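(* Let $M$ be a connected orientable hypersurface of $\mathbb{CP}^{3}\setminus\mathbb{CP}^{2}$, $\eta$ a unit normal vector field along $M$ and $\gamma:M\to\mathbb{R}^{6}$, $\gamma(x)=\Gamma_x(\eta(x))$, the associated Gauss map. Then $$\Delta\gamma(x)=-5\,\Gamma_{x}\left(\operatorname{grad}H(x)\right)-\left(8+\|A(x)\|^{2}\right)\gamma(x),\quad x\in M,$$ where $H$ and $A$ are the mean curvature function and the second fundamental form of $M$. In particular, $M$ has constant mean curvature if and only if $\gamma$ satisfies the vectorial PDE $$\Delta\gamma=-\left(8+\|A(x)\|^{2}\right)\gamma .$$
   Context: $\mathbb{S}^7$ is the unit sphere of $\mathbb{R}^8$ identified with the octonions, with multiplication $\cdot$, unit $1=e_0$ and canonical basis $e_0,e_1,\dots,e_7$ (orthonormal, $e_1,\dots,e_7$ imaginary units, e.g. $e_m\cdot e_{m+1}=e_{m+3}$ with indices mod $7$); $i=e_1$, $e^{i\theta}=\cos\theta+(\sin\theta)\, i$. The circle acts on $\mathbb{S}^7$ by $x\mapsto e^{i\theta}\cdot x$; $\mathbb{CP}^3=\mathbb{S}^7/\mathbb{S}^1$ with projection $\pi$ carries the Fubini-Study metric making $\pi$ a Riemannian submersion. $\mathbb{CP}^2\subset\mathbb{CP}^3$ is the cut locus of $\pi(1)$, i.e. the image under $\pi$ of the points of $\mathbb{S}^7$ whose $e_0$- and $e_1$-coordinates vanish. For $v\in T_1\mathbb{S}^7$ let $$W_v(x)=\tfrac12\left(x\cdot v-i\cdot((i\cdot x)\cdot v)\right),\quad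 x\in\mathbb{S}^7,$$ a vector field on $\mathbb{S}^7$ satisfying $W_v(e^{i\phi}\cdot x)=e^{i\phi}\cdot W_v(x)$. It therefore induces vector fields on $\mathbb{CP}^3$: $Z_n(z)=d\pi_x(W_{e_{n+1}}(x))$ for any $x\in\pi^{-1}(z)$, $1\le n\le 6$. Define $\Gamma_z(w)=\left(\langle w,Z_1(z)\rangle,\dots,\langle w,Z_6(z)\rangle\right)\in\mathbb{R}^6$ for $z\in\mathbb{CP}^3\setminus\mathbb{CP}^2$, $w\in T_z\mathbb{CP}^3$. The Laplacian $\Delta\gamma$ is taken componentwise, with $\Delta=\operatorname{div}\operatorname{grad}$ the Laplacian of $M$ in the induced metric. Conventions: $A(X)=-\nabla_X\eta$, $H=\frac15\operatorname{tr}A$, $\|A\|^2=\operatorname{tr}(A^2)$. *)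

theory Defs
  imports "HOL-Analysis.Analysis"
begin

section \<open>Smooth maps\<close>

text \<open>For open \<open>S\<close>: all iterated partial derivatives up to order \<open>k\<close> exist and are continuous.\<close>

primrec Ck_on :: "nat \<Rightarrow> 'a::euclidean_space set \<Rightarrow> ('a \<Rightarrow> 'b::real_normed_vector) \<Rightarrow> bool" where
  "Ck_on 0 S f \<longleftrightarrow> continuous_on S f"
| "Ck_on (Suc k) S f \<longleftrightarrow>
     (\<forall>x\<in>S. f differentiable (at x)) \<and>
     (\<forall>b\<in>Basis. Ck_on k S (\<lambda>x. frechet_derivative f (at x) b))"

definition smooth_on :: "'a::euclidean_space set \<Rightarrow> ('a \<Rightarrow> 'b::real_normed_vector) \<Rightarrow> bool" where
  "smooth_on S f \<longleftrightarrow> (\<forall>k. Ck_on k S f)"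


section \<open>Riemannian geometry in local coordinates\<close>

text \<open>A metric on an open subset of \<open>\<real>\<^sup>n\<close> is given by its Gram matrix \<open>g u\<close> in the coordinate frame.\<close>

abbreviation pderiv_at :: "(real^'n \<Rightarrow> 'b::real_normed_vector) \<Rightarrow> real^'n \<Rightarrow> 'n \<Rightarrow> 'b" where
  "pderiv_at f u i \<equiv> frechet_derivative f (at u) (axis i 1)"

text \<open>The Levi-Civita connection of \<open>g\<close>: \<open>\<nabla>\<^bsub>\<partial>\<^sub>i\<^esub> \<partial>\<^sub>j = (\<Sum>k. christoffel g u k i j \<partial>\<^sub>k)\<close>.\<close>

definition christoffel :: "(real^'n \<Rightarrow> real^'n^'n) \<Rightarrow> real^'n \<Rightarrow> 'n \<Rightarrow> 'n \<Rightarrow> 'n \<Rightarrow> real" where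
  "christoffel g u k i j =
     (1/2) * (\<Sum>l\<in>UNIV. matrix_inv (g u) $ k $ l *
        (pderiv_at g u i $ j $ l + pderiv_at g u j $ i $ l - pderiv_at g u l $ i $ j))"

text \<open>Covariant derivative at \<open>u\<close> in direction \<open>a\<close> of a vector field \<open>V\<close> along a map \<open>F\<close>.\<close>

definition cov_deriv_along ::
  "(real^'n \<Rightarrow> real^'n^'n) \<Rightarrow> (real^'m \<Rightarrow> real^'n) \<Rightarrow> (real^'m \<Rightarrow> real^'n) \<Rightarrow> real^'m \<Rightarrow> real^'m \<Rightarrow> real^'n" where
  "cov_deriv_along g F V u a =
     frechet_derivative V (at u) a +
     (\<chi> k. \<Sum>i\<in>UNIV. \<Sum>j\<in>UNIV.
        christoffel g (F u) k i j * frechet_derivative F (at u) a $ i * V u $ j)"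

definition cgrad :: "(real^'n \<Rightarrow> real^'n^'n) \<Rightarrow> (real^'n \<Rightarrow> real) \<Rightarrow> real^'n \<Rightarrow> real^'n" where
  "cgrad g f u = matrix_inv (g u) *v (\<chi> i. pderiv_at f u i)"

definition cdiv :: "(real^'n \<Rightarrow> real^'n^'n) \<Rightarrow> (real^'n \<Rightarrow> real^'n) \<Rightarrow> real^'n \<Rightarrow> real" where
  "cdiv g V u = trace (matrix (cov_deriv_along g (\<lambda>x. x) V u))"

definition claplace :: "(real^'n \<Rightarrow> real^'n^'n) \<Rightarrow> (real^'n \<Rightarrow> real) \<Rightarrow> real^'n \<Rightarrow> real" where
  "claplace g f = cdiv g (cgrad g f)"


section \<open>Octonions\<close>

text \<open>Real part and imaginary part. The index type \<open>7\<close> has arithmetic modulo 7, so \<open>e\<^sub>7\<close> is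
  \<open>axis 0 1\<close>. The product is the one with \<open>e\<^sub>m e\<^sub>m\<^sub>+\<^sub>1 = e\<^sub>m\<^sub>+\<^sub>3\<close>, each triple \<open>(m, m+1, m+3)\<close> behaving
  like the quaternion units; below, \<open>c\<close> is the third, second or first member of its three triples,
  listed by the remaining two in the order in which their product is \<open>e\<^sub>c\<close>.\<close>

type_synonym octonion = "real \<times> (real^7)"

definition oct_mult :: "octonion \<Rightarrow> octonion \<Rightarrow> octonion" (infixl \<open>\<odot>\<close> 70) where
  "x \<odot> y =
     (fst x * fst y - snd x \<bullet> snd y,
      \<chi> c. fst x * snd y $ c + snd x $ c * fst y
         + (snd x $ (c+4) * snd y $ (c+5) - snd x $ (c+5) * snd y $ (c+4))
         + (snd x $ (c+2) * snd y $ (c+6) - snd x $ (c+6) * snd y $ (c+2))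
         + (snd x $ (c+1) * snd y $ (c+3) - snd x $ (c+3) * snd y $ (c+1)))"

definition oct_e :: "nat \<Rightarrow> octonion" where
  "oct_e m = (if m = 0 then (1, 0) else (0, axis (of_nat m) 1))"

abbreviation oct_i :: octonion where "oct_i \<equiv> oct_e 1"


section \<open>Complex projective space\<close>

definition hopf :: "octonion \<Rightarrow> octonion set" where
  "hopf x = {(cos \<theta> *\<^sub>R oct_e 0 + sin \<theta> *\<^sub>R oct_i) \<odot> x | \<theta>. True}"

definition CP3 :: "octonion set set" where
  "CP3 = hopf ` sphere 0 1"

definition CP2 :: "octonion set set" where
  "CP2 = hopf ` {x \<in> sphere 0 1. x \<bullet> oct_e 0 = 0 \<and> x \<bullet> oct_e 1 = 0}"

text \<open>\<open>CP3 - CP2\<close> is the domain of an affine chart, onto \<open>\<real>\<^sup>6\<close>: writing \<open>x = a + b\<close> with \<open>a\<close> in the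
  span of \<open>e\<^sub>0, e\<^sub>1\<close> and \<open>b\<close> in the span of \<open>e\<^sub>2, \<dots>, e\<^sub>7\<close>, the chart sends the orbit of \<open>x\<close> to the
  coordinates of \<open>a\<^sup>-\<^sup>1 b\<close>, where \<open>a\<^sup>-\<^sup>1\<close> is the conjugate of \<open>a\<close> divided by \<open>|a|\<^sup>2\<close>.
  Tangent vectors of \<open>CP3\<close> at points of \<open>CP3 - CP2\<close> are given by their components in this chart.\<close>

definition cp_chart :: "octonion set \<Rightarrow> real^6" where
  "cp_chart z =
     (let x = (SOME x. x \<in> z);
          a0 = x \<bullet> oct_e 0; a1 = x \<bullet> oct_e 1;
          b = x - a0 *\<^sub>R oct_e 0 - a1 *\<^sub>R oct_e 1;
          y = ((a0 *\<^sub>R oct_e 0 - a1 *\<^sub>R oct_e 1) /\<^sub>R (a0\<^sup>2 + a1\<^sup>2)) \<odot> b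
      in vector (map (\<lambda>n. y \<bullet> oct_e (n + 1)) [1..<7]))"

text \<open>The differential at \<open>x\<close> of the projection of the sphere, applied to a tangent vector \<open>X\<close> of the
  sphere; the projection is extended radially to be defined on an open set.\<close>

definition dhopf :: "octonion \<Rightarrow> octonion \<Rightarrow> real^6" where
  "dhopf x X = frechet_derivative (\<lambda>y. cp_chart (hopf (sgn y))) (at x) X"

text \<open>The tangent vector of the sphere at \<open>x\<close>, orthogonal to the fibre, that projects to \<open>w\<close>. The
  Fubini-Study metric makes \<open>dhopf x\<close> isometric on such vectors.\<close>

definition hlift :: "octonion \<Rightarrow> real^6 \<Rightarrow> octonion" where
  "hlift x w = (THE X. X \<bullet> x = 0 \<and> X \<bullet> (oct_i \<odot> x) = 0 \<and> dhopf x X = w)"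

definition fubini_study :: "octonion set \<Rightarrow> real^6 \<Rightarrow> real^6 \<Rightarrow> real" where
  "fubini_study z w w' = (let x = (SOME x. x \<in> z) in hlift x w \<bullet> hlift x w')"

definition fs_matrix :: "real^6 \<Rightarrow> real^6^6" where
  "fs_matrix u =
     (let z = inv_into (CP3 - CP2) cp_chart u
      in \<chi> i j. fubini_study z (axis i 1) (axis j 1))"

definition W_field :: "octonion \<Rightarrow> octonion \<Rightarrow> octonion" where
  "W_field v x = (1/2) *\<^sub>R (x \<odot> v - oct_i \<odot> ((oct_i \<odot> x) \<odot> v))"

definition Z_field :: "nat \<Rightarrow> octonion set \<Rightarrow> real^6" where
  "Z_field n z = (let x = (SOME x. x \<in> z) in dhopf x (W_field (oct_e (n + 1)) x))"

definition Gauss_transl :: "octonion set \<Rightarrow> real^6 \<Rightarrow> real^6" where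
  "Gauss_transl z w = vector (map (\<lambda>n. fubini_study z w (Z_field n z)) [1..<7])"


section \<open>Hypersurfaces\<close>

text \<open>A hypersurface is a topological 5-manifold \<open>X\<close> with a map \<open>\<iota>\<close> into \<open>CP3 - CP2\<close> that is a smooth
  immersion in suitable local parametrizations. The smooth structure of \<open>X\<close> is determined by \<open>\<iota>\<close>:
  transition maps between the parametrizations below are automatically smooth. An embedded
  hypersurface is the case of a subset of \<open>CP3 - CP2\<close> with the subspace topology and \<open>\<iota> = id\<close>.\<close>

definition local_param ::
  "'m topology \<Rightarrow> ('m \<Rightarrow> octonion set) \<Rightarrow> (real^5) set \<Rightarrow> (real^5 \<Rightarrow> 'm) \<Rightarrow> bool" where
  "local_param X \<iota> U \<phi> \<longleftrightarrow>
     open U \<and> openin X (\<phi> ` U) \<and>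
     homeomorphic_map (top_of_set U) (subtopology X (\<phi> ` U)) \<phi> \<and>
     smooth_on U (cp_chart \<circ> \<iota> \<circ> \<phi>) \<and>
     (\<forall>u\<in>U. inj (frechet_derivative (cp_chart \<circ> \<iota> \<circ> \<phi>) (at u)))"

definition hypersurface :: "'m topology \<Rightarrow> ('m \<Rightarrow> octonion set) \<Rightarrow> bool" where
  "hypersurface X \<iota> \<longleftrightarrow>
     Hausdorff_space X \<and> second_countable X \<and>
     \<iota> ` topspace X \<subseteq> CP3 - CP2 \<and>
     (\<forall>p\<in>topspace X. \<exists>U \<phi>. local_param X \<iota> U \<phi> \<and> p \<in> \<phi> ` U)"

definition orientable :: "'m topology \<Rightarrow> ('m \<Rightarrow> octonion set) \<Rightarrow> bool" where
  "orientable X \<iota> \<longleftrightarrow>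
     (\<exists>\<A>. (\<forall>(U, \<phi>)\<in>\<A>. local_param X \<iota> U \<phi>) \<and>
          (\<forall>p\<in>topspace X. \<exists>(U, \<phi>)\<in>\<A>. p \<in> \<phi> ` U) \<and>
          (\<forall>(U, \<phi>)\<in>\<A>. \<forall>(V, \<psi>)\<in>\<A>. \<forall>u\<in>U. \<phi> u \<in> \<psi> ` V \<longrightarrow>
             det (matrix (frechet_derivative (inv_into V \<psi> \<circ> \<phi>) (at u))) > 0))"

text \<open>Pointwise objects on the hypersurface are computed in some local parametrization \<open>\<phi>\<close> with
  \<open>\<phi> u = p\<close>; they do not depend on its choice.\<close>

definition param_at :: "'m topology \<Rightarrow> ('m \<Rightarrow> octonion set) \<Rightarrow> 'm \<Rightarrow> (real^5 \<Rightarrow> 'm) \<times> (real^5)" where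
  "param_at X \<iota> p = (SOME (\<phi>, u). \<exists>U. local_param X \<iota> U \<phi> \<and> u \<in> U \<and> \<phi> u = p)"

definition dparam_at :: "'m topology \<Rightarrow> ('m \<Rightarrow> octonion set) \<Rightarrow> 'm \<Rightarrow> real^5 \<Rightarrow> real^6" where
  "dparam_at X \<iota> p = (case param_at X \<iota> p of (\<phi>, u) \<Rightarrow>
     frechet_derivative (cp_chart \<circ> \<iota> \<circ> \<phi>) (at u))"

definition tangent_space :: "'m topology \<Rightarrow> ('m \<Rightarrow> octonion set) \<Rightarrow> 'm \<Rightarrow> (real^6) set" where
  "tangent_space X \<iota> p = range (dparam_at X \<iota> p)"

definition unit_normal :: "'m topology \<Rightarrow> ('m \<Rightarrow> octonion set) \<Rightarrow> ('m \<Rightarrow> real^6) \<Rightarrow> bool" where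
  "unit_normal X \<iota> \<eta> \<longleftrightarrow>
     (\<forall>U \<phi>. local_param X \<iota> U \<phi> \<longrightarrow> smooth_on U (\<eta> \<circ> \<phi>)) \<and>
     (\<forall>p\<in>topspace X. fubini_study (\<iota> p) (\<eta> p) (\<eta> p) = 1 \<and>
        (\<forall>w\<in>tangent_space X \<iota> p. fubini_study (\<iota> p) (\<eta> p) w = 0))"

text \<open>\<open>A(w) = - \<nabla>\<^sub>w \<eta>\<close> for \<open>w\<close> in the tangent space at \<open>p\<close>, \<open>\<nabla>\<close> the connection of \<open>CP3\<close>.\<close>

definition shape_op ::
  "'m topology \<Rightarrow> ('m \<Rightarrow> octonion set) \<Rightarrow> ('m \<Rightarrow> real^6) \<Rightarrow> 'm \<Rightarrow> real^6 \<Rightarrow> real^6" where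
  "shape_op X \<iota> \<eta> p w = (case param_at X \<iota> p of (\<phi>, u) \<Rightarrow>
     - cov_deriv_along fs_matrix (cp_chart \<circ> \<iota> \<circ> \<phi>) (\<eta> \<circ> \<phi>) u (inv (dparam_at X \<iota> p) w))"

text \<open>\<open>L\<close> maps the tangent space at \<open>p\<close> to itself; its matrix is taken in the coordinate frame. As
  \<open>dparam_at\<close> is injective, \<open>inv\<close> is its inverse on the tangent space.\<close>

definition tangent_trace ::
  "'m topology \<Rightarrow> ('m \<Rightarrow> octonion set) \<Rightarrow> 'm \<Rightarrow> (real^6 \<Rightarrow> real^6) \<Rightarrow> real" where
  "tangent_trace X \<iota> p L = trace (matrix (inv (dparam_at X \<iota> p) \<circ> L \<circ> dparam_at X \<iota> p))"

definition mean_curv ::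
  "'m topology \<Rightarrow> ('m \<Rightarrow> octonion set) \<Rightarrow> ('m \<Rightarrow> real^6) \<Rightarrow> 'm \<Rightarrow> real" where
  "mean_curv X \<iota> \<eta> p = (1/5) * tangent_trace X \<iota> p (shape_op X \<iota> \<eta> p)"

definition shape_norm_sq ::
  "'m topology \<Rightarrow> ('m \<Rightarrow> octonion set) \<Rightarrow> ('m \<Rightarrow> real^6) \<Rightarrow> 'm \<Rightarrow> real" where
  "shape_norm_sq X \<iota> \<eta> p = tangent_trace X \<iota> p (shape_op X \<iota> \<eta> p \<circ> shape_op X \<iota> \<eta> p)"

definition induced_metric :: "('m \<Rightarrow> octonion set) \<Rightarrow> (real^5 \<Rightarrow> 'm) \<Rightarrow> real^5 \<Rightarrow> real^5^5" where
  "induced_metric \<iota> \<phi> v =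
     (\<chi> i j. fubini_study (\<iota> (\<phi> v))
        (pderiv_at (cp_chart \<circ> \<iota> \<circ> \<phi>) v i) (pderiv_at (cp_chart \<circ> \<iota> \<circ> \<phi>) v j))"

text \<open>The gradient on the hypersurface, as a tangent vector of \<open>CP3\<close>.\<close>

definition hs_grad ::
  "'m topology \<Rightarrow> ('m \<Rightarrow> octonion set) \<Rightarrow> ('m \<Rightarrow> real) \<Rightarrow> 'm \<Rightarrow> real^6" where
  "hs_grad X \<iota> f p = (case param_at X \<iota> p of (\<phi>, u) \<Rightarrow>
     dparam_at X \<iota> p (cgrad (induced_metric \<iota> \<phi>) (f \<circ> \<phi>) u))"

definition hs_laplace ::
  "'m topology \<Rightarrow> ('m \<Rightarrow> octonion set) \<Rightarrow> ('m \<Rightarrow> real) \<Rightarrow> 'm \<Rightarrow> real" where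
  "hs_laplace X \<iota> f p = (case param_at X \<iota> p of (\<phi>, u) \<Rightarrow>
     claplace (induced_metric \<iota> \<phi>) (f \<circ> \<phi>) u)"

definition hs_vec_laplace ::
  "'m topology \<Rightarrow> ('m \<Rightarrow> octonion set) \<Rightarrow> ('m \<Rightarrow> real^'k) \<Rightarrow> 'm \<Rightarrow> real^'k" where
  "hs_vec_laplace X \<iota> f p = (\<chi> n. hs_laplace X \<iota> (\<lambda>q. f q $ n) p)"

definition Gauss_map ::
  "('m \<Rightarrow> octonion set) \<Rightarrow> ('m \<Rightarrow> real^6) \<Rightarrow> 'm \<Rightarrow> real^6" where
  "Gauss_map \<iota> \<eta> p = Gauss_transl (\<iota> p) (\<eta> p)"

end

theory Submission
  imports Defs
begin

text \<open>Everything is lifted to \<open>\<real>\<^sup>8\<close>. The affine chart has the section \<open>y \<mapsto> (e\<^sub>0 + y) / sqrt (1 + |y|\<^sup>2)\<close> into the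
  sphere, so a hypersurface becomes a map \<open>x\<close> into the sphere, tangent vectors become vectors orthogonal to \<open>x\<close>
  and \<open>i x\<close>, and by the Koszul formula the Levi-Civita connection of the Fubini-Study metric becomes the projected
  derivative, corrected by a phase term because \<open>x\<close> is not horizontal.

  For imaginary \<open>v\<close> orthogonal to \<open>i\<close> the field \<open>W\<^sub>v\<close> is the skew map
  \<open>x \<mapsto> \<langle>x,e\<^sub>0\<rangle> v + \<langle>x,i\<rangle> i v - \<langle>x,v\<rangle> e\<^sub>0 - \<langle>x,i v\<rangle> i\<close>, which commutes with \<open>i\<close>; it induces a Killing field on
  \<open>CP\<^sup>3\<close>, and the components of \<open>\<gamma>\<close> are the support functions \<open>\<langle>N, W\<^sub>v x\<rangle>\<close>. The Codazzi equation, in which the trace of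
  the curvature term vanishes, together with the contribution of the second derivative of the Killing field, which is
  \<open>-8\<close>, gives the formula for the Laplacian.

  For the converse, \<open>\<Gamma>\<close> is injective away from the geodesic sphere \<open>|y| = 1\<close>, so there the equation forces
  \<open>grad H = 0\<close>. On this sphere \<open>\<Gamma>\<close> has a kernel. In the interior of the part of the hypersurface that lies on it,
  \<open>H\<close> is locally constant because the sphere has constant mean curvature, and the remaining points are reached by continuity.\<close>

section \<open>Smooth maps\<close>

text \<open>The constant 8 is the Einstein constant of CP^3 at holomorphic sectional curvature 4,
  found below as m + 3 with m = 5. It acts in two ways: Ric(N, X) = 0 for tangential X is what makes
  the traced curvature term of the Codazzi equation vanish, and the trace of the second derivative
  of a Killing field W, paired with N, is -Ric(N, W) = -8 times the support function.

  The main obstacle outside the calculation is choice. An orbit is accessed through a chosen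
  representative, a horizontal lift through a definite description, and every point of the
  hypersurface through a parametrization chosen anew. Values of H at neighbouring points thus come
  from unrelated parametrizations, and already the differentiability of H requires a comparison of
  parametrizations whose transition maps are at first only continuous.

  On |y| = 1 the kernel of the Gauss translation is the line spanned by i times the radial
  direction, which is tangent to that geodesic sphere. There the pointwise equation says nothing
  about the component of grad H along this line, so an argument on open sets has to replace the
  pointwise one.\<close>

lemma Ck_on_cong:
  assumes "open S" "\<And>x. x \<in> S \<Longrightarrow> f x = g x"
  shows "Ck_on k S f \<longleftrightarrow> Ck_on k S g"
proof -
  have *: "Ck_on k S g" if "\<And>x. x \<in> S \<Longrightarrow> f x = g x" "Ck_on k S f" for f g :: "'a \<Rightarrow> 'b"
    using that
  proof (induction k arbitrary: f g)
    case 0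
    then show ?case by (simp cong: continuous_on_cong)
  next
    case (Suc k)
    have d: "(g has_derivative frechet_derivative f (at x)) (at x)" if "x \<in> S" for x
      using Suc.prems that has_derivative_transform_within_open[OF _ assms(1) that, where f = f and g = g]
      by (simp add: frechet_derivative_works)
    then have "frechet_derivative g (at x) = frechet_derivative f (at x)" if "x \<in> S" for x
      using that frechet_derivative_at by metis
    then have "Ck_on k S (\<lambda>x. frechet_derivative g (at x) b)" if "b \<in> Basis" for b
      using Suc.IH[of "\<lambda>x. frechet_derivative f (at x) b"] Suc.prems that by simp
    then show ?case using d by (auto simp: differentiable_def)
  qed
  show ?thesis using *[of f g] *[of g f] assms by auto
qed

text \<open>An explicit formula for the derivative takes the place of the choice term
  \<open>frechet_derivative\<close>. The closure lemmas below are inductions on k through this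
  rule.\<close>

lemma Ck_on_SucI:
  assumes "open S" "\<And>x. x \<in> S \<Longrightarrow> (f has_derivative f' x) (at x)"
    and "\<And>b. b \<in> Basis \<Longrightarrow> Ck_on k S (\<lambda>x. f' x b)"
  shows "Ck_on (Suc k) S f"
proof -
  have "frechet_derivative f (at x) = f' x" if "x \<in> S" for x
    using frechet_derivative_at[OF assms(2)[OF that]] by simp
  then have "Ck_on k S (\<lambda>x. frechet_derivative f (at x) b)" if "b \<in> Basis" for b
    using Ck_on_cong[OF assms(1), of "\<lambda>x. f' x b" "\<lambda>x. frechet_derivative f (at x) b"] assms(3)[OF that]
    by simp
  then show ?thesis using assms(2) by (auto simp: differentiable_def)
qed

lemma Ck_on_Suc_has_derivative:
  "Ck_on (Suc k) S f \<Longrightarrow> x \<in> S \<Longrightarrow> (f has_derivative frechet_derivative f (at x)) (at x)"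
  by (simp add: frechet_derivative_works)

lemma Ck_on_continuous: "Ck_on k S f \<Longrightarrow> continuous_on S f"
  by (cases k) (simp_all add: continuous_at_imp_continuous_on differentiable_imp_continuous_within)

lemma Ck_on_lower: "Ck_on (Suc k) S f \<Longrightarrow> Ck_on k S f"
proof (induction k arbitrary: f)
  case 0
  then show ?case using Ck_on_continuous[of "Suc 0"] by simp
next
  case (Suc k)
  then show ?case unfolding Ck_on.simps(2)[of _ S f] by blast
qed

lemma Ck_on_const: "Ck_on k S (\<lambda>x. c)"
  by (induction k arbitrary: c) auto

lemma Ck_on_bounded_linear:
  assumes "open S" "bounded_linear L"
  shows "Ck_on k S f \<Longrightarrow> Ck_on k S (\<lambda>x. L (f x))"
proof (induction k arbitrary: f)
  case 0
  then show ?case using bounded_linear.continuous_on[OF assms(2)] by simp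
next
  case (Suc k)
  show ?case
  proof (rule Ck_on_SucI[OF assms(1)])
    show "((\<lambda>x. L (f x)) has_derivative (\<lambda>h. L (frechet_derivative f (at x) h))) (at x)" if "x \<in> S" for x
      using Ck_on_Suc_has_derivative[OF Suc.prems that] bounded_linear.has_derivative[OF assms(2)] by blast
  qed (use Suc in auto)
qed

lemma Ck_on_add:
  assumes "open S"
  shows "Ck_on k S f \<Longrightarrow> Ck_on k S g \<Longrightarrow> Ck_on k S (\<lambda>x. f x + g x)"
proof (induction k arbitrary: f g)
  case 0
  then show ?case by (simp add: continuous_on_add)
next
  case (Suc k)
  show ?case
  proof (rule Ck_on_SucI[OF assms(1)])
    show "((\<lambda>x. f x + g x) has_derivative
        (\<lambda>h. frechet_derivative f (at x) h + frechet_derivative g (at x) h)) (at x)" if "x \<in> S" for x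
      using Suc.prems that by (intro has_derivative_add Ck_on_Suc_has_derivative)
  qed (use Suc in auto)
qed

lemma Ck_on_bilinear:
  assumes "open S" "bounded_bilinear B"
  shows "Ck_on k S f \<Longrightarrow> Ck_on k S g \<Longrightarrow> Ck_on k S (\<lambda>x. B (f x) (g x))"
proof (induction k arbitrary: f g)
  case 0
  then show ?case using bounded_bilinear.continuous_on[OF assms(2)] by simp
next
  case (Suc k)
  show ?case
  proof (rule Ck_on_SucI[OF assms(1)])
    show "((\<lambda>x. B (f x) (g x)) has_derivative
        (\<lambda>h. B (f x) (frechet_derivative g (at x) h) + B (frechet_derivative f (at x) h) (g x))) (at x)"
      if "x \<in> S" for x
      using Suc.prems that by (intro bounded_bilinear.FDERIV[OF assms(2)] Ck_on_Suc_has_derivative)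
    show "Ck_on k S (\<lambda>x. B (f x) (frechet_derivative g (at x) b) + B (frechet_derivative f (at x) b) (g x))"
      if "b \<in> Basis" for b
      using Suc.prems that Suc.IH[of f "\<lambda>x. frechet_derivative g (at x) b"]
        Suc.IH[of "\<lambda>x. frechet_derivative f (at x) b" g] Ck_on_lower[of k S f] Ck_on_lower[of k S g]
      by (intro Ck_on_add assms(1)) simp_all
  qed
qed

text \<open>The derivative is a product of the derivative of f with two copies of the inverse
  itself, so the induction closes on itself.\<close>

lemma Ck_on_inverse:
  fixes f :: "'a::euclidean_space \<Rightarrow> real"
  assumes "open S" "\<And>x. x \<in> S \<Longrightarrow> f x \<noteq> 0"
  shows "Ck_on k S f \<Longrightarrow> Ck_on k S (\<lambda>x. inverse (f x))"
proof (induction k)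
  case 0
  then show ?case using assms by (auto intro: continuous_on_inverse)
next
  case (Suc k)
  show ?case
  proof (rule Ck_on_SucI[OF assms(1)])
    show "((\<lambda>x. inverse (f x)) has_derivative
       (\<lambda>h. - (inverse (f x) * frechet_derivative f (at x) h * inverse (f x)))) (at x)" if "x \<in> S" for x
      using Suc.prems that assms(2) by (intro Deriv.has_derivative_inverse Ck_on_Suc_has_derivative)
    have "Ck_on k S (\<lambda>x. inverse (f x))" using Suc.IH Ck_on_lower Suc.prems by blast
    then show "Ck_on k S (\<lambda>x. - (inverse (f x) * frechet_derivative f (at x) b * inverse (f x)))"
      if "b \<in> Basis" for b
      using Suc.prems that
      by (intro Ck_on_bounded_linear[OF assms(1) bounded_linear_minus[OF bounded_linear_ident]]
          Ck_on_bilinear[OF assms(1) bounded_bilinear_mult]) auto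
  qed
qed

lemma Ck_on_inverse_sqrt:
  fixes f :: "'a::euclidean_space \<Rightarrow> real"
  assumes "open S" "\<And>x. x \<in> S \<Longrightarrow> f x > 0"
  shows "Ck_on k S f \<Longrightarrow> Ck_on k S (\<lambda>x. inverse (sqrt (f x)))"
proof (induction k)
  case 0
  then have "continuous_on S (\<lambda>x. sqrt (f x))" by (simp add: continuous_on_real_sqrt)
  moreover have "\<forall>x\<in>S. sqrt (f x) \<noteq> 0" using assms(2) by fastforce
  ultimately show ?case by (simp add: continuous_on_inverse)
next
  case (Suc k)
  let ?r = "\<lambda>x. inverse (sqrt (f x))"
  show ?case
  proof (rule Ck_on_SucI[OF assms(1)])
    show "(?r has_derivative
       (\<lambda>h. (- 1 / 2) * (?r x * (?r x * (?r x * frechet_derivative f (at x) h))))) (at x)" if "x \<in> S" for x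
    proof -
      have "((\<lambda>x. sqrt (f x)) has_derivative (\<lambda>h. frechet_derivative f (at x) h * (?r x / 2))) (at x)"
        using DERIV_real_sqrt[OF assms(2)[OF that]] Ck_on_Suc_has_derivative[OF Suc.prems that]
        by (rule DERIV_compose_FDERIV)
      then have "(?r has_derivative (\<lambda>h. - (?r x * (frechet_derivative f (at x) h * (?r x / 2)) * ?r x))) (at x)"
        using assms(2)[OF that] by (intro Deriv.has_derivative_inverse) simp_all
      then show ?thesis by (rule has_derivative_eq_rhs) (simp add: fun_eq_iff)
    qed
    have "Ck_on k S ?r" using Suc.IH Ck_on_lower Suc.prems by blast
    then show "Ck_on k S (\<lambda>x. (- 1 / 2) * (?r x * (?r x * (?r x * frechet_derivative f (at x) b))))"
      if "b \<in> Basis" for b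
      using Suc.prems that
      by (intro Ck_on_bilinear[OF assms(1) bounded_bilinear_mult] Ck_on_const) simp_all
  qed
qed

lemma smooth_on_const [simp]: "smooth_on S (\<lambda>x. c)"
  by (simp add: smooth_on_def Ck_on_const)

lemma smooth_on_bounded_linear:
  "open S \<Longrightarrow> bounded_linear L \<Longrightarrow> smooth_on S f \<Longrightarrow> smooth_on S (\<lambda>x. L (f x))"
  unfolding smooth_on_def by (rule allI, rule Ck_on_bounded_linear) simp_all

lemma smooth_on_bilinear:
  "open S \<Longrightarrow> bounded_bilinear B \<Longrightarrow> smooth_on S f \<Longrightarrow> smooth_on S g \<Longrightarrow> smooth_on S (\<lambda>x. B (f x) (g x))"
  unfolding smooth_on_def by (rule allI, rule Ck_on_bilinear) simp_all

lemma smooth_on_add: "open S \<Longrightarrow> smooth_on S f \<Longrightarrow> smooth_on S g \<Longrightarrow> smooth_on S (\<lambda>x. f x + g x)"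
  by (simp add: smooth_on_def Ck_on_add)

lemma smooth_on_minus: "open S \<Longrightarrow> smooth_on S f \<Longrightarrow> smooth_on S (\<lambda>x. - f x)"
  by (rule smooth_on_bounded_linear[OF _ bounded_linear_minus[OF bounded_linear_ident]])

lemma smooth_on_diff: "open S \<Longrightarrow> smooth_on S f \<Longrightarrow> smooth_on S g \<Longrightarrow> smooth_on S (\<lambda>x. f x - g x)"
  using smooth_on_add[of S f "\<lambda>x. - g x"] smooth_on_minus by auto

lemma smooth_on_scaleR: "open S \<Longrightarrow> smooth_on S f \<Longrightarrow> smooth_on S g \<Longrightarrow> smooth_on S (\<lambda>x. f x *\<^sub>R g x)"
  by (rule smooth_on_bilinear[OF _ bounded_bilinear_scaleR])

lemma smooth_on_mult:
  "open S \<Longrightarrow> smooth_on S f \<Longrightarrow> smooth_on S g \<Longrightarrow> smooth_on S (\<lambda>x. f x * g x :: real)"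
  by (rule smooth_on_bilinear[OF _ bounded_bilinear_mult])

lemma smooth_on_inner:
  fixes f g :: "'a::euclidean_space \<Rightarrow> 'b::real_inner"
  shows "open S \<Longrightarrow> smooth_on S f \<Longrightarrow> smooth_on S g \<Longrightarrow> smooth_on S (\<lambda>x. f x \<bullet> g x)"
  by (rule smooth_on_bilinear[OF _ bounded_bilinear_inner])

lemma smooth_on_inverse:
  "open S \<Longrightarrow> smooth_on S f \<Longrightarrow> (\<And>x. x \<in> S \<Longrightarrow> f x \<noteq> 0) \<Longrightarrow> smooth_on S (\<lambda>x. inverse (f x) :: real)"
  by (simp add: smooth_on_def Ck_on_inverse)

lemma smooth_on_inverse_sqrt:
  "open S \<Longrightarrow> smooth_on S f \<Longrightarrow> (\<And>x. x \<in> S \<Longrightarrow> f x > 0) \<Longrightarrow> smooth_on S (\<lambda>x. inverse (sqrt (f x)))"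
  by (simp add: smooth_on_def Ck_on_inverse_sqrt)

lemma smooth_on_sum:
  "open S \<Longrightarrow> (\<And>i. i \<in> I \<Longrightarrow> smooth_on S (f i)) \<Longrightarrow> smooth_on S (\<lambda>x. \<Sum>i\<in>I. f i x)"
  by (induction I rule: infinite_finite_induct) (auto intro: smooth_on_add)

lemma smooth_on_prod:
  "open S \<Longrightarrow> (\<And>i. i \<in> I \<Longrightarrow> smooth_on S (f i)) \<Longrightarrow> smooth_on S (\<lambda>x. \<Prod>i\<in>I. f i x :: real)"
  by (induction I rule: infinite_finite_induct) (auto intro: smooth_on_mult)

lemma smooth_on_cong:
  "open S \<Longrightarrow> (\<And>x. x \<in> S \<Longrightarrow> f x = g x) \<Longrightarrow> smooth_on S f \<longleftrightarrow> smooth_on S g"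
  unfolding smooth_on_def by (simp add: Ck_on_cong[of S f g])

lemma smooth_on_imp_differentiable: "smooth_on S f \<Longrightarrow> x \<in> S \<Longrightarrow> f differentiable (at x)"
  unfolding smooth_on_def by (drule spec[of _ "Suc 0"]) simp

lemma smooth_on_imp_continuous: "smooth_on S f \<Longrightarrow> continuous_on S f"
  unfolding smooth_on_def by (drule spec[of _ 0]) simp

lemma Ck_on_subset: "Ck_on k S f \<Longrightarrow> T \<subseteq> S \<Longrightarrow> Ck_on k T f"
proof (induction k arbitrary: f)
  case 0
  then show ?case using continuous_on_subset[of S f T] by simp
next
  case (Suc k)
  then show ?case unfolding Ck_on.simps(2)[of _ S f] Ck_on.simps(2)[of _ T f] by blast
qed

lemma smooth_on_subset: "smooth_on S f \<Longrightarrow> T \<subseteq> S \<Longrightarrow> smooth_on T f"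
  by (auto simp: smooth_on_def intro: Ck_on_subset)

lemma smooth_on_ident: "open S \<Longrightarrow> smooth_on S (\<lambda>x. x)"
  unfolding smooth_on_def
proof
  fix k show "open S \<Longrightarrow> Ck_on k S (\<lambda>x. x)"
    by (cases k) (auto simp: Ck_on_const)
qed

subsection \<open>Directional derivatives\<close>

text \<open>The direction comes before the function, so that \<open>dirder a f\<close> is again a
  function of the point and can be iterated.\<close>

definition dirder :: "'a::real_normed_vector \<Rightarrow> ('a \<Rightarrow> 'b::real_normed_vector) \<Rightarrow> 'a \<Rightarrow> 'b" where
  "dirder a f u = frechet_derivative f (at u) a"

lemma dirder_eq: "(f has_derivative f') (at u) \<Longrightarrow> dirder a f u = f' a"
  unfolding dirder_def using frechet_derivative_at[of f f' u] by simp

lemma linear_dirder: "f differentiable (at u) \<Longrightarrow> linear (\<lambda>a. dirder a f u)"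
  unfolding dirder_def by (simp add: linear_frechet_derivative)

lemma dirder_const [simp]: "dirder a (\<lambda>x. c) u = 0"
  by (simp add: dirder_def)

lemma has_derivative_dirder: "f differentiable (at u) \<Longrightarrow> (f has_derivative (\<lambda>a. dirder a f u)) (at u)"
  unfolding dirder_def by (simp add: frechet_derivative_works)

lemma dirder_add:
  "f differentiable (at u) \<Longrightarrow> g differentiable (at u) \<Longrightarrow>
     dirder a (\<lambda>x. f x + g x) u = dirder a f u + dirder a g u"
  by (rule dirder_eq) (intro has_derivative_add has_derivative_dirder)

lemma dirder_diff:
  "f differentiable (at u) \<Longrightarrow> g differentiable (at u) \<Longrightarrow>
     dirder a (\<lambda>x. f x - g x) u = dirder a f u - dirder a g u"
  by (rule dirder_eq) (intro has_derivative_diff has_derivative_dirder)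

lemma dirder_minus: "f differentiable (at u) \<Longrightarrow> dirder a (\<lambda>x. - f x) u = - dirder a f u"
  by (rule dirder_eq) (intro has_derivative_minus has_derivative_dirder)

lemma dirder_bounded_linear:
  "bounded_linear L \<Longrightarrow> f differentiable (at u) \<Longrightarrow> dirder a (\<lambda>x. L (f x)) u = L (dirder a f u)"
  by (rule dirder_eq[where f' = "\<lambda>a. L (dirder a f u)"])
    (rule bounded_linear.has_derivative, assumption, rule has_derivative_dirder)

lemma dirder_bilinear:
  "bounded_bilinear B \<Longrightarrow> f differentiable (at u) \<Longrightarrow> g differentiable (at u) \<Longrightarrow>
     dirder a (\<lambda>x. B (f x) (g x)) u = B (f u) (dirder a g u) + B (dirder a f u) (g u)"
  by (rule dirder_eq[where f' = "\<lambda>a. B (f u) (dirder a g u) + B (dirder a f u) (g u)"])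
    (rule bounded_bilinear.FDERIV, assumption, (rule has_derivative_dirder, assumption)+)

lemmas dirder_scaleR = dirder_bilinear[OF bounded_bilinear_scaleR]
lemmas dirder_mult = dirder_bilinear[OF bounded_bilinear_mult]
lemmas dirder_inner = dirder_bilinear[OF bounded_bilinear_inner]

lemma dirder_chain:
  assumes "g differentiable (at u)" "f differentiable (at (g u))"
  shows "dirder a (\<lambda>u. f (g u)) u = dirder (dirder a g u) f (g u)"
  by (rule dirder_eq[OF has_derivative_compose[OF has_derivative_dirder has_derivative_dirder, OF assms]])

lemma dirder_sum:
  "(\<And>i. i \<in> I \<Longrightarrow> f i differentiable (at u)) \<Longrightarrow>
     dirder a (\<lambda>x. \<Sum>i\<in>I. f i x) u = (\<Sum>i\<in>I. dirder a (f i) u)"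
  by (rule dirder_eq[where f' = "\<lambda>a. \<Sum>i\<in>I. dirder a (f i) u"])
    (intro has_derivative_sum has_derivative_dirder)

lemma dirder_cong:
  assumes "open S" "u \<in> S" "\<And>x. x \<in> S \<Longrightarrow> f x = g x"
  shows "dirder a f u = dirder a g u"
proof -
  have "(f has_derivative f') (at u) \<longleftrightarrow> (g has_derivative f') (at u)" for f'
    using has_derivative_transform_within_open[OF _ assms(1,2), where f = f and g = g]
      has_derivative_transform_within_open[OF _ assms(1,2), where f = g and g = f] assms(3) by auto
  then show ?thesis by (simp add: dirder_def frechet_derivative_def)
qed

text \<open>\<open>Ck_on\<close> speaks of basis directions only; a general direction is a constant
  linear combination of them.\<close>

lemma smooth_on_dirder:
  assumes "open S" "smooth_on S f"
  shows "smooth_on S (dirder a f)"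
proof -
  have "Ck_on k S (\<lambda>x. frechet_derivative f (at x) b)" if "b \<in> Basis" for b k
    using assms(2)[unfolded smooth_on_def, rule_format, of "Suc k"] that by simp
  then have D: "smooth_on S (\<lambda>x. frechet_derivative f (at x) b)" if "b \<in> Basis" for b
    using that by (simp add: smooth_on_def)
  have "smooth_on S (\<lambda>x. \<Sum>b\<in>Basis. (a \<bullet> b) *\<^sub>R frechet_derivative f (at x) b)"
    by (intro smooth_on_sum smooth_on_scaleR smooth_on_const assms(1) D)
  moreover have "(\<Sum>b\<in>Basis. (a \<bullet> b) *\<^sub>R frechet_derivative f (at x) b) = dirder a f x" if "x \<in> S" for x
  proof -
    interpret linear "frechet_derivative f (at x)"
      using assms that by (intro linear_frechet_derivative smooth_on_imp_differentiable)
    show ?thesis unfolding dirder_def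
      using sum[of "\<lambda>b. (a \<bullet> b) *\<^sub>R b" Basis] by (simp add: scale euclidean_representation)
  qed
  ultimately show ?thesis
    by (subst (asm) smooth_on_cong[OF assms(1)])
qed

section \<open>Symmetry of second derivatives\<close>

lemma dirder_commute_real:
  fixes f :: "'a::euclidean_space \<Rightarrow> real"
  assumes S: "open S" "smooth_on S f" "u \<in> S"
  shows "dirder a (dirder b f) u = dirder b (dirder a f) u"
proof -
  \<comment> \<open>the second difference quotient, evaluated by two applications of the mean value theorem\<close>
  define Q where "Q = (\<lambda>a b t. f (u + t *\<^sub>R a + t *\<^sub>R b) - f (u + t *\<^sub>R a) - f (u + t *\<^sub>R b) + f u)"
  have main: "((\<lambda>t. Q a b t / t\<^sup>2) \<longlongrightarrow> dirder b (dirder a f) u) (at_right 0)" for a b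
  proof (rule tendstoI)
    fix e :: real assume e: "e > 0"
    define h where "h = dirder b (dirder a f)"
    have "continuous_on S h" unfolding h_def
      using S by (intro smooth_on_imp_continuous smooth_on_dirder)
    then have "isCont h u" using S continuous_on_eq_continuous_at by blast
    then obtain d where d: "d > 0" "\<And>x. dist x u < d \<Longrightarrow> dist (h x) (h u) < e"
      using e unfolding continuous_at_eps_delta by blast
    obtain r where r: "r > 0" "ball u r \<subseteq> S" using S openE by blast
    define m where "m = min d r"
    \<comment> \<open>The 1 keeps the denominator positive. The parallelogram with sides below this
      bound stays within distance m of u, hence inside S and where \<open>h\<close> varies by less
      than e.\<close>
    define \<delta> where "\<delta> = m / (norm a + norm b + 1)"
    have \<delta>: "\<delta> > 0" using d r by (simp add: \<delta>_def m_def add_nonneg_pos)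
    have near: "dist (u + s *\<^sub>R a + t *\<^sub>R b) u < m" if "0 \<le> s" "s < \<delta>" "0 \<le> t" "t < \<delta>" for s t
    proof -
      have "dist (u + s *\<^sub>R a + t *\<^sub>R b) u \<le> s * norm a + t * norm b"
        using norm_triangle_ineq[of "s *\<^sub>R a" "t *\<^sub>R b"] that by (simp add: dist_norm)
      also have "\<dots> \<le> \<delta> * norm a + \<delta> * norm b"
        using that by (intro add_mono mult_right_mono) auto
      also have "\<dots> < \<delta> * (norm a + norm b + 1)" using \<delta> by (simp add: algebra_simps)
      also have "\<dots> = m" using add_nonneg_pos[of "norm a + norm b" 1] by (simp add: \<delta>_def)
      finally show ?thesis .
    qed
    have inS: "u + s *\<^sub>R a + t *\<^sub>R b \<in> S" if "0 \<le> s" "s < \<delta>" "0 \<le> t" "t < \<delta>" for s t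
      using near[OF that] r by (auto simp: m_def dist_commute)
    have "dist (Q a b t / t\<^sup>2) (h u) < e" if t: "0 < t" "t < \<delta>" for t
    proof -
      have D: "((\<lambda>s. f (p + s *\<^sub>R c)) has_real_derivative dirder c f (p + s *\<^sub>R c)) (at s)"
        if "f differentiable (at (p + s *\<^sub>R c))" for f :: "'a \<Rightarrow> real" and p c s
      proof -
        have "((\<lambda>s. p + s *\<^sub>R c) has_derivative (\<lambda>y. y *\<^sub>R c)) (at s)"
          by (auto intro!: derivative_eq_intros)
        note has_derivative_compose[OF this has_derivative_dirder[OF that]]
        then show ?thesis unfolding has_field_derivative_def
          by (rule has_derivative_eq_rhs) (simp add: fun_eq_iff linear_scale[OF linear_dirder[OF that]])
      qed
      define \<phi> where "\<phi> = (\<lambda>s. f ((u + t *\<^sub>R b) + s *\<^sub>R a) - f (u + s *\<^sub>R a))"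
      have inS': "u + t *\<^sub>R b + s *\<^sub>R a \<in> S" "u + s *\<^sub>R a \<in> S" "u + s *\<^sub>R a + r *\<^sub>R b \<in> S"
        if "0 \<le> s" "s \<le> t" "0 \<le> r" "r \<le> t" for s r
      proof -
        have eq: "u + t *\<^sub>R b + s *\<^sub>R a = u + s *\<^sub>R a + t *\<^sub>R b" by (simp add: add_ac)
        then show "u + t *\<^sub>R b + s *\<^sub>R a \<in> S" "u + s *\<^sub>R a \<in> S" "u + s *\<^sub>R a + r *\<^sub>R b \<in> S"
          unfolding eq using inS[of s t] inS[of s 0] inS[of s r] that t by simp_all
      qed
      have "(\<phi> has_real_derivative (dirder a f ((u + t *\<^sub>R b) + s *\<^sub>R a) - dirder a f (u + s *\<^sub>R a))) (at s)"
        if "0 \<le> s" "s \<le> t" for s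
        unfolding \<phi>_def using inS'[of s 0] that t
        by (intro DERIV_diff D[of f] smooth_on_imp_differentiable[OF S(2)]) simp_all
      from MVT2[OF t(1) this] obtain \<xi> where \<xi>: "0 < \<xi>" "\<xi> < t"
        "\<phi> t - \<phi> 0 = t * (dirder a f ((u + t *\<^sub>R b) + \<xi> *\<^sub>R a) - dirder a f (u + \<xi> *\<^sub>R a))" unfolding diff_0_right by blast
      have "((\<lambda>r. dirder a f ((u + \<xi> *\<^sub>R a) + r *\<^sub>R b)) has_real_derivative h ((u + \<xi> *\<^sub>R a) + r *\<^sub>R b)) (at r)"
        if "0 \<le> r" "r \<le> t" for r
        unfolding h_def using inS'[of \<xi> r] that \<xi>
        by (intro D[of "dirder a f"] smooth_on_imp_differentiable[OF smooth_on_dirder[OF S(1,2)]]) simp_all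
      from MVT2[OF t(1) this] obtain \<zeta> where \<zeta>: "0 < \<zeta>" "\<zeta> < t"
        "dirder a f ((u + \<xi> *\<^sub>R a) + t *\<^sub>R b) - dirder a f (u + \<xi> *\<^sub>R a) = t * h (u + \<xi> *\<^sub>R a + \<zeta> *\<^sub>R b)"
        unfolding diff_0_right scaleR_zero_left add_0_right by blast
      have "Q a b t = \<phi> t - \<phi> 0" by (simp add: Q_def \<phi>_def algebra_simps)
      also have "\<dots> = t\<^sup>2 * h (u + \<xi> *\<^sub>R a + \<zeta> *\<^sub>R b)"
        using \<xi>(3) \<zeta>(3) by (simp add: algebra_simps power2_eq_square)
      finally have "Q a b t / t\<^sup>2 = h (u + \<xi> *\<^sub>R a + \<zeta> *\<^sub>R b)" using t by simp
      moreover have "dist (u + \<xi> *\<^sub>R a + \<zeta> *\<^sub>R b) u < d"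
        using near[of \<xi> \<zeta>] \<xi> \<zeta> t by (simp add: m_def)
      ultimately show ?thesis using d(2) by simp
    qed
    then show "\<forall>\<^sub>F t in at_right 0. dist (Q a b t / t\<^sup>2) (dirder b (dirder a f) u) < e"
      unfolding eventually_at_right[OF \<delta>] h_def using \<delta> by blast
  qed
  \<comment> \<open>The second difference does not see the order of a and b, whereas its limit names
    one; uniqueness of limits identifies the two mixed derivatives.\<close>
  have "Q a b = Q b a" by (auto simp: Q_def algebra_simps)
  then have "((\<lambda>t. Q a b t / t\<^sup>2) \<longlongrightarrow> dirder a (dirder b f) u) (at_right 0)"
    using main[of b a] by simp
  then show ?thesis by (rule tendsto_unique[OF trivial_limit_at_right_real _ main])
qed

lemma dirder_commute:
  fixes f :: "'a::euclidean_space \<Rightarrow> 'b::euclidean_space"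
  assumes S: "open S" "smooth_on S f" "u \<in> S"
  shows "dirder a (dirder b f) u = dirder b (dirder a f) u"
proof (rule euclidean_eqI)
  fix e :: 'b
  have 1: "dirder a (\<lambda>x. g x \<bullet> e) x = dirder a g x \<bullet> e" if "smooth_on S g" "x \<in> S" for g :: "'a \<Rightarrow> 'b" and a x
    using that by (intro dirder_bounded_linear bounded_linear_inner_left smooth_on_imp_differentiable)
  have 2: "dirder a (dirder b (\<lambda>x. f x \<bullet> e)) u = dirder a (dirder b f) u \<bullet> e" for a b
  proof -
    have "dirder a (dirder b (\<lambda>x. f x \<bullet> e)) u = dirder a (\<lambda>x. dirder b f x \<bullet> e) u"
      by (rule dirder_cong[OF S(1,3)]) (rule 1[OF S(2)])
    also have "\<dots> = dirder a (dirder b f) u \<bullet> e"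
      by (rule 1[OF smooth_on_dirder[OF S(1,2)] S(3)])
    finally show ?thesis .
  qed
  have "dirder a (dirder b (\<lambda>x. f x \<bullet> e)) u = dirder b (dirder a (\<lambda>x. f x \<bullet> e)) u"
    by (rule dirder_commute_real[OF S(1) smooth_on_bounded_linear[OF S(1) bounded_linear_inner_left S(2)] S(3)])
  then show "dirder a (dirder b f) u \<bullet> e = dirder b (dirder a f) u \<bullet> e"
    unfolding 2 .
qed

section \<open>Submanifolds of the sphere modulo a circle action\<close>

text \<open>In the differential geometry only left multiplication by i matters, so the octonions are
  replaced by a Euclidean space with an orthogonal complex structure.\<close>

locale complex_structure =
  fixes J :: "'v::euclidean_space \<Rightarrow> 'v"
  assumes linear_J: "linear J"
    and J_J [simp]: "J (J v) = - v"
    and J_skew: "J v \<bullet> w = - (v \<bullet> J w)"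
begin

lemma bounded_linear_J: "bounded_linear J"
  using linear_J by (simp add: linear_conv_bounded_linear)

lemmas J_lin = linear_add[OF linear_J] linear_diff[OF linear_J] linear_neg[OF linear_J]
  linear_scale[OF linear_J] linear_0[OF linear_J]

lemmas inner_expand = inner_add_left inner_add_right inner_diff_left inner_diff_right J_lin

lemma J_skew': "v \<bullet> J w = - (w \<bullet> J v)"
  using J_skew[of w v] by (simp add: inner_commute)

lemma J_inner_J [simp]: "J v \<bullet> J w = v \<bullet> w"
  by (simp add: J_skew)

lemma inner_J_self [simp]: "v \<bullet> J v = 0" "J v \<bullet> v = 0"
  using J_skew[of v v] by (simp_all add: inner_commute)

end

section \<open>Horizontal calculus along a map into the sphere\<close>

text \<open>Neither horizontality nor injectivity of the differential is assumed. The locale covers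
  the section over the whole affine chart as well as its composition with a parametrized
  hypersurface, so both connections come out of one calculation.\<close>

locale sphere_map = complex_structure J for J :: "'v::euclidean_space \<Rightarrow> 'v" +
  fixes U :: "(real^'m) set" and x :: "real^'m \<Rightarrow> 'v"
  assumes open_U: "open U" and smooth_x: "smooth_on U x"
    and x_x: "u \<in> U \<Longrightarrow> x u \<bullet> x u = 1"
begin

definition hproj :: "real^'m \<Rightarrow> 'v \<Rightarrow> 'v" where
  "hproj u w = w - (w \<bullet> x u) *\<^sub>R x u - (w \<bullet> J (x u)) *\<^sub>R J (x u)"

text \<open>The connection form of the Hopf fibration, pulled back along x.\<close>

definition phase :: "real^'m \<Rightarrow> real^'m \<Rightarrow> real" where
  "phase a u = dirder a x u \<bullet> J (x u)"

definition X :: "real^'m \<Rightarrow> real^'m \<Rightarrow> 'v" where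
  "X a u = hproj u (dirder a x u)"

text \<open>The lift of the covariant derivative along the projected map. The term with \<open>phase\<close> corrects
  for \<open>x\<close> not being horizontal.\<close>

definition D :: "real^'m \<Rightarrow> (real^'m \<Rightarrow> 'v) \<Rightarrow> real^'m \<Rightarrow> 'v" where
  "D a V u = hproj u (dirder a V u) - phase a u *\<^sub>R J (V u)"

text \<open>These are the lifts of smooth vector fields along the projected map.\<close>

definition hfield :: "(real^'m \<Rightarrow> 'v) \<Rightarrow> bool" where
  "hfield V \<longleftrightarrow> smooth_on U V \<and> (\<forall>u\<in>U. V u \<bullet> x u = 0 \<and> V u \<bullet> J (x u) = 0)"

lemmas smooth_intros = open_U smooth_on_add[OF open_U] smooth_on_diff[OF open_U] smooth_on_minus[OF open_U]
  smooth_on_scaleR[OF open_U] smooth_on_mult[OF open_U] smooth_on_inner[OF open_U] smooth_on_const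
  smooth_on_bounded_linear[OF open_U bounded_linear_J] smooth_on_dirder[OF open_U] smooth_x
  smooth_on_sum[OF open_U]

lemma hfieldD:
  assumes "hfield V" "u \<in> U"
  shows "V u \<bullet> x u = 0" "V u \<bullet> J (x u) = 0" "J (V u) \<bullet> x u = 0" "J (V u) \<bullet> J (x u) = 0"
    "x u \<bullet> V u = 0" "J (x u) \<bullet> V u = 0" "x u \<bullet> J (V u) = 0" "J (x u) \<bullet> J (V u) = 0"
    "V differentiable (at u)"
proof -
  show V: "V u \<bullet> x u = 0" "V u \<bullet> J (x u) = 0" "V differentiable (at u)"
    using assms smooth_on_imp_differentiable[of U V u] by (auto simp: hfield_def)
  then show "J (V u) \<bullet> x u = 0" "J (V u) \<bullet> J (x u) = 0" by (simp_all add: J_skew)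
  then show "x u \<bullet> V u = 0" "J (x u) \<bullet> V u = 0" "x u \<bullet> J (V u) = 0" "J (x u) \<bullet> J (V u) = 0"
    using V by (metis inner_commute)+
qed

lemma hfield_smooth: "hfield V \<Longrightarrow> smooth_on U V"
  by (simp add: hfield_def)

lemma x_differentiable: "u \<in> U \<Longrightarrow> x differentiable (at u)"
  using smooth_x smooth_on_imp_differentiable by blast

lemma dirder_J: "V differentiable (at u) \<Longrightarrow> dirder a (\<lambda>u. J (V u)) u = J (dirder a V u)"
  by (rule dirder_bounded_linear[OF bounded_linear_J])

lemma differentiable_J: "V differentiable (at u) \<Longrightarrow> (\<lambda>u. J (V u)) differentiable (at u)"
  using bounded_linear.has_derivative[OF bounded_linear_J] unfolding differentiable_def by blast

lemma dirder_x_inner: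
  assumes "u \<in> U"
  shows "dirder a x u \<bullet> x u = 0" "x u \<bullet> dirder a x u = 0"
proof -
  have "dirder a (\<lambda>u. x u \<bullet> x u) u = dirder a (\<lambda>u. 1) u"
    using assms by (intro dirder_cong[OF open_U]) (simp_all add: x_x)
  then show "dirder a x u \<bullet> x u = 0" "x u \<bullet> dirder a x u = 0"
    by (simp_all add: dirder_inner x_differentiable[OF assms] inner_commute)
qed

lemma dirder_x: "u \<in> U \<Longrightarrow> dirder a x u = X a u + phase a u *\<^sub>R J (x u)"
  by (simp add: X_def hproj_def phase_def dirder_x_inner)

lemma hproj_inner:
  assumes "u \<in> U"
  shows "hproj u w \<bullet> x u = 0" "hproj u w \<bullet> J (x u) = 0"
  using assms by (simp_all add: hproj_def inner_diff_left x_x)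

lemma hproj_inner_horizontal:
  "Z \<bullet> x u = 0 \<Longrightarrow> Z \<bullet> J (x u) = 0 \<Longrightarrow> hproj u w \<bullet> Z = w \<bullet> Z"
  using inner_commute[of "x u" Z] inner_commute[of "J (x u)" Z] by (simp add: hproj_def inner_diff_left)

lemma smooth_hproj: "smooth_on U V \<Longrightarrow> smooth_on U (\<lambda>u. hproj u (V u))"
  unfolding hproj_def by (intro smooth_intros)

lemma hfield_hproj: "smooth_on U V \<Longrightarrow> hfield (\<lambda>u. hproj u (V u))"
  unfolding hfield_def by (simp add: hproj_inner smooth_hproj)

lemma smooth_phase: "smooth_on U (phase a)"
  unfolding phase_def[abs_def] by (intro smooth_intros)

lemma hfield_X: "hfield (X a)"
  unfolding X_def[abs_def] by (intro hfield_hproj smooth_intros)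

lemma hfield_D: "hfield V \<Longrightarrow> hfield (D a V)"
  using hfield_hproj[OF smooth_on_dirder[OF open_U hfield_smooth], of V a]
  by (auto simp: hfield_def D_def[abs_def] inner_diff_left J_skew intro!: smooth_intros smooth_phase)

lemma hfield_scaleR: "smooth_on U f \<Longrightarrow> hfield V \<Longrightarrow> hfield (\<lambda>u. f u *\<^sub>R V u)"
  by (auto simp: hfield_def intro: smooth_intros)

lemma hfield_sum: "(\<And>i. i \<in> I \<Longrightarrow> hfield (V i)) \<Longrightarrow> hfield (\<lambda>u. \<Sum>i\<in>I. V i u)"
  by (auto simp: hfield_def inner_sum_left intro: smooth_intros)

lemma has_derivative_vec_lambda:
  fixes f :: "'k::finite \<Rightarrow> 'c::real_normed_vector \<Rightarrow> 'w::euclidean_space"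
  assumes "\<And>i. (f i has_derivative f' i) (at u)"
  shows "((\<lambda>u. \<chi> i. f i u) has_derivative (\<lambda>h. \<chi> i. f' i h)) (at u)"
proof -
  have "((\<lambda>u. (\<chi> i. f i u) \<bullet> axis i b) has_derivative (\<lambda>h. (\<chi> i. f' i h) \<bullet> axis i b)) (at u)" for i b
    using has_derivative_inner_left[OF assms, of i b] by (simp add: inner_axis)
  then show ?thesis
    by (subst has_derivative_componentwise_within) (auto simp: Basis_vec_def)
qed

lemma linear_dirder_x: "u \<in> U \<Longrightarrow> linear (\<lambda>a. dirder a x u)"
  by (simp add: linear_dirder x_differentiable)

lemma linear_phase: "u \<in> U \<Longrightarrow> linear (\<lambda>a. phase a u)"
  using linear_dirder_x[of u] unfolding phase_def linear_iff by (simp add: inner_add_left)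

lemma linear_hproj: "linear (hproj u)"
  by (rule linearI) (simp_all add: hproj_def inner_add_left algebra_simps)

lemma linear_X: "u \<in> U \<Longrightarrow> linear (\<lambda>a. X a u)"
  unfolding X_def using linear_compose[OF linear_dirder_x linear_hproj] by (simp add: o_def)

lemma linear_D: "u \<in> U \<Longrightarrow> V differentiable (at u) \<Longrightarrow> linear (\<lambda>a. D a V u)"
  using linear_compose[OF linear_dirder[of V u] linear_hproj[of u]] linear_phase[of u]
  unfolding D_def linear_iff by (simp add: algebra_simps)

lemma sum_axis: "(\<Sum>i\<in>UNIV. a $ i *\<^sub>R axis i 1) = (a :: real^'k)"
  by (simp add: vec_eq_iff axis_def sum.delta if_distrib cong: if_cong)

lemma linear_expand:
  "linear (f :: real^'k \<Rightarrow> 'w::real_vector) \<Longrightarrow> f a = (\<Sum>i\<in>UNIV. a $ i *\<^sub>R f (axis i 1))"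
  using linear_sum[of f "\<lambda>i. a $ i *\<^sub>R axis i 1" UNIV] by (simp add: sum_axis linear_scale)

text \<open>Differentiating the two orthogonality relations of a horizontal field determines the
  components of its derivative along x and J x.\<close>

lemma dirder_hfield_inner:
  assumes "hfield V" "u \<in> U"
  shows "dirder a V u \<bullet> x u = - (V u \<bullet> X a u)" "dirder a V u \<bullet> J (x u) = J (V u) \<bullet> X a u"
proof -
  note [simp] = hfieldD[OF assms] x_differentiable[OF assms(2)]
    differentiable_J[OF x_differentiable[OF assms(2)]] dirder_J[OF x_differentiable[OF assms(2)]]
  have "dirder a (\<lambda>u. V u \<bullet> x u) u = dirder a (\<lambda>u. 0) u" "dirder a (\<lambda>u. V u \<bullet> J (x u)) u = dirder a (\<lambda>u. 0) u"
    by (rule dirder_cong[OF open_U assms(2)], simp add: hfieldD[OF assms(1)])+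
  then show "dirder a V u \<bullet> x u = - (V u \<bullet> X a u)" "dirder a V u \<bullet> J (x u) = J (V u) \<bullet> X a u"
    by (simp_all add: dirder_inner dirder_x[OF assms(2)] inner_expand J_skew)
qed

lemma dirder_hfield:
  assumes "hfield V" "u \<in> U"
  shows "dirder a V u = D a V u + phase a u *\<^sub>R J (V u) - (V u \<bullet> X a u) *\<^sub>R x u + (J (V u) \<bullet> X a u) *\<^sub>R J (x u)"
  by (simp add: D_def hproj_def dirder_hfield_inner[OF assms])

lemma dirder_hfield_inner_horizontal:
  assumes "hfield V" "u \<in> U" "Z \<bullet> x u = 0" "Z \<bullet> J (x u) = 0"
  shows "dirder a V u \<bullet> Z = D a V u \<bullet> Z + phase a u * (J (V u) \<bullet> Z)"
  using assms inner_commute[of "x u" Z] inner_commute[of "J (x u)" Z]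
  by (simp add: dirder_hfield inner_add_left inner_diff_left)

text \<open>Compatibility of D with the metric: the two phase corrections cancel because J is
  skew.\<close>

lemma dirder_inner_hfield:
  assumes "hfield V" "hfield Y" "u \<in> U"
  shows "dirder a (\<lambda>u. V u \<bullet> Y u) u = D a V u \<bullet> Y u + V u \<bullet> D a Y u"
proof -
  note [simp] = hfieldD[OF assms(1,3)] hfieldD[OF assms(2,3)]
  show ?thesis
    using dirder_hfield_inner_horizontal[OF assms(1,3), of "Y u" a]
      dirder_hfield_inner_horizontal[OF assms(2,3), of "V u" a] J_skew'[of "V u" "Y u"]
    by (simp add: dirder_inner inner_commute[of "V u"] J_skew)
qed

lemma D_sum:
  fixes f :: "'i \<Rightarrow> real^'m \<Rightarrow> real"
  assumes "u \<in> U" "\<And>j. j \<in> I \<Longrightarrow> f j differentiable (at u)" "\<And>j. j \<in> I \<Longrightarrow> hfield (V j)"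
  shows "D a (\<lambda>u. \<Sum>j\<in>I. f j u *\<^sub>R V j u) u = (\<Sum>j\<in>I. dirder a (f j) u *\<^sub>R V j u + f j u *\<^sub>R D a (V j) u)"
proof -
  have d: "(\<lambda>u. f j u *\<^sub>R V j u) differentiable (at u)" if "j \<in> I" for j
    using bounded_bilinear.FDERIV[OF bounded_bilinear_scaleR]
      assms(2)[OF that] hfieldD(9)[OF assms(3)[OF that] assms(1)]
    unfolding differentiable_def by blast
  have h: "hproj u (V j u) = V j u" if "j \<in> I" for j
    using hfieldD[OF assms(3)[OF that] assms(1)] by (simp add: hproj_def)
  show ?thesis
    by (simp add: D_def dirder_sum d linear_sum[OF linear_hproj] linear_sum[OF linear_J] dirder_scaleR
        assms(2) hfieldD(9)[OF assms(3) assms(1)] linear_add[OF linear_hproj] linear_scale[OF linear_hproj] h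
        J_lin scaleR_diff_right scaleR_sum_right sum.distrib sum_subtractf mult.commute algebra_simps
        cong: sum.cong)
qed

lemma dirder_phase:
  assumes "u \<in> U"
  shows "dirder a (phase b) u = dirder a (dirder b x) u \<bullet> J (x u) + dirder b x u \<bullet> J (dirder a x u)"
  unfolding phase_def[abs_def] using assms
  by (subst dirder_inner)
    (auto intro!: smooth_on_imp_differentiable[OF smooth_on_dirder[OF open_U smooth_x]] differentiable_J
      simp: dirder_J x_differentiable)

text \<open>The exterior derivative of the connection form is -2 times the Kaehler form. This is the
  origin of the term with factor 2 in the curvature of CP^n.\<close>

lemma dirder_phase_antisym:
  assumes "u \<in> U"
  shows "dirder a (phase b) u - dirder b (phase a) u = - 2 * (X a u \<bullet> J (X b u))"
proof -
  note [simp] = hfieldD[OF hfield_X assms]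
  have "dirder b x u \<bullet> J (dirder a x u) = X b u \<bullet> J (X a u)" for a b
    by (simp add: dirder_x[OF assms] inner_expand J_skew)
  then show ?thesis
    using dirder_commute[OF open_U smooth_x assms, of a b] J_skew'[of "X a u" "X b u"]
    by (simp add: dirder_phase[OF assms])
qed

lemma D_X_inner:
  assumes "u \<in> U" "Z \<bullet> x u = 0" "Z \<bullet> J (x u) = 0"
  shows "D a (X b) u \<bullet> Z = dirder a (dirder b x) u \<bullet> Z - phase b u * (J (X a u) \<bullet> Z) - phase a u * (J (X b u) \<bullet> Z)"
proof -
  have d: "X b differentiable (at u)" "phase b differentiable (at u)"
    using hfieldD(9)[OF hfield_X assms(1)] smooth_on_imp_differentiable[OF smooth_phase assms(1)] by auto
  have "dirder a (dirder b x) u = dirder a (\<lambda>u. X b u + phase b u *\<^sub>R J (x u)) u"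
    by (rule dirder_cong[OF open_U assms(1)]) (rule dirder_x)
  also have "\<dots> = dirder a (X b) u + (phase b u *\<^sub>R J (dirder a x u) + dirder a (phase b) u *\<^sub>R J (x u))"
    using smooth_on_imp_differentiable[OF _ assms(1), of "\<lambda>u. phase b u *\<^sub>R J (x u)"]
    by (simp add: dirder_add d dirder_scaleR dirder_J x_differentiable[OF assms(1)]
        differentiable_J[OF x_differentiable[OF assms(1)]] smooth_intros smooth_phase)
  finally have "dirder a (dirder b x) u \<bullet> Z = dirder a (X b) u \<bullet> Z + phase b u * (J (X a u) \<bullet> Z)"
    using assms inner_commute[of "x u" Z] inner_commute[of "J (x u)" Z] by (simp add: dirder_x inner_expand)
  then show ?thesis using dirder_hfield_inner_horizontal[OF hfield_X assms, of a b] by simp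
qed

lemma horizontal_eqI:
  assumes "u \<in> U" "hfield V" "hfield Y"
    "\<And>Z. Z \<bullet> x u = 0 \<Longrightarrow> Z \<bullet> J (x u) = 0 \<Longrightarrow> V u \<bullet> Z = Y u \<bullet> Z"
  shows "V u = Y u"
proof -
  have "V u \<bullet> (V u - Y u) = Y u \<bullet> (V u - Y u)"
    by (rule assms(4)) (simp_all add: inner_diff_left hfieldD[OF assms(2,1)] hfieldD[OF assms(3,1)])
  then have "(V u - Y u) \<bullet> (V u - Y u) = 0" by (simp add: inner_diff_left)
  then show ?thesis by simp
qed

text \<open>Torsion-freeness: the right side of \<open>D_X_inner\<close> is symmetric in a and b.
  With \<open>dirder_inner_hfield\<close> it characterizes the Levi-Civita connection.\<close>

lemma D_X_commute: "u \<in> U \<Longrightarrow> D a (X b) u = D b (X a) u"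
  by (rule horizontal_eqI)
    (auto intro: hfield_D hfield_X simp: D_X_inner dirder_commute[OF open_U smooth_x, of u a b])

section \<open>Curvature of the lifted connection\<close>

text \<open>This is the curvature tensor of complex projective space with holomorphic sectional
  curvature 4. No bracket term occurs because a and b are constant coordinate directions.\<close>

lemma curvature:
  assumes V: "hfield V" and u: "u \<in> U" and Z: "Z \<bullet> x u = 0" "Z \<bullet> J (x u) = 0"
  shows "D a (D b V) u \<bullet> Z - D b (D a V) u \<bullet> Z =
    2 * (X a u \<bullet> J (X b u)) * (J (V u) \<bullet> Z)
    + (V u \<bullet> X b u) * (X a u \<bullet> Z) - (V u \<bullet> X a u) * (X b u \<bullet> Z)
    - (J (V u) \<bullet> X b u) * (J (X a u) \<bullet> Z) + (J (V u) \<bullet> X a u) * (J (X b u) \<bullet> Z)"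
proof -
  note sm = smooth_intros hfield_smooth[OF V] hfield_smooth[OF hfield_X] smooth_phase
    hfield_smooth[OF hfield_D[OF V]]
  have [simp]: "x u \<bullet> Z = 0" "J (x u) \<bullet> Z = 0" "J (V u) \<bullet> Z = - (V u \<bullet> J Z)" using Z
    by (simp_all add: inner_commute J_skew)
  \<comment> \<open>In one order of differentiation, the terms in which a phase multiplies J D V or
    another phase are symmetric in a and b. The difference keeps only the derivative of the phase
    and the products of X with V.\<close>
  have E: "D a (D b V) u \<bullet> Z = dirder a (dirder b V) u \<bullet> Z
      - dirder a (phase b) u * (J (V u) \<bullet> Z) - phase b u * (J (D a V u) \<bullet> Z) - phase a u * (J (D b V u) \<bullet> Z)
      + phase a u * phase b u * (V u \<bullet> Z)
      + (V u \<bullet> X b u) * (X a u \<bullet> Z) - (J (V u) \<bullet> X b u) * (J (X a u) \<bullet> Z)" for a b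
  proof -
    let ?d = "\<lambda>f. f differentiable (at u)"
    have ds: "?d (\<lambda>u. phase b u *\<^sub>R J (V u))" "?d (\<lambda>u. (V u \<bullet> X b u) *\<^sub>R x u)"
        "?d (\<lambda>u. (J (V u) \<bullet> X b u) *\<^sub>R J (x u))" "?d (D b V)" "?d (phase b)" "?d (\<lambda>u. V u \<bullet> X b u)"
        "?d (\<lambda>u. J (V u) \<bullet> X b u)" "?d x" "?d V" "?d (\<lambda>u. J (V u))" "?d (\<lambda>u. J (x u))"
        "?d (\<lambda>u. D b V u + phase b u *\<^sub>R J (V u))"
        "?d (\<lambda>u. D b V u + phase b u *\<^sub>R J (V u) - (V u \<bullet> X b u) *\<^sub>R x u)"
      by (intro smooth_on_imp_differentiable[OF _ u] sm)+
    have 1: "dirder a (dirder b V) u = dirder a (\<lambda>u. D b V u + phase b u *\<^sub>R J (V u) - (V u \<bullet> X b u) *\<^sub>R x u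
        + (J (V u) \<bullet> X b u) *\<^sub>R J (x u)) u"
      by (rule dirder_cong[OF open_U u]) (rule dirder_hfield[OF V])
    have 2: "dirder a (dirder b V) u \<bullet> Z = dirder a (D b V) u \<bullet> Z + phase b u * (J (dirder a V u) \<bullet> Z)
        + dirder a (phase b) u * (J (V u) \<bullet> Z)
        - (V u \<bullet> X b u) * (dirder a x u \<bullet> Z) + (J (V u) \<bullet> X b u) * (J (dirder a x u) \<bullet> Z)"
      unfolding 1 by (simp add: dirder_add dirder_diff dirder_scaleR dirder_J ds inner_add_left inner_diff_left)
    have 3: "dirder a (D b V) u \<bullet> Z = D a (D b V) u \<bullet> Z + phase a u * (J (D b V u) \<bullet> Z)"
      by (rule dirder_hfield_inner_horizontal[OF hfield_D[OF V] u Z])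
    have 4: "J (dirder a V u) \<bullet> Z = J (D a V u) \<bullet> Z - phase a u * (V u \<bullet> Z)"
      by (simp add: dirder_hfield[OF V u] inner_expand)
    have 5: "dirder a x u \<bullet> Z = X a u \<bullet> Z" "J (dirder a x u) \<bullet> Z = J (X a u) \<bullet> Z"
      by (simp_all add: dirder_x[OF u] inner_expand)
    show ?thesis using 2 unfolding 3 4 5 by (simp add: algebra_simps)
  qed
  have eq: "dirder a (phase b) u = dirder b (phase a) u - 2 * (X a u \<bullet> J (X b u))"
    using dirder_phase_antisym[OF u, of a b] by simp
  show ?thesis
    unfolding E[of a b] E[of b a] dirder_commute[OF open_U hfield_smooth[OF V] u, of a b] eq
    by (simp add: algebra_simps)
qed

section \<open>Metric and Christoffel symbols in coordinates\<close>

definition gram :: "real^'m \<Rightarrow> real^'m^'m" where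
  "gram u = (\<chi> i j. X (axis i 1) u \<bullet> X (axis j 1) u)"

text \<open>If the matrix kills a, then \<open>X a u\<close> is orthogonal to all frame vectors and
  hence to itself.\<close>

lemma gram_invertibleI:
  assumes u: "u \<in> U" and inj: "\<And>a. X a u = 0 \<Longrightarrow> a = 0"
  shows "invertible (gram u)"
proof -
  have "a = 0" if "gram u *v a = 0" for a
  proof (rule inj)
    have Xa: "X a u = (\<Sum>i\<in>UNIV. a $ i *\<^sub>R X (axis i 1) u)"
      by (rule linear_expand[OF linear_X[OF u]])
    have "X (axis i 1) u \<bullet> X a u = (gram u *v a) $ i" for i
      unfolding Xa by (simp add: gram_def matrix_vector_mult_def inner_sum_right mult.commute)
    then have "X (axis i 1) u \<bullet> X a u = 0" for i using that by simp
    moreover have "X a u \<bullet> X a u = (\<Sum>i\<in>UNIV. a $ i * (X (axis i 1) u \<bullet> X a u))"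
      using arg_cong[OF Xa, of "\<lambda>v. v \<bullet> X a u"] by (simp add: inner_sum_left)
    ultimately show "X a u = 0" by simp
  qed
  then have "inj ((*v) (gram u))"
    by (simp add: linear_injective_0)
  then show ?thesis
    by (simp add: invertible_left_inverse matrix_left_invertible_injective)
qed

lemma gram_inv:
  assumes "invertible (gram u)"
  shows "(\<Sum>k\<in>UNIV. matrix_inv (gram u) $ i $ k * (X (axis k 1) u \<bullet> X (axis j 1) u)) = (if i = j then 1 else 0)"
    and "(\<Sum>k\<in>UNIV. (X (axis i 1) u \<bullet> X (axis k 1) u) * matrix_inv (gram u) $ k $ j) = (if i = j then 1 else 0)"
    and "matrix_inv (gram u) $ i $ j = matrix_inv (gram u) $ j $ i"
proof -
  let ?G = "gram u" and ?H = "matrix_inv (gram u)"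
  have *: "?G ** ?H = mat 1 \<and> ?H ** ?G = mat 1"
    using assms unfolding matrix_inv_def invertible_def by (rule someI_ex)
  then have "(?H ** ?G) $ i $ j = mat 1 $ i $ j" "(?G ** ?H) $ i $ j = mat 1 $ i $ j" by simp_all
  then show "(\<Sum>k\<in>UNIV. ?H $ i $ k * (X (axis k 1) u \<bullet> X (axis j 1) u)) = (if i = j then 1 else 0)"
    "(\<Sum>k\<in>UNIV. (X (axis i 1) u \<bullet> X (axis k 1) u) * ?H $ k $ j) = (if i = j then 1 else 0)"
    by (simp_all add: matrix_matrix_mult_def gram_def mat_def)
  have "transpose ?G = ?G" by (simp add: transpose_def gram_def vec_eq_iff inner_commute)
  then have "?G ** transpose ?H = mat 1" using * matrix_transpose_mul[of ?H ?G] by (simp add: transpose_mat)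
  then have "?H ** (?G ** transpose ?H) = ?H" by (simp add: matrix_mul_rid)
  then have "transpose ?H = ?H" using * by (simp add: matrix_mul_assoc matrix_mul_lid)
  then have "transpose ?H $ j $ i = ?H $ j $ i" by simp
  then show "?H $ i $ j = ?H $ j $ i" by (simp add: transpose_def)
qed

lemma pderiv_gram:
  assumes u: "u \<in> U"
  shows "frechet_derivative gram (at u) a $ i $ j
    = D a (X (axis i 1)) u \<bullet> X (axis j 1) u + X (axis i 1) u \<bullet> D a (X (axis j 1)) u"
proof -
  have s: "smooth_on U (\<lambda>u. X (axis i 1) u \<bullet> X (axis j 1) u)" for i j
    by (intro smooth_intros hfield_smooth[OF hfield_X])
  have "(gram has_derivative (\<lambda>a. \<chi> i j. dirder a (\<lambda>u. X (axis i 1) u \<bullet> X (axis j 1) u) u)) (at u)"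
    unfolding gram_def[abs_def]
    by (rule has_derivative_vec_lambda, rule has_derivative_vec_lambda, rule has_derivative_dirder,
        rule smooth_on_imp_differentiable[OF s u])
  from frechet_derivative_at[OF this, symmetric] show ?thesis
    by (simp add: dirder_inner_hfield[OF hfield_X hfield_X u])
qed

text \<open>The Koszul formula. Both sides are paired with a frame vector: for the section this
  determines the whole of D X, for a hypersurface only its tangential part, and the same statement
  serves both.\<close>

lemma christoffel_gram:
  assumes u: "u \<in> U" and inv: "invertible (gram u)"
  shows "(\<Sum>k\<in>UNIV. christoffel gram u k i j * (X (axis k 1) u \<bullet> X (axis l 1) u))
    = D (axis i 1) (X (axis j 1)) u \<bullet> X (axis l 1) u"
proof -
  let ?H = "matrix_inv (gram u)" and ?X = "\<lambda>i. X (axis i 1) u"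
  let ?DX = "\<lambda>i j. D (axis i 1) (X (axis j 1)) u"
  have c: "christoffel gram u k i j = (\<Sum>m\<in>UNIV. ?H $ k $ m * (?DX i j \<bullet> ?X m))" for k
    unfolding christoffel_def sum_distrib_left
  proof (rule sum.cong[OF refl])
    fix m
    \<comment> \<open>Of the six terms produced by \<open>pderiv_gram\<close>, four cancel in pairs
      by symmetry, and the other two agree and absorb the factor 1/2.\<close>
    have "?DX m i = ?DX i m" "?DX m j = ?DX j m" "?DX j i = ?DX i j" by (simp_all only: D_X_commute[OF u])
    then show "1 / 2 * (?H $ k $ m * (frechet_derivative gram (at u) (axis i 1) $ j $ m
        + frechet_derivative gram (at u) (axis j 1) $ i $ m - frechet_derivative gram (at u) (axis m 1) $ i $ j))
      = ?H $ k $ m * (?DX i j \<bullet> ?X m)"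
      unfolding pderiv_gram[OF u] by (simp add: inner_commute)
  qed
  have "(\<Sum>k\<in>UNIV. christoffel gram u k i j * (?X k \<bullet> ?X l))
      = (\<Sum>m\<in>UNIV. (\<Sum>k\<in>UNIV. ?H $ m $ k * (?X k \<bullet> ?X l)) * (?DX i j \<bullet> ?X m))"
    unfolding c sum_distrib_right
    by (subst sum.swap) (simp add: gram_inv(3)[OF inv, of _ m for m] mult_ac)
  also have "\<dots> = ?DX i j \<bullet> ?X l"
    unfolding gram_inv(1)[OF inv] by (simp add: if_distrib[where f = "\<lambda>c. c * _"] cong: if_cong)
  finally show ?thesis .
qed

end

lemma sum_mult_delta:
  fixes c :: "'k::finite \<Rightarrow> real"
  shows "(\<Sum>m\<in>UNIV. c m * (if m = k then 1 else 0)) = c k"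
    and "(\<Sum>m\<in>UNIV. c m * (if k = m then 1 else 0)) = c k"
    and "(\<Sum>m\<in>UNIV. (if m = k then 1 else 0) * c m) = c k"
    and "(\<Sum>m\<in>UNIV. (if k = m then 1 else 0) * c m) = c k"
  by (simp_all add: if_distrib if_distribR cong: if_cong)

text \<open>Cramer's rule: the entry is the determinant of \<open>C\<close>, which is A with column
  i replaced by the j-th basis vector, divided by the determinant of A. Both are polynomials in the
  entries.\<close>

lemma smooth_on_matrix_inv:
  fixes A :: "'a::euclidean_space \<Rightarrow> real^'k^'k"
  assumes S: "open S" and A: "\<And>i j. smooth_on S (\<lambda>u. A u $ i $ j)" and inv: "\<And>u. u \<in> S \<Longrightarrow> invertible (A u)"
  shows "smooth_on S (\<lambda>u. matrix_inv (A u) $ i $ j)"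
proof -
  define C where "C = (\<lambda>u. \<chi> i' j'. if j' = i then axis j 1 $ i' else A u $ i' $ j')"
  have det: "smooth_on S (\<lambda>u. det (M u))" if "\<And>i j. smooth_on S (\<lambda>u. M u $ i $ j)" for M :: "'a \<Rightarrow> real^'k^'k"
    unfolding det_def using that by (intro smooth_on_sum smooth_on_mult smooth_on_prod S smooth_on_const)
  have "smooth_on S (\<lambda>u. det (C u) * inverse (det (A u)))"
  proof (intro smooth_on_mult smooth_on_inverse S det A)
    show "smooth_on S (\<lambda>u. C u $ i' $ j')" for i' j'
      using A[of i' j'] by (cases "j' = i") (simp_all add: C_def)
  qed (use inv invertible_det_nz in blast)
  moreover have "det (C u) * inverse (det (A u)) = matrix_inv (A u) $ i $ j" if "u \<in> S" for u
  proof -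
    have "A u ** matrix_inv (A u) = mat 1"
      using someI_ex[OF inv[OF that, unfolded invertible_def]] by (simp add: matrix_inv_def)
    then have "A u *v (matrix_inv (A u) *v axis j 1) = axis j 1"
      by (simp add: matrix_vector_mul_assoc)
    then have "det (C u) = (matrix_inv (A u) *v axis j 1) $ i * det (A u)"
      using cramer_lemma[where A = "A u" and x = "matrix_inv (A u) *v axis j 1" and k = i] by (simp only: C_def)
    moreover have "(matrix_inv (A u) *v axis j 1) $ i = matrix_inv (A u) $ i $ j"
      by (simp add: matrix_vector_mult_basis column_def)
    moreover have "det (A u) \<noteq> 0" using inv[OF that] invertible_det_nz by blast
    ultimately show ?thesis by simp
  qed
  ultimately show ?thesis by (subst (asm) smooth_on_cong[OF S])
qed

section \<open>Dual frame, gradient and Laplacian\<close>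

locale sphere_immersion = sphere_map J U x
  for J :: "'v::euclidean_space \<Rightarrow> 'v" and U :: "(real^'m) set" and x +
  assumes invertible_gram: "u \<in> U \<Longrightarrow> invertible (gram u)"
begin

abbreviation XX :: "'m \<Rightarrow> real^'m \<Rightarrow> 'v" where "XX i \<equiv> X (axis i 1)"
abbreviation DD :: "'m \<Rightarrow> (real^'m \<Rightarrow> 'v) \<Rightarrow> real^'m \<Rightarrow> 'v" where "DD i \<equiv> D (axis i 1)"
abbreviation dd :: "'m \<Rightarrow> (real^'m \<Rightarrow> real) \<Rightarrow> real^'m \<Rightarrow> real" where "dd i \<equiv> dirder (axis i 1)"

definition ginv :: "real^'m \<Rightarrow> 'm \<Rightarrow> 'm \<Rightarrow> real" where
  "ginv u i k = matrix_inv (gram u) $ i $ k"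

text \<open>The metric dual of the coordinate frame. Pairing \<open>XX i\<close> with
  \<open>dual i\<close> gives traces over the tangent space without orthonormal frames.\<close>

definition dual :: "'m \<Rightarrow> real^'m \<Rightarrow> 'v" where
  "dual i u = (\<Sum>k\<in>UNIV. ginv u i k *\<^sub>R XX k u)"

lemma ginv_sym: "u \<in> U \<Longrightarrow> ginv u i k = ginv u k i"
  unfolding ginv_def by (rule gram_inv(3)[OF invertible_gram])

lemma smooth_ginv: "smooth_on U (\<lambda>u. ginv u i k)"
  unfolding ginv_def
proof (rule smooth_on_matrix_inv[OF open_U])
  show "smooth_on U (\<lambda>u. gram u $ i $ j)" for i j
    by (simp add: gram_def) (intro smooth_intros hfield_smooth[OF hfield_X])
qed (rule invertible_gram)

lemma hfield_dual: "hfield (dual i)"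
  unfolding dual_def[abs_def] by (intro hfield_sum hfield_scaleR smooth_ginv hfield_X)

lemma dual_X: "u \<in> U \<Longrightarrow> dual i u \<bullet> XX j u = (if i = j then 1 else 0)"
  using gram_inv(1)[OF invertible_gram, of u i j] by (simp add: dual_def inner_sum_left ginv_def)

lemma ginv_X: "(\<Sum>k\<in>UNIV. ginv u i k * (Y \<bullet> XX k u)) = Y \<bullet> dual i u"
  by (simp add: dual_def inner_sum_right)

lemma ginv_X': "u \<in> U \<Longrightarrow> (\<Sum>k\<in>UNIV. ginv u k i * (Y \<bullet> XX k u)) = Y \<bullet> dual i u"
  unfolding ginv_X[symmetric] by (simp add: ginv_sym[of u _ i])

lemma christoffel_dual:
  assumes "u \<in> U"
  shows "christoffel gram u k i j = dual k u \<bullet> DD i (XX j) u"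
proof -
  have "dual k u \<bullet> DD i (XX j) u = (\<Sum>l\<in>UNIV. ginv u k l * (\<Sum>m\<in>UNIV. christoffel gram u m i j * (XX m u \<bullet> XX l u)))"
    unfolding christoffel_gram[OF assms invertible_gram[OF assms]]
    using ginv_X[of u k "DD i (XX j) u"] by (simp add: inner_commute)
  also have "\<dots> = (\<Sum>m\<in>UNIV. \<Sum>l\<in>UNIV. ginv u k l * (christoffel gram u m i j * (XX m u \<bullet> XX l u)))"
    unfolding sum_distrib_left by (rule sum.swap)
  also have "\<dots> = (\<Sum>m\<in>UNIV. christoffel gram u m i j * (XX m u \<bullet> dual k u))"
    unfolding ginv_X[symmetric] sum_distrib_left by (simp add: mult_ac)
  also have "\<dots> = christoffel gram u k i j"
    by (simp add: inner_commute[of _ "dual k u"] dual_X[OF assms] sum_mult_delta)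
  finally show ?thesis by simp
qed

lemma hfield_inner_smooth: "hfield V \<Longrightarrow> hfield Y \<Longrightarrow> smooth_on U (\<lambda>u. V u \<bullet> Y u)"
  by (intro smooth_intros hfield_smooth)

text \<open>The divergence of the gradient is the metric trace of the Hessian. The Christoffel
  symbols appear through D, so that covariant calculus on the lifts can be applied to the
  result.\<close>

lemma laplace_gram:
  assumes f: "smooth_on U f" and u: "u \<in> U"
  shows "claplace gram f u = (\<Sum>i\<in>UNIV. \<Sum>k\<in>UNIV. ginv u i k *
    (dd i (dd k f) u - (\<Sum>m\<in>UNIV. (dual m u \<bullet> DD i (XX k) u) * dd m f u)))"
proof -
  define b where "b = cgrad gram f"
  have b: "b v $ j = (\<Sum>k\<in>UNIV. ginv v j k * dd k f v)" for v j
    by (simp add: b_def cgrad_def ginv_def matrix_vector_mult_def dirder_def)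
  \<comment> \<open>The horizontal lift of the gradient; its divergence is the trace of D T.\<close>
  define T where "T = (\<lambda>v. \<Sum>j\<in>UNIV. b v $ j *\<^sub>R XX j v)"
  have smb: "smooth_on U (\<lambda>v. b v $ j)" for j
    unfolding b by (intro smooth_intros smooth_ginv f)
  then have db: "(\<lambda>v. b v $ j) differentiable (at u)" for j
    using smooth_on_imp_differentiable u by blast
  have hT: "hfield T"
    unfolding T_def by (intro hfield_sum hfield_scaleR hfield_X smb)
  have TX: "T v \<bullet> XX k v = dd k f v" if v: "v \<in> U" for v k
  proof -
    have "T v \<bullet> XX k v = (\<Sum>l\<in>UNIV. dd l f v * (\<Sum>j\<in>UNIV. ginv v l j * (XX k v \<bullet> XX j v)))"
      by (simp add: T_def inner_sum_left b sum_distrib_left sum_distrib_right)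
        (subst sum.swap, simp add: ginv_sym[OF v] inner_commute mult_ac)
    also have "\<dots> = dd k f v"
      unfolding ginv_X by (simp add: inner_commute[of _ "dual _ v"] dual_X[OF v] sum_mult_delta)
    finally show ?thesis .
  qed
  have "b differentiable (at u)"
    using has_derivative_vec_lambda[OF has_derivative_dirder[OF db], of "\<lambda>j. j"]
    unfolding differentiable_def by auto
  then have fb: "frechet_derivative b (at u) (axis i 1) $ i = dd i (\<lambda>v. b v $ i) u" for i
    using dirder_bounded_linear[OF bounded_linear_vec_nth, of b u "axis i 1" i] by (simp add: dirder_def)
  have "claplace gram f u = (\<Sum>i\<in>UNIV. dd i (\<lambda>v. b v $ i) u + (\<Sum>j\<in>UNIV. christoffel gram u i i j * b u $ j))"
  proof -
    have "(\<Sum>i'\<in>UNIV. \<Sum>j\<in>UNIV. christoffel gram u i i' j * axis i 1 $ i' * b u $ j)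
        = (\<Sum>j\<in>UNIV. christoffel gram u i i j * b u $ j)" for i
    proof -
      have "(\<Sum>j\<in>UNIV. christoffel gram u i i' j * axis i 1 $ i' * b u $ j)
        = (if i' = i then 1 else 0) * (\<Sum>j\<in>UNIV. christoffel gram u i i' j * b u $ j)" for i'
        by (simp add: axis_def)
      then show ?thesis by (simp only: sum_mult_delta)
    qed
    then show ?thesis
      by (simp add: claplace_def cdiv_def trace_def matrix_def cov_deriv_along_def fb b_def[symmetric])
  qed
  also have "\<dots> = (\<Sum>i\<in>UNIV. dual i u \<bullet> DD i T u)"
  proof (rule sum.cong[OF refl])
    fix i
    have "DD i T u = (\<Sum>j\<in>UNIV. dd i (\<lambda>v. b v $ j) u *\<^sub>R XX j u + b u $ j *\<^sub>R DD i (XX j) u)"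
      unfolding T_def by (rule D_sum[OF u db hfield_X])
    then show "dd i (\<lambda>v. b v $ i) u + (\<Sum>j\<in>UNIV. christoffel gram u i i j * b u $ j) = dual i u \<bullet> DD i T u"
      by (simp add: inner_sum_right inner_add_right sum.distrib dual_X[OF u] christoffel_dual[OF u]
          sum_mult_delta mult.commute[of "dual i u \<bullet> _"])
  qed
  also have "\<dots> = (\<Sum>i\<in>UNIV. \<Sum>k\<in>UNIV. ginv u i k * (DD i T u \<bullet> XX k u))"
    by (simp add: ginv_X inner_commute[of "dual _ u"])
  also have "\<dots> = (\<Sum>i\<in>UNIV. \<Sum>k\<in>UNIV. ginv u i k *
    (dd i (dd k f) u - (\<Sum>m\<in>UNIV. (dual m u \<bullet> DD i (XX k) u) * dd m f u)))"
  proof (intro sum.cong refl arg_cong2[of _ _ _ _ "(*)"])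
    fix i k
    have "dd i (dd k f) u = dd i (\<lambda>v. T v \<bullet> XX k v) u"
      \<comment> \<open>Differentiating \<open>T v \<bullet> XX k v = dd k f v\<close> turns D T
        into the Hessian.\<close>
      by (rule dirder_cong[OF open_U u]) (simp add: TX)
    then have 1: "DD i T u \<bullet> XX k u = dd i (dd k f) u - T u \<bullet> DD i (XX k) u"
      by (simp add: dirder_inner_hfield[OF hT hfield_X u])
    have "T u \<bullet> Y = (\<Sum>m\<in>UNIV. (dual m u \<bullet> Y) * dd m f u)" for Y
    proof -
      have "T u \<bullet> Y = (\<Sum>m\<in>UNIV. \<Sum>j\<in>UNIV. ginv u j m * dd m f u * (XX j u \<bullet> Y))"
        by (simp add: T_def inner_sum_left b sum_distrib_right) (rule sum.swap)
      also have "\<dots> = (\<Sum>m\<in>UNIV. (\<Sum>j\<in>UNIV. ginv u j m * (Y \<bullet> XX j u)) * dd m f u)"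
        by (simp add: sum_distrib_left mult_ac inner_commute)
      finally show ?thesis by (simp add: ginv_X'[OF u] inner_commute)
    qed
    then show "DD i T u \<bullet> XX k u = dd i (dd k f) u - (\<Sum>m\<in>UNIV. (dual m u \<bullet> DD i (XX k) u) * dd m f u)"
      using 1 by simp
  qed
  finally show ?thesis .
qed

lemma X_cgrad:
  assumes u: "u \<in> U"
  shows "X (cgrad gram f u) u \<bullet> w = (\<Sum>k\<in>UNIV. (dual k u \<bullet> w) * dd k f u)"
proof -
  have b: "cgrad gram f u $ j = (\<Sum>k\<in>UNIV. ginv u j k * dd k f u)" for j
    by (simp add: cgrad_def ginv_def matrix_vector_mult_def dirder_def)
  have "X (cgrad gram f u) u \<bullet> w = (\<Sum>j\<in>UNIV. \<Sum>k\<in>UNIV. ginv u j k * dd k f u * (XX j u \<bullet> w))"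
    unfolding linear_expand[OF linear_X[OF u], of "cgrad gram f u"]
    by (simp add: inner_sum_left b sum_distrib_right)
  also have "\<dots> = (\<Sum>k\<in>UNIV. \<Sum>j\<in>UNIV. ginv u j k * dd k f u * (XX j u \<bullet> w))"
    by (rule sum.swap)
  also have "\<dots> = (\<Sum>k\<in>UNIV. (\<Sum>j\<in>UNIV. ginv u j k * (w \<bullet> XX j u)) * dd k f u)"
    by (simp add: sum_distrib_left mult_ac inner_commute)
  finally show ?thesis by (simp add: ginv_X'[OF u] inner_commute)
qed

end

section \<open>The Laplacian of a support function\<close>

text \<open>The assumption \<open>full\<close> expresses codimension one without counting
  dimensions: N and the coordinate frame together detect every horizontal vector.\<close>

locale sphere_hypersurface = sphere_immersion J U x
  for J :: "'v::euclidean_space \<Rightarrow> 'v" and U :: "(real^'m) set" and x +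
  fixes N :: "real^'m \<Rightarrow> 'v"
  assumes hfield_N: "hfield N"
    and N_N: "u \<in> U \<Longrightarrow> N u \<bullet> N u = 1"
    and N_X: "u \<in> U \<Longrightarrow> N u \<bullet> X a u = 0"
    and full: "u \<in> U \<Longrightarrow> Z \<bullet> x u = 0 \<Longrightarrow> Z \<bullet> J (x u) = 0 \<Longrightarrow> Z \<bullet> N u = 0 \<Longrightarrow>
      (\<And>i. Z \<bullet> X (axis i 1) u = 0) \<Longrightarrow> Z = 0"
begin

lemma N_dual: "u \<in> U \<Longrightarrow> N u \<bullet> dual i u = 0"
  by (simp add: dual_def inner_sum_right N_X)

lemma tangential_expand:
  assumes "u \<in> U" "Z \<bullet> x u = 0" "Z \<bullet> J (x u) = 0" "Z \<bullet> N u = 0"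
  shows "Z = (\<Sum>i\<in>UNIV. (Z \<bullet> dual i u) *\<^sub>R XX i u)" "Z = (\<Sum>i\<in>UNIV. (Z \<bullet> XX i u) *\<^sub>R dual i u)"
proof -
  note h = hfieldD[OF hfield_X assms(1)] hfieldD[OF hfield_dual assms(1)]
  let ?Y = "\<Sum>i\<in>UNIV. (Z \<bullet> dual i u) *\<^sub>R XX i u" and ?Y' = "\<Sum>i\<in>UNIV. (Z \<bullet> XX i u) *\<^sub>R dual i u"
  have N': "XX i u \<bullet> N u = 0" "dual i u \<bullet> N u = 0" for i
    using N_X[OF assms(1)] N_dual[OF assms(1)] by (simp_all add: inner_commute)
  have "Z - ?Y' = 0"
    by (rule full[OF assms(1)])
      (simp_all add: inner_diff_left inner_sum_left assms h N' dual_X sum_mult_delta)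
  then show "Z = ?Y'" by simp
  also have "\<dots> = (\<Sum>i\<in>UNIV. \<Sum>k\<in>UNIV. (ginv u k i * (Z \<bullet> XX i u)) *\<^sub>R XX k u)"
    by (simp add: dual_def scaleR_sum_right ginv_sym[OF assms(1), of _ _] mult.commute)
  also have "\<dots> = ?Y"
    by (subst sum.swap) (simp add: ginv_X scaleR_sum_left[symmetric])
  finally show "Z = ?Y" .
qed

lemma tangential_inner:
  assumes "u \<in> U" "Z \<bullet> x u = 0" "Z \<bullet> J (x u) = 0" "Z \<bullet> N u = 0"
  shows "Z \<bullet> Y = (\<Sum>i\<in>UNIV. (Z \<bullet> dual i u) * (XX i u \<bullet> Y))"
    "Z \<bullet> Y = (\<Sum>i\<in>UNIV. (Z \<bullet> XX i u) * (dual i u \<bullet> Y))"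
proof -
  have "Z \<bullet> Y = (\<Sum>i\<in>UNIV. (Z \<bullet> dual i u) *\<^sub>R XX i u) \<bullet> Y"
    by (rule arg_cong[where f = "\<lambda>Z. Z \<bullet> Y"]) (rule tangential_expand(1)[OF assms])
  then show "Z \<bullet> Y = (\<Sum>i\<in>UNIV. (Z \<bullet> dual i u) * (XX i u \<bullet> Y))" by (simp add: inner_sum_left)
  have "Z \<bullet> Y = (\<Sum>i\<in>UNIV. (Z \<bullet> XX i u) *\<^sub>R dual i u) \<bullet> Y"
    by (rule arg_cong[where f = "\<lambda>Z. Z \<bullet> Y"]) (rule tangential_expand(2)[OF assms])
  then show "Z \<bullet> Y = (\<Sum>i\<in>UNIV. (Z \<bullet> XX i u) * (dual i u \<bullet> Y))" by (simp add: inner_sum_left)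
qed

lemma D_N_N:
  assumes "u \<in> U" shows "D a N u \<bullet> N u = 0" "N u \<bullet> D a N u = 0"
proof -
  have "dirder a (\<lambda>u. N u \<bullet> N u) u = dirder a (\<lambda>u. 1) u"
    by (rule dirder_cong[OF open_U assms]) (simp add: N_N)
  then show "D a N u \<bullet> N u = 0" "N u \<bullet> D a N u = 0"
    using dirder_inner_hfield[OF hfield_N hfield_N assms, of a] by (simp_all add: inner_commute)
qed

lemma D_N_X: "u \<in> U \<Longrightarrow> D a N u \<bullet> X b u = - (N u \<bullet> D a (X b) u)"
proof -
  assume u: "u \<in> U"
  have "dirder a (\<lambda>u. N u \<bullet> X b u) u = dirder a (\<lambda>u. 0) u"
    by (rule dirder_cong[OF open_U u]) (simp add: N_X)
  then show ?thesis using dirder_inner_hfield[OF hfield_N hfield_X u, of a b] by simp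
qed

lemma D_N_X_sym: "u \<in> U \<Longrightarrow> D a N u \<bullet> X b u = D b N u \<bullet> X a u"
  by (simp add: D_N_X D_X_commute[of u a b])

lemma D_N_tangential:
  assumes "u \<in> U"
  shows "D a N u \<bullet> Y = (\<Sum>i\<in>UNIV. (D a N u \<bullet> dual i u) * (XX i u \<bullet> Y))"
    "D a N u \<bullet> Y = (\<Sum>i\<in>UNIV. (D a N u \<bullet> XX i u) * (dual i u \<bullet> Y))"
  by (rule tangential_inner[OF assms hfieldD(1,2)[OF hfield_D[OF hfield_N] assms] D_N_N(1)[OF assms]])+

lemma J_N_tangential:
  assumes "u \<in> U"
  shows "J (N u) \<bullet> Y = (\<Sum>i\<in>UNIV. (J (N u) \<bullet> dual i u) * (XX i u \<bullet> Y))"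
    "J (N u) \<bullet> Y = (\<Sum>i\<in>UNIV. (J (N u) \<bullet> XX i u) * (dual i u \<bullet> Y))"
  by (rule tangential_inner[OF assms]; simp add: hfieldD[OF hfield_N assms])+

text \<open>\<open>A\<close> is the shape operator \<open>- D N\<close>.\<close>

definition trA :: "real^'m \<Rightarrow> real" where
  "trA u = - (\<Sum>i\<in>UNIV. DD i N u \<bullet> dual i u)"

definition trA2 :: "real^'m \<Rightarrow> real" where
  "trA2 u = (\<Sum>i\<in>UNIV. \<Sum>j\<in>UNIV. (DD i N u \<bullet> dual j u) * (DD j N u \<bullet> dual i u))"

lemma smooth_trA: "smooth_on U trA"
  unfolding trA_def[abs_def]
  by (intro smooth_intros hfield_smooth hfield_D hfield_N hfield_dual)

text \<open>Raising the index in which N is differentiated: self-adjointness of the shape operator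
  moves that index into the other slot, where the inverse metric can act on it.\<close>

lemma ginv_D_N:
  assumes "u \<in> U"
  shows "(\<Sum>k\<in>UNIV. ginv u i k * (DD k N u \<bullet> Z)) = (\<Sum>j\<in>UNIV. (DD j N u \<bullet> dual i u) * (dual j u \<bullet> Z))"
proof -
  have "(\<Sum>k\<in>UNIV. ginv u i k * (DD k N u \<bullet> Z))
      = (\<Sum>k\<in>UNIV. ginv u i k * (\<Sum>j\<in>UNIV. (DD j N u \<bullet> XX k u) * (dual j u \<bullet> Z)))"
  proof (intro sum.cong refl arg_cong2[of _ _ _ _ "(*)"])
    fix k
    show "DD k N u \<bullet> Z = (\<Sum>j\<in>UNIV. (DD j N u \<bullet> XX k u) * (dual j u \<bullet> Z))"
      unfolding D_N_tangential(2)[OF assms, of "axis k 1" Z]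
      by (intro sum.cong refl arg_cong2[of _ _ _ _ "(*)"]) (rule D_N_X_sym[OF assms])
  qed
  also have "\<dots> = (\<Sum>j\<in>UNIV. \<Sum>k\<in>UNIV. ginv u i k * ((DD j N u \<bullet> XX k u) * (dual j u \<bullet> Z)))"
    unfolding sum_distrib_left by (rule sum.swap)
  also have "\<dots> = (\<Sum>j\<in>UNIV. (DD j N u \<bullet> dual i u) * (dual j u \<bullet> Z))"
    unfolding ginv_X[symmetric] sum_distrib_right by (simp add: mult_ac)
  finally show ?thesis .
qed

lemma ginv_XX:
  "(\<Sum>k\<in>UNIV. ginv u i k * (c * (Y \<bullet> XX k u))) = c * (Y \<bullet> dual i u)"
  unfolding ginv_X[symmetric] sum_distrib_left by (simp add: mult_ac)

text \<open>The inverse metric is symmetric, so exchanging the two summation indices changes the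
  sign of the sum.\<close>

lemma trace_skew:
  assumes "u \<in> U" "\<And>v w. \<phi> v w = - \<phi> w v" "\<And>w. linear (\<lambda>v. \<phi> v w)"
  shows "(\<Sum>i\<in>UNIV. \<phi> (dual i u) (XX i u)) = (0::real)"
proof -
  let ?s = "\<Sum>i\<in>UNIV. \<phi> (dual i u) (XX i u)"
  have e: "?s = (\<Sum>i\<in>UNIV. \<Sum>k\<in>UNIV. ginv u i k * \<phi> (XX k u) (XX i u))"
    unfolding dual_def by (simp add: linear_sum[OF assms(3)] linear_scale[OF assms(3)])
  also have "\<dots> = (\<Sum>i\<in>UNIV. \<Sum>k\<in>UNIV. ginv u k i * \<phi> (XX i u) (XX k u))"
    by (rule sum.swap)
  also have "\<dots> = (\<Sum>i\<in>UNIV. \<Sum>k\<in>UNIV. - (ginv u i k * \<phi> (XX k u) (XX i u)))"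
  proof (intro sum.cong refl)
    fix i k
    show "ginv u k i * \<phi> (XX i u) (XX k u) = - (ginv u i k * \<phi> (XX k u) (XX i u))"
      using assms(2)[of "XX i u" "XX k u"] ginv_sym[OF assms(1), of k i] by simp
  qed
  also have "\<dots> = - ?s" unfolding e by (simp add: sum_negf)
  finally show ?thesis by simp
qed

lemma trace_J:
  assumes "u \<in> U"
  shows "(\<Sum>i\<in>UNIV. J (XX i u) \<bullet> dual i u) = 0"
proof (rule trace_skew[OF assms])
  show "J w \<bullet> v = - (J v \<bullet> w)" for v w
    unfolding J_skew[of w v] by (simp add: inner_commute)
  show "linear (\<lambda>v. J w \<bullet> v)" for w
    by (simp add: linear_iff inner_add_right)
qed

text \<open>On the left is the tangential part of the traced second covariant derivative of N, that
  is, minus the divergence of A. Symmetry of A and the curvature identity move the free index l to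
  the outer derivative, leaving the derivative of the trace.\<close>

lemma codazzi_trace:
  assumes u: "u \<in> U"
  shows "(\<Sum>i\<in>UNIV. \<Sum>k\<in>UNIV. ginv u i k * (DD i (DD k N) u \<bullet> XX l u
      - (\<Sum>m\<in>UNIV. (dual m u \<bullet> DD i (XX k) u) * (DD m N u \<bullet> XX l u)))) = - dd l trA u"
proof -
  note hX = hfieldD[OF hfield_X u] and hN = hfieldD[OF hfield_N u]
  \<comment> \<open>The differentiated symmetry of A exchanges k and l; the remaining product is the
    Christoffel term for the new position of l.\<close>
  have 1: "DD i (DD k N) u \<bullet> XX l u - (\<Sum>m\<in>UNIV. (dual m u \<bullet> DD i (XX k) u) * (DD m N u \<bullet> XX l u))
      = DD i (DD l N) u \<bullet> XX k u - DD k N u \<bullet> DD i (XX l) u" for i k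
  proof -
    have "dd i (\<lambda>u. DD k N u \<bullet> XX l u) u = dd i (\<lambda>u. DD l N u \<bullet> XX k u) u"
      by (rule dirder_cong[OF open_U u]) (rule D_N_X_sym)
    then have "DD i (DD k N) u \<bullet> XX l u + DD k N u \<bullet> DD i (XX l) u
        = DD i (DD l N) u \<bullet> XX k u + DD l N u \<bullet> DD i (XX k) u"
      by (simp add: dirder_inner_hfield[OF hfield_D[OF hfield_N] hfield_X u])
    moreover have "(\<Sum>m\<in>UNIV. (dual m u \<bullet> DD i (XX k) u) * (DD m N u \<bullet> XX l u)) = DD l N u \<bullet> DD i (XX k) u"
      unfolding D_N_tangential(2)[OF u, of "axis l 1" "DD i (XX k) u"]
      by (rule sum.cong[OF refl]) (simp only: mult.commute D_N_X_sym[OF u, of "axis l 1"])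
    ultimately show ?thesis by simp
  qed
  \<comment> \<open>Exchanging i and l costs the trace of the curvature, which is Ric(N, X). One
    part is the trace of J; the two others are multiples of the inner product of J N with J X. All
    of them vanish.\<close>
  have 2: "(\<Sum>i\<in>UNIV. \<Sum>k\<in>UNIV. ginv u i k * (DD i (DD l N) u \<bullet> XX k u))
      = (\<Sum>i\<in>UNIV. \<Sum>k\<in>UNIV. ginv u i k * (DD l (DD i N) u \<bullet> XX k u))"
  proof -
    have "DD i (DD l N) u \<bullet> XX k u = DD l (DD i N) u \<bullet> XX k u
        + (2 * (XX i u \<bullet> J (XX l u))) * (J (N u) \<bullet> XX k u)
        - (J (N u) \<bullet> XX l u) * (J (XX i u) \<bullet> XX k u) + (J (N u) \<bullet> XX i u) * (J (XX l u) \<bullet> XX k u)" for i k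
      using curvature[OF hfield_N u hX(1,2), of "axis i 1" "axis l 1" "axis k 1"] by (simp add: N_X[OF u])
    then have "(\<Sum>i\<in>UNIV. \<Sum>k\<in>UNIV. ginv u i k * (DD i (DD l N) u \<bullet> XX k u))
      = (\<Sum>i\<in>UNIV. \<Sum>k\<in>UNIV. ginv u i k * (DD l (DD i N) u \<bullet> XX k u))
      + (\<Sum>i\<in>UNIV. 2 * (XX i u \<bullet> J (XX l u)) * (J (N u) \<bullet> dual i u))
      - (\<Sum>i\<in>UNIV. (J (N u) \<bullet> XX l u) * (J (XX i u) \<bullet> dual i u))
      + (\<Sum>i\<in>UNIV. (J (N u) \<bullet> XX i u) * (J (XX l u) \<bullet> dual i u))"
      by (simp add: distrib_left right_diff_distrib sum.distrib sum_subtractf ginv_XX del: mult.assoc)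
    also have "(\<Sum>i\<in>UNIV. (J (N u) \<bullet> XX l u) * (J (XX i u) \<bullet> dual i u)) = (J (N u) \<bullet> XX l u) * 0"
      unfolding sum_distrib_left[symmetric] trace_J[OF u] ..
    also have "(\<Sum>i\<in>UNIV. (J (N u) \<bullet> XX i u) * (J (XX l u) \<bullet> dual i u)) = J (N u) \<bullet> J (XX l u)"
      unfolding J_N_tangential(2)[OF u, of "J (XX l u)"] by (simp add: inner_commute)
    also have "(\<Sum>i\<in>UNIV. 2 * (XX i u \<bullet> J (XX l u)) * (J (N u) \<bullet> dual i u)) = 2 * (J (N u) \<bullet> J (XX l u))"
      unfolding J_N_tangential(1)[OF u, of "J (XX l u)"] sum_distrib_left by (simp add: mult_ac)
    finally show ?thesis by (simp add: N_X[OF u])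
  qed
  have 3: "(\<Sum>i\<in>UNIV. \<Sum>k\<in>UNIV. ginv u i k * (DD l (DD i N) u \<bullet> XX k u)) = (\<Sum>i\<in>UNIV. DD l (DD i N) u \<bullet> dual i u)"
    by (simp add: ginv_X)
  \<comment> \<open>These leftover terms are exactly those that arise from differentiating the dual
    frame in \<open>trA\<close>.\<close>
  have 4: "(\<Sum>i\<in>UNIV. \<Sum>k\<in>UNIV. ginv u i k * (DD k N u \<bullet> DD i (XX l) u)) = - (\<Sum>i\<in>UNIV. DD i N u \<bullet> DD l (dual i) u)"
  proof -
    have dd: "DD l (dual i) u \<bullet> XX j u = - (dual i u \<bullet> DD l (XX j) u)" for i j
    proof -
      have "dd l (\<lambda>u. dual i u \<bullet> XX j u) u = dd l (\<lambda>u. if i = j then 1 else 0) u"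
        by (rule dirder_cong[OF open_U u]) (simp add: dual_X)
      then show ?thesis by (simp add: dirder_inner_hfield[OF hfield_dual hfield_X u])
    qed
    have "(\<Sum>i\<in>UNIV. \<Sum>k\<in>UNIV. ginv u i k * (DD k N u \<bullet> DD i (XX l) u))
        = (\<Sum>i\<in>UNIV. \<Sum>j\<in>UNIV. (DD j N u \<bullet> dual i u) * (dual j u \<bullet> DD l (XX i) u))"
      unfolding ginv_D_N[OF u] by (intro sum.cong refl) (simp only: D_X_commute[OF u, of "axis l 1"])
    also have "\<dots> = (\<Sum>j\<in>UNIV. \<Sum>i\<in>UNIV. (DD j N u \<bullet> dual i u) * (dual j u \<bullet> DD l (XX i) u))"
      by (rule sum.swap)
    also have "\<dots> = (\<Sum>j\<in>UNIV. - (DD j N u \<bullet> DD l (dual j) u))"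
    proof (rule sum.cong[OF refl])
      fix j
      have "DD j N u \<bullet> DD l (dual j) u = (\<Sum>i\<in>UNIV. (DD j N u \<bullet> dual i u) * - (dual j u \<bullet> DD l (XX i) u))"
        unfolding D_N_tangential(1)[OF u, of "axis j 1" "DD l (dual j) u"] dd[symmetric] by (simp add: inner_commute)
      then show "(\<Sum>i\<in>UNIV. (DD j N u \<bullet> dual i u) * (dual j u \<bullet> DD l (XX i) u)) = - (DD j N u \<bullet> DD l (dual j) u)"
        by (simp add: sum_negf)
    qed
    finally show ?thesis by (simp add: sum_negf)
  qed
  have "dd l trA u = - (\<Sum>i\<in>UNIV. DD l (DD i N) u \<bullet> dual i u + DD i N u \<bullet> DD l (dual i) u)"
  proof -
    have d: "(\<lambda>u. DD i N u \<bullet> dual i u) differentiable (at u)" for i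
      by (intro smooth_on_imp_differentiable[OF hfield_inner_smooth u] hfield_D hfield_N hfield_dual)
    have d': "(\<lambda>u. \<Sum>i\<in>UNIV. DD i N u \<bullet> dual i u) differentiable (at u)"
      by (rule smooth_on_imp_differentiable[OF _ u]) (intro smooth_intros hfield_smooth hfield_D hfield_N hfield_dual)
    show ?thesis
      unfolding trA_def[abs_def] dirder_minus[OF d']
      by (simp add: dirder_sum[OF d] dirder_inner_hfield[OF hfield_D[OF hfield_N] hfield_dual u])
  qed
  then show ?thesis
    unfolding 1 by (simp add: right_diff_distrib sum_subtractf 2 3 4 sum.distrib)
qed

end

section \<open>Killing fields along a hypersurface\<close>

locale killing_hypersurface = sphere_hypersurface J U x N
  for J :: "'v::euclidean_space \<Rightarrow> 'v" and U :: "(real^'m) set" and x N +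
  fixes W :: "'v \<Rightarrow> 'v"
  assumes linear_W: "linear W" and W_skew: "W v \<bullet> w = - (v \<bullet> W w)" and W_J: "W (J v) = J (W v)"
begin

lemmas W_lin = linear_add[OF linear_W] linear_diff[OF linear_W] linear_neg[OF linear_W]
  linear_scale[OF linear_W] linear_0[OF linear_W]

lemma W_skew': "v \<bullet> W w = - (w \<bullet> W v)"
  using W_skew[of w v] by (simp add: inner_commute)

lemma W_self [simp]: "v \<bullet> W v = 0"
  using W_skew'[of v v] by simp

text \<open>The vertical component of \<open>W (x u)\<close>. As a function on the projected points
  it is the moment map of the Killing field, up to normalization.\<close>

definition \<mu> :: "real^'m \<Rightarrow> real" where "\<mu> u = J (x u) \<bullet> W (x u)"

text \<open>The covariant derivative of the induced Killing field: \<open>\<beta> u v w\<close> is v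
  paired with the derivative in direction w. The correction by \<open>\<mu>\<close> accounts for the
  vertical part of W x, and skewness is the Killing equation.\<close>

definition \<beta> :: "real^'m \<Rightarrow> 'v \<Rightarrow> 'v \<Rightarrow> real" where
  "\<beta> u v w = v \<bullet> W w - \<mu> u * (v \<bullet> J w)"

lemma \<beta>_skew: "\<beta> u v w = - \<beta> u w v"
  unfolding \<beta>_def using W_skew'[of v w] J_skew'[of v w] by simp

lemma \<beta>_self [simp]: "\<beta> u v v = 0"
  by (simp add: \<beta>_def)

lemma linear_\<beta>: "linear (\<lambda>v. \<beta> u v w)" "linear (\<lambda>w. \<beta> u v w)"
  unfolding \<beta>_def linear_iff by (simp_all add: inner_add_left inner_add_right W_lin J_lin algebra_simps)

lemma bounded_linear_W: "bounded_linear W"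
  using linear_W by (simp add: linear_conv_bounded_linear)

lemma smooth_W: "smooth_on U V \<Longrightarrow> smooth_on U (\<lambda>u. W (V u))"
  by (rule smooth_on_bounded_linear[OF open_U bounded_linear_W])

lemma dirder_W: "V differentiable (at u) \<Longrightarrow> dirder a (\<lambda>u. W (V u)) u = W (dirder a V u)"
  by (rule dirder_bounded_linear[OF bounded_linear_W])

lemma smooth_\<mu>: "smooth_on U \<mu>"
  unfolding \<mu>_def[abs_def] by (intro smooth_intros smooth_W)

lemma smooth_\<beta>: "hfield V \<Longrightarrow> hfield Y \<Longrightarrow> smooth_on U (\<lambda>u. \<beta> u (V u) (Y u))"
  unfolding \<beta>_def by (intro smooth_intros smooth_W smooth_\<mu> hfield_smooth)

lemma W_x_eqs:
  "x u \<bullet> W (J v) = v \<bullet> J (W (x u))" "J (x u) \<bullet> W v = - (v \<bullet> J (W (x u)))"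
  "J (x u) \<bullet> W (J v) = - (v \<bullet> W (x u))" "x u \<bullet> W v = - (v \<bullet> W (x u))"
  "v \<bullet> W (J w) = v \<bullet> J (W w)"
proof -
  show "v \<bullet> W (J w) = v \<bullet> J (W w)" for v w by (simp add: W_J)
  show "x u \<bullet> W v = - (v \<bullet> W (x u))" by (rule W_skew')
  show "x u \<bullet> W (J v) = v \<bullet> J (W (x u))"
    using W_skew'[of "x u" "J v"] by (simp add: J_skew)
  show "J (x u) \<bullet> W v = - (v \<bullet> J (W (x u)))"
    using W_skew'[of "J (x u)" v] by (simp add: W_J)
  show "J (x u) \<bullet> W (J v) = - (v \<bullet> W (x u))"
    using W_skew'[of "x u" v] by (simp add: W_J)
qed

lemma dirder_\<mu>:
  assumes "u \<in> U"
  shows "dirder a \<mu> u = - 2 * (X a u \<bullet> J (W (x u)))"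
proof -
  note d = x_differentiable[OF assms]
  have dW: "(\<lambda>u. W (x u)) differentiable (at u)"
    using smooth_on_imp_differentiable[OF smooth_W[OF smooth_x] assms] .
  have "dirder a \<mu> u = J (x u) \<bullet> W (dirder a x u) + J (dirder a x u) \<bullet> W (x u)"
    unfolding \<mu>_def[abs_def] by (simp add: dirder_inner differentiable_J d dW dirder_W dirder_J)
  also have "J (x u) \<bullet> W (dirder a x u) = - (X a u \<bullet> J (W (x u)))"
    using W_x_eqs(2)[of u "X a u"] by (simp add: dirder_x[OF assms] W_lin inner_add_right W_J)
  also have "J (dirder a x u) \<bullet> W (x u) = - (X a u \<bullet> J (W (x u)))"
    by (simp add: dirder_x[OF assms] J_lin inner_add_left inner_diff_left J_skew)
  finally show ?thesis by simp
qed

lemma dirder_inner_W_x: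
  assumes V: "hfield V" and u: "u \<in> U"
  shows "dirder a (\<lambda>u. V u \<bullet> W (x u)) u = D a V u \<bullet> W (x u) + \<beta> u (V u) (X a u)"
proof -
  have dW: "(\<lambda>u. W (x u)) differentiable (at u)"
    using smooth_on_imp_differentiable[OF smooth_W[OF smooth_x] u] .
  show ?thesis
    by (simp add: dirder_inner hfieldD(9)[OF V u] dW dirder_W x_differentiable[OF u] dirder_x[OF u]
        dirder_hfield[OF V u] inner_add_left inner_add_right inner_diff_left W_lin \<beta>_def W_J J_skew
        \<mu>_def algebra_simps)
qed

text \<open>The terms beyond the product rule are curvature terms linear in W x: as for every
  Killing field, the second covariant derivative is given by the curvature.\<close>

lemma dirder_\<beta>:
  assumes V: "hfield V" and Y: "hfield Y" and u: "u \<in> U"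
  shows "dirder a (\<lambda>u. \<beta> u (V u) (Y u)) u = \<beta> u (D a V u) (Y u) + \<beta> u (V u) (D a Y u)
    + (V u \<bullet> X a u) * (Y u \<bullet> W (x u)) - (J (V u) \<bullet> X a u) * (Y u \<bullet> J (W (x u)))
    - (Y u \<bullet> X a u) * (V u \<bullet> W (x u)) + (J (Y u) \<bullet> X a u) * (V u \<bullet> J (W (x u)))
    + 2 * (X a u \<bullet> J (W (x u))) * (V u \<bullet> J (Y u))"
proof -
  note d = hfieldD(9)[OF V u] hfieldD(9)[OF Y u]
  note hV = hfieldD[OF V u] and hY = hfieldD[OF Y u]
  have dW: "(\<lambda>u. W (Y u)) differentiable (at u)" "(\<lambda>u. J (Y u)) differentiable (at u)"
    "\<mu> differentiable (at u)" "(\<lambda>u. V u \<bullet> W (Y u)) differentiable (at u)"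
    "(\<lambda>u. V u \<bullet> J (Y u)) differentiable (at u)" "(\<lambda>u. \<mu> u * (V u \<bullet> J (Y u))) differentiable (at u)"
    by (rule smooth_on_imp_differentiable[OF _ u],
        intro smooth_intros smooth_W hfield_smooth[OF V] hfield_smooth[OF Y] smooth_\<mu>)+
  have "dirder a (\<lambda>u. \<beta> u (V u) (Y u)) u
    = V u \<bullet> W (dirder a Y u) + dirder a V u \<bullet> W (Y u)
      - (\<mu> u * (V u \<bullet> J (dirder a Y u) + dirder a V u \<bullet> J (Y u)) + dirder a \<mu> u * (V u \<bullet> J (Y u)))"
    unfolding \<beta>_def by (simp add: dirder_diff dirder_mult dirder_inner d dW dirder_W dirder_J)
  also have "V u \<bullet> W (dirder a Y u) = V u \<bullet> W (D a Y u) + phase a u * (V u \<bullet> J (W (Y u)))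
      - (Y u \<bullet> X a u) * (V u \<bullet> W (x u)) + (J (Y u) \<bullet> X a u) * (V u \<bullet> J (W (x u)))"
    by (simp add: dirder_hfield[OF Y u] W_lin inner_add_right inner_diff_right W_J)
  also have "dirder a V u \<bullet> W (Y u) = D a V u \<bullet> W (Y u) - phase a u * (V u \<bullet> J (W (Y u)))
      + (V u \<bullet> X a u) * (Y u \<bullet> W (x u)) - (J (V u) \<bullet> X a u) * (Y u \<bullet> J (W (x u)))"
    by (simp add: dirder_hfield[OF V u] inner_add_left inner_diff_left W_x_eqs J_skew[of "V u" "W (Y u)"])
  also have "V u \<bullet> J (dirder a Y u) = V u \<bullet> J (D a Y u) - phase a u * (V u \<bullet> Y u)"
    by (simp add: dirder_hfield[OF Y u] J_lin inner_add_right inner_diff_right hV)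
  also have "dirder a V u \<bullet> J (Y u) = D a V u \<bullet> J (Y u) + phase a u * (V u \<bullet> Y u)"
    by (simp add: dirder_hfield[OF V u] inner_add_left inner_diff_left hY)
  finally show ?thesis by (simp add: dirder_\<mu>[OF u] \<beta>_def algebra_simps)
qed

text \<open>The Hessian of the support function splits into the second derivative of N, mixed terms
  with one derivative on N and one on W, and the second derivative of W. In the trace the first
  gives grad H and the norm of A, the second vanishes, and the third gives the Ricci
  curvature.\<close>

theorem laplace_support:
  assumes u: "u \<in> U"
  shows "claplace gram (\<lambda>u. N u \<bullet> W (x u)) u =
    - (\<Sum>l\<in>UNIV. (dual l u \<bullet> W (x u)) * dd l trA u)
    - (real CARD('m) + 3 + trA2 u) * (N u \<bullet> W (x u))"
proof -
  let ?w = "W (x u)" and ?f = "\<lambda>u. N u \<bullet> W (x u)"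
  note hN = hfieldD[OF hfield_N u]
  have sm: "smooth_on U ?f"
    by (intro smooth_intros smooth_W hfield_smooth hfield_N)
  have df: "dirder a ?f v = D a N v \<bullet> W (x v) + \<beta> v (N v) (X a v)" if "v \<in> U" for a v
    by (rule dirder_inner_W_x[OF hfield_N that])
  \<comment> \<open>The second covariant derivative of N along the hypersurface; \<open>R\<close>
    collects the second derivative of the Killing field.\<close>
  define S where "S = (\<lambda>i k. DD i (DD k N) u - (\<Sum>m\<in>UNIV. (dual m u \<bullet> DD i (XX k) u) *\<^sub>R DD m N u))"
  define R where "R = (\<lambda>i k. - (J (N u) \<bullet> XX i u) * (XX k u \<bullet> J ?w) - (XX k u \<bullet> XX i u) * (N u \<bullet> ?w)
      + (J (XX k u) \<bullet> XX i u) * (N u \<bullet> J ?w) + 2 * (XX i u \<bullet> J ?w) * (N u \<bullet> J (XX k u)))"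
  have q: "dd i (dd k ?f) u - (\<Sum>m\<in>UNIV. (dual m u \<bullet> DD i (XX k) u) * dd m ?f u)
      = S i k \<bullet> ?w + \<beta> u (DD k N u) (XX i u) + \<beta> u (DD i N u) (XX k u) + R i k" for i k
  proof -
    have "dd i (dd k ?f) u = dd i (\<lambda>v. DD k N v \<bullet> W (x v) + \<beta> v (N v) (XX k v)) u"
      by (rule dirder_cong[OF open_U u]) (rule df)
    also have "\<dots> = dd i (\<lambda>v. DD k N v \<bullet> W (x v)) u + dd i (\<lambda>v. \<beta> v (N v) (XX k v)) u"
      by (rule dirder_add; rule smooth_on_imp_differentiable[OF _ u];
          intro smooth_intros smooth_W hfield_smooth hfield_D hfield_N smooth_\<beta> hfield_X)
    also have "\<dots> = DD i (DD k N) u \<bullet> ?w + \<beta> u (DD k N u) (XX i u) + \<beta> u (DD i N u) (XX k u)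
       + \<beta> u (N u) (DD i (XX k) u) + R i k"
      unfolding dirder_inner_W_x[OF hfield_D[OF hfield_N] u] dirder_\<beta>[OF hfield_N hfield_X u] R_def
      by (simp add: N_X[OF u])
    finally have 1: "dd i (dd k ?f) u = DD i (DD k N) u \<bullet> ?w + \<beta> u (DD k N u) (XX i u) + \<beta> u (DD i N u) (XX k u)
       + \<beta> u (N u) (DD i (XX k) u) + R i k" .
    \<comment> \<open>The normal part of D X drops out because \<open>\<beta>\<close> vanishes on
      (N, N). What is left cancels against the Christoffel correction of the first
      derivatives.\<close>
    have "\<beta> u (N u) (DD i (XX k) u) = (\<Sum>m\<in>UNIV. (dual m u \<bullet> DD i (XX k) u) * \<beta> u (N u) (XX m u))"
    proof -
      let ?Z = "DD i (XX k) u" let ?T = "?Z - (?Z \<bullet> N u) *\<^sub>R N u"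
      note hZ = hfieldD[OF hfield_D[OF hfield_X] u]
      have T: "?T = (\<Sum>m\<in>UNIV. (?T \<bullet> dual m u) *\<^sub>R XX m u)"
        by (rule tangential_expand(1)[OF u]) (simp_all add: inner_diff_left hZ hN N_N[OF u])
      have "\<beta> u (N u) ?Z = \<beta> u (N u) ?T"
        by (simp add: linear_diff[OF linear_\<beta>(2)] linear_scale[OF linear_\<beta>(2)])
      also have "\<dots> = (\<Sum>m\<in>UNIV. (?T \<bullet> dual m u) * \<beta> u (N u) (XX m u))"
        by (subst T) (simp add: linear_sum[OF linear_\<beta>(2)] linear_scale[OF linear_\<beta>(2)])
      also have "\<dots> = (\<Sum>m\<in>UNIV. (dual m u \<bullet> ?Z) * \<beta> u (N u) (XX m u))"
        by (intro sum.cong refl arg_cong2[of _ _ _ _ "(*)"])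
          (simp add: inner_diff_left N_dual[OF u] inner_commute[of ?Z])
      finally show ?thesis .
    qed
    then show ?thesis unfolding 1 df[OF u] S_def
      by (simp add: distrib_left sum.distrib inner_diff_left inner_sum_left)
  qed
  \<comment> \<open>Differentiating the orthogonality of D N and N gives the normal component of S,
    the source of the squared norm of A. The tangential component is left to the Codazzi
    equation.\<close>
  have Sw: "S i k \<bullet> ?w = - (DD k N u \<bullet> DD i N u) * (N u \<bullet> ?w) + (\<Sum>l\<in>UNIV. (S i k \<bullet> XX l u) * (dual l u \<bullet> ?w))" for i k
  proof -
    let ?T = "S i k - (S i k \<bullet> N u) *\<^sub>R N u"
    have hS: "S i k \<bullet> x u = 0" "S i k \<bullet> J (x u) = 0"
      using hfieldD[OF hfield_D[OF hfield_D[OF hfield_N]] u] hfieldD[OF hfield_D[OF hfield_N] u]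
      by (simp_all add: S_def inner_diff_left inner_sum_left)
    have "dd i (\<lambda>v. DD k N v \<bullet> N v) u = dd i (\<lambda>v. 0) u"
      by (rule dirder_cong[OF open_U u]) (rule D_N_N)
    then have SN: "S i k \<bullet> N u = - (DD k N u \<bullet> DD i N u)"
      by (simp add: S_def inner_diff_left inner_sum_left D_N_N[OF u] dirder_inner_hfield[OF hfield_D[OF hfield_N] hfield_N u])
    have "?T \<bullet> ?w = (\<Sum>l\<in>UNIV. (?T \<bullet> XX l u) * (dual l u \<bullet> ?w))"
      by (rule tangential_inner(2)[OF u]) (simp_all add: inner_diff_left hS hN N_N[OF u])
    then have "S i k \<bullet> ?w - (S i k \<bullet> N u) * (N u \<bullet> ?w) = (\<Sum>l\<in>UNIV. (S i k \<bullet> XX l u) * (dual l u \<bullet> ?w))"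
      by (simp only: inner_diff_left inner_scaleR_left N_X[OF u] mult_zero_right diff_0_right)
    then show ?thesis unfolding SN by simp
  qed
  have sq: "(\<Sum>i\<in>UNIV. \<Sum>k\<in>UNIV. ginv u i k * (DD k N u \<bullet> DD i N u)) = trA2 u"
    unfolding ginv_D_N[OF u] trA2_def
    by (subst sum.swap) (simp add: inner_commute)
  have A: "(\<Sum>i\<in>UNIV. \<Sum>k\<in>UNIV. ginv u i k * (S i k \<bullet> ?w))
      = - trA2 u * ?f u - (\<Sum>l\<in>UNIV. (dual l u \<bullet> ?w) * dd l trA u)"
  proof -
    have "(\<Sum>i\<in>UNIV. \<Sum>k\<in>UNIV. ginv u i k * (S i k \<bullet> ?w))
      = - (\<Sum>i\<in>UNIV. \<Sum>k\<in>UNIV. ginv u i k * (DD k N u \<bullet> DD i N u)) * ?f u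
        + (\<Sum>i\<in>UNIV. \<Sum>k\<in>UNIV. \<Sum>l\<in>UNIV. ginv u i k * (S i k \<bullet> XX l u) * (dual l u \<bullet> ?w))"
      unfolding Sw
      by (simp only: distrib_left sum.distrib sum_distrib_left sum_distrib_right sum_negf[symmetric]
          mult_minus_left mult_minus_right mult.assoc)
    also have "(\<Sum>i\<in>UNIV. \<Sum>k\<in>UNIV. \<Sum>l\<in>UNIV. ginv u i k * (S i k \<bullet> XX l u) * (dual l u \<bullet> ?w))
      = (\<Sum>i\<in>UNIV. \<Sum>l\<in>UNIV. \<Sum>k\<in>UNIV. ginv u i k * (S i k \<bullet> XX l u) * (dual l u \<bullet> ?w))"
      by (intro sum.cong refl sum.swap)
    also have "\<dots> = (\<Sum>l\<in>UNIV. \<Sum>i\<in>UNIV. \<Sum>k\<in>UNIV. ginv u i k * (S i k \<bullet> XX l u) * (dual l u \<bullet> ?w))"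
      by (rule sum.swap)
    also have "\<dots> = (\<Sum>l\<in>UNIV. (\<Sum>i\<in>UNIV. \<Sum>k\<in>UNIV. ginv u i k * (S i k \<bullet> XX l u)) * (dual l u \<bullet> ?w))"
      by (simp add: sum_distrib_right)
    also have "\<dots> = (\<Sum>l\<in>UNIV. - dd l trA u * (dual l u \<bullet> ?w))"
      using codazzi_trace[OF u] by (simp add: S_def inner_diff_left inner_sum_left)
    finally show ?thesis unfolding sq by (simp add: sum_negf mult.commute)
  qed
  have B2: "(\<Sum>i\<in>UNIV. \<Sum>k\<in>UNIV. ginv u i k * \<beta> u (DD i N u) (XX k u)) = (\<Sum>i\<in>UNIV. \<beta> u (DD i N u) (dual i u))"
    by (simp add: dual_def linear_sum[OF linear_\<beta>(2)] linear_scale[OF linear_\<beta>(2)])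
  have B1: "(\<Sum>i\<in>UNIV. \<Sum>k\<in>UNIV. ginv u i k * \<beta> u (DD k N u) (XX i u)) = (\<Sum>i\<in>UNIV. \<beta> u (DD i N u) (dual i u))"
    by (subst sum.swap) (simp add: dual_def linear_sum[OF linear_\<beta>(2)] linear_scale[OF linear_\<beta>(2)] ginv_sym[OF u])
  \<comment> \<open>The product of the self-adjoint shape operator with a skew form has trace zero:
    transposing with \<open>ginv_D_N\<close> reproduces the sum with the opposite sign.\<close>
  have B0: "(\<Sum>i\<in>UNIV. \<beta> u (DD i N u) (dual i u)) = 0"
  proof -
    have b: "\<beta> u v (XX i u) = v \<bullet> (W (XX i u) - \<mu> u *\<^sub>R J (XX i u))" for i v
      by (simp add: \<beta>_def inner_diff_right)
    have "(\<Sum>i\<in>UNIV. \<Sum>k\<in>UNIV. ginv u i k * \<beta> u (DD k N u) (XX i u))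
      = (\<Sum>i\<in>UNIV. \<Sum>j\<in>UNIV. (DD j N u \<bullet> dual i u) * \<beta> u (dual j u) (XX i u))"
      by (simp only: b ginv_D_N[OF u])
    also have "\<dots> = (\<Sum>j\<in>UNIV. \<Sum>i\<in>UNIV. (DD j N u \<bullet> dual i u) * \<beta> u (dual j u) (XX i u))"
      by (rule sum.swap)
    also have "\<dots> = (\<Sum>j\<in>UNIV. \<beta> u (dual j u) (DD j N u))"
    proof (rule sum.cong[OF refl])
      fix j
      have "DD j N u = (\<Sum>i\<in>UNIV. (DD j N u \<bullet> dual i u) *\<^sub>R XX i u)"
        by (rule tangential_expand(1)[OF u hfieldD(1,2)[OF hfield_D[OF hfield_N] u] D_N_N(1)[OF u]])
      then have "\<beta> u (dual j u) (DD j N u) = \<beta> u (dual j u) (\<Sum>i\<in>UNIV. (DD j N u \<bullet> dual i u) *\<^sub>R XX i u)"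
        by simp
      then show "(\<Sum>i\<in>UNIV. (DD j N u \<bullet> dual i u) * \<beta> u (dual j u) (XX i u)) = \<beta> u (dual j u) (DD j N u)"
        by (simp add: linear_sum[OF linear_\<beta>(2)] linear_scale[OF linear_\<beta>(2)])
    qed
    also have "\<dots> = - (\<Sum>j\<in>UNIV. \<beta> u (DD j N u) (dual j u))"
      unfolding sum_negf[symmetric] by (intro sum.cong refl \<beta>_skew)
    finally show ?thesis unfolding B1 by simp
  qed
  \<comment> \<open>The four traces contribute -1, -m, 0 and -2 times the support function. The m
    comes from the trace of the identity on the tangent space, the 1 and the 2 from the direction J
    N.\<close>
  have RR: "(\<Sum>i\<in>UNIV. \<Sum>k\<in>UNIV. ginv u i k * R i k) = - (real CARD('m) + 3) * ?f u"
  proof -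
    have "R i k = - (J (N u) \<bullet> XX i u) * (J ?w \<bullet> XX k u) + - (N u \<bullet> ?w) * (XX i u \<bullet> XX k u)
      + - (N u \<bullet> J ?w) * (J (XX i u) \<bullet> XX k u) + - (2 * (XX i u \<bullet> J ?w)) * (J (N u) \<bullet> XX k u)" for i k
      unfolding R_def using J_skew[of "XX k u" "XX i u"] J_skew[of "N u" "XX k u"]
      by (simp add: inner_commute[of "XX k u"])
    then have "(\<Sum>i\<in>UNIV. \<Sum>k\<in>UNIV. ginv u i k * R i k)
      = (\<Sum>i\<in>UNIV. - (J (N u) \<bullet> XX i u) * (J ?w \<bullet> dual i u)) + (\<Sum>i\<in>UNIV. - (N u \<bullet> ?w) * (XX i u \<bullet> dual i u))
      + (\<Sum>i\<in>UNIV. - (N u \<bullet> J ?w) * (J (XX i u) \<bullet> dual i u)) + (\<Sum>i\<in>UNIV. - (2 * (XX i u \<bullet> J ?w)) * (J (N u) \<bullet> dual i u))"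
      by (simp only: distrib_left sum.distrib ginv_XX)
    also have "(\<Sum>i\<in>UNIV. - (J (N u) \<bullet> XX i u) * (J ?w \<bullet> dual i u)) = - (J (N u) \<bullet> J ?w)"
      unfolding J_N_tangential(2)[OF u, of "J ?w"] by (simp add: sum_negf inner_commute)
    also have "(\<Sum>i\<in>UNIV. - (2 * (XX i u \<bullet> J ?w)) * (J (N u) \<bullet> dual i u)) = - 2 * (J (N u) \<bullet> J ?w)"
      unfolding J_N_tangential(1)[OF u, of "J ?w"] sum_distrib_left by (simp add: mult_ac)
    also have "(\<Sum>i\<in>UNIV. - (N u \<bullet> J ?w) * (J (XX i u) \<bullet> dual i u)) = 0"
      unfolding sum_distrib_left[symmetric] trace_J[OF u] by simp
    also have "(\<Sum>i\<in>UNIV. - (N u \<bullet> ?w) * (XX i u \<bullet> dual i u)) = - real CARD('m) * ?f u"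
      by (simp add: inner_commute[of "XX _ u"] dual_X[OF u])
    finally show ?thesis by (simp add: algebra_simps)
  qed
  show ?thesis
    unfolding laplace_gram[OF sm u] q
    by (simp add: distrib_left sum.distrib A B1 B2 B0 RR) (simp add: algebra_simps)
qed

end

section \<open>Octonions and the Fubini-Study metric\<close>

lemma UNIV_7: "(UNIV :: 7 set) = {0, 1, 2, 3, 4, 5, 6}"
proof -
  have "x \<in> {0, 1, 2, 3, 4, 5, 6}" for x :: 7
  proof (induct x)
    case (of_int z)
    then have "z = 0 \<or> z = 1 \<or> z = 2 \<or> z = 3 \<or> z = 4 \<or> z = 5 \<or> z = 6" by fastforce
    then show ?case by auto
  qed
  then show ?thesis by blast
qed

lemma UNIV_6: "(UNIV :: 6 set) = {1, 2, 3, 4, 5, 0}"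
proof -
  have "x \<in> {1, 2, 3, 4, 5, 0}" for x :: 6
  proof (induct x)
    case (of_int z)
    then have "z = 0 \<or> z = 1 \<or> z = 2 \<or> z = 3 \<or> z = 4 \<or> z = 5" by fastforce
    then show ?case by auto
  qed
  then show ?thesis by blast
qed

lemma sum_7: "sum f (UNIV :: 7 set) = f 0 + f 1 + f 2 + f 3 + f 4 + f 5 + f 6"
  unfolding UNIV_7 by (simp add: ac_simps)

lemma forall_7: "(\<forall>i::7. P i) \<longleftrightarrow> P 0 \<and> P 1 \<and> P 2 \<and> P 3 \<and> P 4 \<and> P 5 \<and> P 6"
  using UNIV_7 by (metis UNIV_I empty_iff insert_iff)

lemma sum_6: "sum f (UNIV :: 6 set) = f 1 + f 2 + f 3 + f 4 + f 5 + f 0"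
  unfolding UNIV_6 by (simp add: ac_simps)

lemma forall_6: "(\<forall>i::6. P i) \<longleftrightarrow> P 1 \<and> P 2 \<and> P 3 \<and> P 4 \<and> P 5 \<and> P 0"
  using UNIV_6 by (metis UNIV_I empty_iff insert_iff)

lemma octonion_eq_iff: "x = y \<longleftrightarrow> fst x = fst y \<and> (\<forall>i. snd x $ i = snd y $ i)" for x y :: octonion
  by (auto simp: prod_eq_iff vec_eq_iff)

lemma octonion_inner: "x \<bullet> y = fst x * fst y + (\<Sum>i\<in>UNIV. snd x $ i * snd y $ i)" for x y :: octonion
  by (cases x, cases y) (simp add: inner_prod_def inner_vec_def)

text \<open>A constant for \<open>oct_i\<close>, whose index \<open>1\<close> the simplifier would rewrite to \<open>Suc 0\<close>.\<close>

definition oct_im :: octonion where "oct_im = (0, axis 1 1)"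

lemma oct_e_1: "oct_e 1 = oct_im" "oct_e (Suc 0) = oct_im"
  by (simp_all add: oct_e_def oct_im_def)

definition oct_J :: "octonion \<Rightarrow> octonion" where "oct_J x = oct_im \<odot> x"

lemma mod_7: "(7::7) = 0" "(8::7) = 1" "(9::7) = 2" "(10::7) = 3" "(11::7) = 4" "(12::7) = 5"
  by simp_all

lemma fst_oct_J: "fst (oct_J x) = - snd x $ 1"
  by (simp add: oct_J_def oct_mult_def oct_im_def inner_axis')

lemma snd_oct_J:
  "snd (oct_J x) $ 0 = snd x $ 3" "snd (oct_J x) $ 1 = fst x" "snd (oct_J x) $ 2 = - snd x $ 4"
  "snd (oct_J x) $ 3 = - snd x $ 0" "snd (oct_J x) $ 4 = snd x $ 2"
  "snd (oct_J x) $ 5 = - snd x $ 6" "snd (oct_J x) $ 6 = snd x $ 5"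
  by (simp_all add: oct_J_def oct_mult_def oct_im_def axis_def mod_7)

lemmas oct_coord = octonion_eq_iff octonion_inner forall_7 sum_7 fst_oct_J snd_oct_J

interpretation oct: complex_structure oct_J
proof
  show "oct_J (x + y) = oct_J x + oct_J y" "oct_J (r *\<^sub>R x) = r *\<^sub>R oct_J x" for x y r
    by (simp_all add: oct_coord)
  show "oct_J (oct_J v) = - v" for v
    by (simp add: oct_coord)
  show "oct_J v \<bullet> w = - (v \<bullet> oct_J w)" for v w
    by (simp add: oct_coord algebra_simps)
qed

lemma oct_J_e0: "oct_J (oct_e 0) = oct_im" "oct_J oct_im = - oct_e 0"
  by (simp_all add: oct_coord) (simp_all add: oct_e_def oct_im_def axis_def)

lemma oct_mult_complex: "(r *\<^sub>R oct_e 0 + s *\<^sub>R oct_im) \<odot> x = r *\<^sub>R x + s *\<^sub>R oct_J x"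
  by (simp add: oct_coord) (simp add: oct_mult_def oct_e_def oct_im_def axis_def inner_vec_def sum_7 mod_7)

text \<open>Only here are octonions multiplied by something other than a complex scalar on the left.
  Since the product is not associative, the identity is checked in coordinates for each of the six
  units; afterwards J and inner products suffice.\<close>

lemma W_field_eq:
  assumes "n \<in> {1..<7}"
  shows "W_field (oct_e (n + 1)) x = (x \<bullet> oct_e 0) *\<^sub>R oct_e (n + 1) + (x \<bullet> oct_im) *\<^sub>R oct_J (oct_e (n + 1))
    - (x \<bullet> oct_e (n + 1)) *\<^sub>R oct_e 0 - (x \<bullet> oct_J (oct_e (n + 1))) *\<^sub>R oct_im"
proof -
  have "n = 1 \<or> n = 2 \<or> n = 3 \<or> n = 4 \<or> n = 5 \<or> n = 6" using assms by auto
  then show ?thesis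
    by (elim disjE; simp add: W_field_def oct_e_1 oct_J_def[symmetric] oct_coord;
      simp add: oct_mult_def oct_e_def oct_im_def axis_def inner_vec_def sum_7 mod_7 snd_oct_J fst_oct_J)
qed

section \<open>The affine chart and its section\<close>

text \<open>Component n of the chart belongs to the unit with number n + 1. Both index types are
  cyclic: the sixth component has index 0 in type \<open>6\<close>, and the seventh unit has index 0
  in type \<open>7\<close>.\<close>

definition oct_emb :: "real^6 \<Rightarrow> octonion" where
  "oct_emb w = (0, \<chi> c. if c = 0 then w $ 0 else if c = 1 then 0 else if c = 2 then w $ 1 else if c = 3 then w $ 2
     else if c = 4 then w $ 3 else if c = 5 then w $ 4 else w $ 5)"

definition oct_co :: "octonion \<Rightarrow> real^6" where
  "oct_co y = vector (map (\<lambda>n. y \<bullet> oct_e (n + 1)) [1..<7])"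

lemma vector_map_nth:
  "(vector (map f [1..<7]) :: 'a::zero^6) $ 1 = f 1" "(vector (map f [1..<7]) :: 'a::zero^6) $ 2 = f 2"
  "(vector (map f [1..<7]) :: 'a::zero^6) $ 3 = f 3" "(vector (map f [1..<7]) :: 'a::zero^6) $ 4 = f 4"
  "(vector (map f [1..<7]) :: 'a::zero^6) $ 5 = f 5" "(vector (map f [1..<7]) :: 'a::zero^6) $ 0 = f 6"
proof -
  have "[1..<7::nat] = [1, 2, 3, 4, 5, 6]" by (simp add: upt_rec)
  then show "(vector (map f [1..<7]) :: 'a::zero^6) $ 1 = f 1" "(vector (map f [1..<7]) :: 'a::zero^6) $ 2 = f 2"
    "(vector (map f [1..<7]) :: 'a::zero^6) $ 3 = f 3" "(vector (map f [1..<7]) :: 'a::zero^6) $ 4 = f 4"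
    "(vector (map f [1..<7]) :: 'a::zero^6) $ 5 = f 5" "(vector (map f [1..<7]) :: 'a::zero^6) $ 0 = f 6"
    by (simp_all add: vector_def)
qed

lemma oct_co_nth:
  "oct_co y $ 1 = snd y $ 2" "oct_co y $ 2 = snd y $ 3" "oct_co y $ 3 = snd y $ 4"
  "oct_co y $ 4 = snd y $ 5" "oct_co y $ 5 = snd y $ 6" "oct_co y $ 0 = snd y $ 0"
  unfolding oct_co_def vector_map_nth by (simp_all add: oct_coord oct_e_def axis_def)

lemma oct_co_emb [simp]: "oct_co (oct_emb w) = w"
  by (simp add: vec_eq_iff forall_6 oct_co_nth oct_emb_def)

lemma linear_oct_emb: "linear oct_emb"
  by (rule linearI) (simp_all add: oct_coord oct_emb_def)

lemma linear_oct_co: "linear oct_co"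
  by (rule linearI) (simp_all add: vec_eq_iff forall_6 oct_co_nth)

lemma oct_emb_inner [simp]: "oct_emb w \<bullet> oct_emb w' = w \<bullet> w'" "oct_emb w \<bullet> oct_e 0 = 0" "oct_emb w \<bullet> oct_im = 0"
  "oct_e 0 \<bullet> oct_emb w = 0" "oct_im \<bullet> oct_emb w = 0"
  by (simp_all add: oct_coord oct_emb_def inner_vec_def sum_6 oct_e_def oct_im_def axis_def)

lemma oct_e_inner [simp]: "oct_e 0 \<bullet> oct_e 0 = 1" "oct_im \<bullet> oct_im = 1" "oct_e 0 \<bullet> oct_im = 0" "oct_im \<bullet> oct_e 0 = 0"
  by (simp_all add: oct_coord oct_e_def oct_im_def axis_def)

lemma oct_decomp: "y = (y \<bullet> oct_e 0) *\<^sub>R oct_e 0 + (y \<bullet> oct_im) *\<^sub>R oct_im + oct_emb (oct_co y)"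
  by (simp add: oct_coord oct_emb_def oct_co_nth oct_e_def oct_im_def axis_def)

lemma oct_co_e [simp]: "oct_co (oct_e 0) = 0" "oct_co oct_im = 0"
  by (simp_all add: vec_eq_iff forall_6 oct_co_nth oct_e_def oct_im_def axis_def)

lemma oct_e_emb: "n \<in> {1..<7} \<Longrightarrow> oct_e (n + 1) = oct_emb (axis (of_nat n) 1)"
proof -
  assume "n \<in> {1..<7}"
  then have "n = 1 \<or> n = 2 \<or> n = 3 \<or> n = 4 \<or> n = 5 \<or> n = 6" by auto
  then show ?thesis
    by (elim disjE; simp add: oct_coord oct_emb_def; simp add: oct_e_def oct_im_def axis_def)
qed

lemma oct_J_inner_e: "oct_J x \<bullet> oct_e 0 = - (x \<bullet> oct_im)" "oct_J x \<bullet> oct_im = x \<bullet> oct_e 0"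
  by (simp_all add: oct.J_skew oct_J_e0)

text \<open>The chart as a function on representatives. It is applied to all of x instead of b
  alone: the part of x in the complex line becomes real after multiplication by the inverse of a,
  and \<open>oct_co\<close> discards it.\<close>

definition ochart :: "octonion \<Rightarrow> real^6" where
  "ochart x = inverse ((x \<bullet> oct_e 0)\<^sup>2 + (x \<bullet> oct_im)\<^sup>2) *\<^sub>R
     oct_co ((x \<bullet> oct_e 0) *\<^sub>R x - (x \<bullet> oct_im) *\<^sub>R oct_J x)"

definition osec :: "real^6 \<Rightarrow> octonion" where
  "osec y = inverse (sqrt (1 + y \<bullet> y)) *\<^sub>R (oct_e 0 + oct_emb y)"

lemma one_plus_inner_pos: "1 + y \<bullet> y > 0" for y :: "'a::real_inner"
  by (simp add: add_pos_nonneg)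

lemma osec_inner: "osec y \<bullet> osec y = 1"
  using one_plus_inner_pos[of y]
  by (simp add: osec_def inner_add_left inner_add_right power2_eq_square[symmetric] field_simps)

lemma hopf_eq: "hopf x = {cos \<theta> *\<^sub>R x + sin \<theta> *\<^sub>R oct_J x | \<theta>. True}"
  by (simp add: hopf_def oct_mult_complex oct_e_1)

text \<open>The chart is invariant under all nonzero complex scalars, not only those of modulus one.
  The rotations give independence of the representative, the real scalars the radial
  extension.\<close>

lemma ochart_rotate:
  assumes "r\<^sup>2 + s\<^sup>2 \<noteq> 0"
  shows "ochart (r *\<^sub>R x + s *\<^sub>R oct_J x) = ochart x"
    "((r *\<^sub>R x + s *\<^sub>R oct_J x) \<bullet> oct_e 0)\<^sup>2 + ((r *\<^sub>R x + s *\<^sub>R oct_J x) \<bullet> oct_im)\<^sup>2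
      = (r\<^sup>2 + s\<^sup>2) * ((x \<bullet> oct_e 0)\<^sup>2 + (x \<bullet> oct_im)\<^sup>2)"
proof -
  let ?x = "r *\<^sub>R x + s *\<^sub>R oct_J x" and ?a = "x \<bullet> oct_e 0" and ?b = "x \<bullet> oct_im"
  have ab: "?x \<bullet> oct_e 0 = r * ?a - s * ?b" "?x \<bullet> oct_im = r * ?b + s * ?a"
    by (simp_all add: inner_add_left oct_J_inner_e)
  show q: "(?x \<bullet> oct_e 0)\<^sup>2 + (?x \<bullet> oct_im)\<^sup>2 = (r\<^sup>2 + s\<^sup>2) * (?a\<^sup>2 + ?b\<^sup>2)"
    unfolding ab by (simp add: power2_eq_square algebra_simps)
  have "(?x \<bullet> oct_e 0) *\<^sub>R ?x - (?x \<bullet> oct_im) *\<^sub>R oct_J ?x = (r\<^sup>2 + s\<^sup>2) *\<^sub>R (?a *\<^sub>R x - ?b *\<^sub>R oct_J x)"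
    unfolding ab by (simp add: oct.J_lin power2_eq_square algebra_simps)
  then show "ochart ?x = ochart x"
    unfolding ochart_def q using assms by (simp add: linear_scale[OF linear_oct_co])
qed

lemma cp_chart_hopf: "cp_chart (hopf x) = ochart x"
proof -
  define x' where "x' = (SOME x'. x' \<in> hopf x)"
  have "\<exists>x'. x' \<in> hopf x" unfolding hopf_eq by blast
  then have "x' \<in> hopf x" unfolding x'_def by (rule someI_ex)
  then obtain \<theta> where x': "x' = cos \<theta> *\<^sub>R x + sin \<theta> *\<^sub>R oct_J x" unfolding hopf_eq by blast
  let ?a = "x' \<bullet> oct_e 0" and ?b = "x' \<bullet> oct_im"
  let ?y = "((?a *\<^sub>R oct_e 0 - ?b *\<^sub>R oct_im) /\<^sub>R (?a\<^sup>2 + ?b\<^sup>2)) \<odot> (x' - ?a *\<^sub>R oct_e 0 - ?b *\<^sub>R oct_im)"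
  have y: "(?a *\<^sub>R oct_e 0 - ?b *\<^sub>R oct_im) /\<^sub>R (?a\<^sup>2 + ?b\<^sup>2)
      = (inverse (?a\<^sup>2 + ?b\<^sup>2) * ?a) *\<^sub>R oct_e 0 + (- (inverse (?a\<^sup>2 + ?b\<^sup>2) * ?b)) *\<^sub>R oct_im"
    by (simp add: scaleR_diff_right)
  have "cp_chart (hopf x) = oct_co ?y"
    unfolding cp_chart_def Let_def x'_def[symmetric] oct_e_1 oct_co_def ..
  also have "\<dots> = ochart x'"
    unfolding y oct_mult_complex ochart_def
    by (simp add: linear_add[OF linear_oct_co] linear_diff[OF linear_oct_co] linear_scale[OF linear_oct_co]
        linear_neg[OF linear_oct_co] oct.J_lin oct_J_e0 scaleR_diff_right)
  also have "\<dots> = ochart x" unfolding x' by (rule ochart_rotate) simp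
  finally show ?thesis .
qed

lemma ochart_osec [simp]: "ochart (osec y) = y"
proof -
  let ?r = "inverse (sqrt (1 + y \<bullet> y))"
  have r: "?r \<noteq> 0" using one_plus_inner_pos[of y] by simp
  have "osec y \<bullet> oct_e 0 = ?r" "osec y \<bullet> oct_im = 0" by (simp_all add: osec_def inner_add_left)
  then have "ochart (osec y) = inverse (?r\<^sup>2) *\<^sub>R (?r *\<^sub>R oct_co (osec y))"
    by (simp only: ochart_def linear_scale[OF linear_oct_co]) (simp add: linear_scale[OF linear_oct_co])
  also have "oct_co (osec y) = ?r *\<^sub>R y"
    by (simp add: osec_def linear_scale[OF linear_oct_co] linear_add[OF linear_oct_co])
  also have "inverse (?r\<^sup>2) *\<^sub>R (?r *\<^sub>R (?r *\<^sub>R y)) = (inverse (?r\<^sup>2) * ?r\<^sup>2) *\<^sub>R y"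
    by (simp only: power2_eq_square scaleR_scaleR mult.assoc)
  also have "\<dots> = y" using r by simp
  finally show ?thesis .
qed

lemma osec_rep:
  assumes q: "(x \<bullet> oct_e 0)\<^sup>2 + (x \<bullet> oct_im)\<^sup>2 \<noteq> 0" and x: "x \<bullet> x = 1"
  shows "\<exists>r s. r\<^sup>2 + s\<^sup>2 = 1 \<and> x = r *\<^sub>R osec (ochart x) + s *\<^sub>R oct_J (osec (ochart x))"
proof -
  let ?a = "x \<bullet> oct_e 0" and ?b = "x \<bullet> oct_im" and ?y = "ochart x"
  define q where "q = ?a\<^sup>2 + ?b\<^sup>2"
  let ?v = "oct_e 0 + oct_emb ?y" let ?w = "?a *\<^sub>R x - ?b *\<^sub>R oct_J x"
  have q: "q \<noteq> 0" using q q_def by simp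
  have w: "?w \<bullet> oct_e 0 = q" "?w \<bullet> oct_im = 0"
    by (simp_all add: inner_diff_left oct_J_inner_e power2_eq_square q_def)
  have "oct_emb ?y = inverse q *\<^sub>R oct_emb (oct_co ?w)"
    by (simp only: ochart_def q_def linear_scale[OF linear_oct_emb])
  also have "oct_emb (oct_co ?w) = ?w - q *\<^sub>R oct_e 0"
  proof -
    have "?w = q *\<^sub>R oct_e 0 + oct_emb (oct_co ?w)"
      using oct_decomp[of ?w] unfolding w by (simp only: scaleR_zero_left add_0_right)
    then show ?thesis by (metis add_diff_cancel_left')
  qed
  finally have e: "oct_emb ?y = inverse q *\<^sub>R (?w - q *\<^sub>R oct_e 0)" .
  \<comment> \<open>\<open>?w\<close> is the conjugate of the complex number with parts
    \<open>?a\<close> and \<open>?b\<close>, applied to x. Multiplying by the number itself gives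
    back q x.\<close>
  have v: "q *\<^sub>R ?v = ?w"
  proof -
    have "q *\<^sub>R (e + inverse q *\<^sub>R (w - q *\<^sub>R e)) = w" for e w :: octonion
      using q by (simp add: scaleR_add_right)
    then show ?thesis unfolding e .
  qed
  have "q *\<^sub>R (?a *\<^sub>R ?v + ?b *\<^sub>R oct_J ?v) = ?a *\<^sub>R (q *\<^sub>R ?v) + ?b *\<^sub>R oct_J (q *\<^sub>R ?v)"
    unfolding oct.J_lin(4) scaleR_add_right[of q "?a *\<^sub>R _"] by (simp only: scaleR_left_commute)
  also have "\<dots> = q *\<^sub>R x"
    unfolding v by (simp add: oct.J_lin power2_eq_square algebra_simps q_def)
  finally have "?a *\<^sub>R ?v + ?b *\<^sub>R oct_J ?v = x" by (rule scaleR_left_imp_eq[OF q])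
  then have xv: "x = ?a *\<^sub>R ?v + ?b *\<^sub>R oct_J ?v" by simp
  let ?s = "sqrt (1 + ?y \<bullet> ?y)"
  have s: "?s > 0" "?s\<^sup>2 = 1 + ?y \<bullet> ?y" using one_plus_inner_pos[of ?y] by auto
  have vs: "?v = ?s *\<^sub>R osec ?y" using s by (simp add: osec_def)
  have xs: "x = (?a * ?s) *\<^sub>R osec ?y + (?b * ?s) *\<^sub>R oct_J (osec ?y)"
    using xv unfolding vs by (simp add: oct.J_lin)
  have "x \<bullet> x = (?a * ?s)\<^sup>2 + (?b * ?s)\<^sup>2"
    using arg_cong2[OF xs xs, of "(\<bullet>)"]
    by (simp only: inner_add_left inner_add_right inner_scaleR_left inner_scaleR_right osec_inner
      oct.J_inner_J oct.inner_J_self power2_eq_square) simp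
  then have "(?a * ?s)\<^sup>2 + (?b * ?s)\<^sup>2 = 1" using x by simp
  then show ?thesis using xs by metis
qed

text \<open>Through this fact every chosen representative of an orbit is handled: it differs from
  the section by a complex number of modulus one.\<close>

lemma CP3_minus_CP2_rep:
  assumes "z \<in> CP3 - CP2"
  shows "\<exists>r s. r\<^sup>2 + s\<^sup>2 = 1 \<and> (SOME x. x \<in> z) = r *\<^sub>R osec (cp_chart z) + s *\<^sub>R oct_J (osec (cp_chart z))"
proof -
  obtain x0 where x0: "z = hopf x0" "x0 \<bullet> x0 = 1"
    using assms by (auto simp: CP3_def power2_norm_eq_inner[symmetric])
  have q0: "(x0 \<bullet> oct_e 0)\<^sup>2 + (x0 \<bullet> oct_im)\<^sup>2 \<noteq> 0"
  proof
    assume "(x0 \<bullet> oct_e 0)\<^sup>2 + (x0 \<bullet> oct_im)\<^sup>2 = 0"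
    then have "x0 \<bullet> oct_e 0 = 0 \<and> x0 \<bullet> oct_e 1 = 0" by (simp add: oct_e_1 sum_power2_eq_zero_iff)
    then have "z \<in> CP2" using x0 by (auto simp: CP2_def norm_eq_sqrt_inner)
    then show False using assms by simp
  qed
  define x where "x = (SOME x. x \<in> z)"
  have "\<exists>x. x \<in> z" unfolding x0 hopf_eq by blast
  then have "x \<in> z" unfolding x_def by (rule someI_ex)
  then obtain \<theta> where x: "x = cos \<theta> *\<^sub>R x0 + sin \<theta> *\<^sub>R oct_J x0" unfolding x0 hopf_eq by blast
  have "(x \<bullet> oct_e 0)\<^sup>2 + (x \<bullet> oct_im)\<^sup>2 \<noteq> 0"
    unfolding x using ochart_rotate(2)[of "cos \<theta>" "sin \<theta>" x0] q0 by simp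
  moreover have "x \<bullet> x = 1"
    unfolding x using sin_cos_squared_add[of \<theta>]
    by (simp add: inner_add_left inner_add_right x0 power2_eq_square)
  moreover have "ochart x = cp_chart z" unfolding x x0 cp_chart_hopf by (rule ochart_rotate) simp
  ultimately show ?thesis using osec_rep[of x] unfolding x_def by simp
qed

lemma hopf_osec: "hopf (osec y) \<in> CP3 - CP2"
proof -
  have "hopf (osec y) \<in> CP3"
    by (auto simp: CP3_def norm_eq_sqrt_inner osec_inner)
  moreover have "hopf (osec y) \<notin> CP2"
  proof
    assume "hopf (osec y) \<in> CP2"
    then obtain x where x: "hopf (osec y) = hopf x" "x \<bullet> oct_e 0 = 0" "x \<bullet> oct_im = 0"
      by (auto simp: CP2_def oct_e_1)
    have "x \<in> hopf x" unfolding hopf_eq by (rule CollectI, rule exI[of _ 0]) simp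
    then have "x \<in> hopf (osec y)" using x(1) by simp
    then obtain \<theta> where "x = cos \<theta> *\<^sub>R osec y + sin \<theta> *\<^sub>R oct_J (osec y)"
      unfolding hopf_eq by blast
    then have "(osec y \<bullet> oct_e 0)\<^sup>2 + (osec y \<bullet> oct_im)\<^sup>2 = 0"
      using ochart_rotate(2)[of "cos \<theta>" "sin \<theta>" "osec y"] x by simp
    then have "osec y \<bullet> oct_e 0 = 0" by (simp add: sum_power2_eq_zero_iff)
    then show False using one_plus_inner_pos[of y] by (simp add: osec_def inner_add_left)
  qed
  ultimately show ?thesis by simp
qed

lemma smooth_on_osec:
  assumes "open U" "smooth_on U F"
  shows "smooth_on U (\<lambda>u. osec (F u))"
  unfolding osec_def
  using assms one_plus_inner_pos
  by (intro smooth_on_scaleR smooth_on_inverse_sqrt smooth_on_add smooth_on_inner smooth_on_const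
      smooth_on_bounded_linear[of U oct_emb] linear_conv_bounded_linear[THEN iffD1, OF linear_oct_emb]) auto

interpretation sec: sphere_map oct_J UNIV osec
  using smooth_on_osec[OF open_UNIV smooth_on_ident[OF open_UNIV]] by unfold_locales (auto simp: osec_inner)

lemma sphere_map_osec:
  assumes "open U" "smooth_on U F"
  shows "sphere_map oct_J U (\<lambda>u. osec (F u))"
  using assms by unfold_locales (auto intro: smooth_on_osec simp: osec_inner)

text \<open>The derivative of the normalizing factor points along \<open>osec y\<close>, which the
  horizontal projection annihilates.\<close>

lemma sec_X_eq: "sec.X w y = inverse (sqrt (1 + y \<bullet> y)) *\<^sub>R sec.hproj y (oct_emb w)"
proof -
  let ?r = "\<lambda>y::real^6. inverse (sqrt (1 + y \<bullet> y))"
  have "smooth_on UNIV ?r"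
    using one_plus_inner_pos by (intro smooth_on_inverse_sqrt smooth_on_add smooth_on_inner smooth_on_const smooth_on_ident) auto
  then have d: "?r differentiable (at y)" by (rule smooth_on_imp_differentiable) simp
  have bl: "bounded_linear oct_emb" using linear_oct_emb by (simp add: linear_conv_bounded_linear)
  have de: "((\<lambda>y. oct_e 0 + oct_emb y) has_derivative oct_emb) (at y)"
    using bounded_linear.has_derivative[OF bl has_derivative_ident] by (auto intro!: derivative_eq_intros)
  have "dirder w osec y = ?r y *\<^sub>R oct_emb w + dirder w ?r y *\<^sub>R (oct_e 0 + oct_emb y)"
    unfolding osec_def[abs_def]
    using dirder_scaleR[OF d, of "\<lambda>y. oct_e 0 + oct_emb y" w] dirder_eq[OF de, of w] de
    by (auto simp: differentiable_def)
  also have "oct_e 0 + oct_emb y = sqrt (1 + y \<bullet> y) *\<^sub>R osec y"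
    using one_plus_inner_pos[of y] by (simp add: osec_def)
  finally have "dirder w osec y = ?r y *\<^sub>R oct_emb w + (dirder w ?r y * sqrt (1 + y \<bullet> y)) *\<^sub>R osec y"
    by simp
  moreover have "sec.hproj y (osec y) = 0"
    by (simp add: sec.hproj_def osec_inner)
  ultimately show ?thesis
    by (simp add: sec.X_def linear_add[OF sec.linear_hproj] linear_scale[OF sec.linear_hproj])
qed

text \<open>Modulo the image of \<open>oct_emb\<close>, the vectors 1 and i are multiples of
  \<open>osec y\<close> and \<open>oct_J (osec y)\<close>. Projecting the coordinate expansion of V
  therefore leaves only an embedded vector.\<close>

lemma sec_horizontal:
  assumes "V \<bullet> osec y = 0" "V \<bullet> oct_J (osec y) = 0"
  shows "\<exists>w. V = sec.X w y"
proof -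
  let ?s = "sqrt (1 + y \<bullet> y)"
  have s: "?s > 0" using one_plus_inner_pos[of y] by simp
  let ?a = "V \<bullet> oct_e 0" and ?b = "V \<bullet> oct_im"
  have e: "oct_e 0 = ?s *\<^sub>R osec y - oct_emb y" using s by (simp add: osec_def)
  have Jy: "oct_J (oct_emb y) = oct_emb (oct_co (oct_J (oct_emb y)))"
    using oct_decomp[of "oct_J (oct_emb y)"] by (simp add: oct_J_inner_e)
  have im: "oct_im = ?s *\<^sub>R oct_J (osec y) - oct_emb (oct_co (oct_J (oct_emb y)))"
    using arg_cong[OF e, of oct_J] unfolding Jy[symmetric] by (simp add: oct.J_lin oct_J_e0)
  define w where "w = oct_co V - ?a *\<^sub>R y - ?b *\<^sub>R oct_co (oct_J (oct_emb y))"
  have "V = ?a *\<^sub>R oct_e 0 + ?b *\<^sub>R oct_im + oct_emb (oct_co V)" by (rule oct_decomp)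
  also have "\<dots> = (?a * ?s) *\<^sub>R osec y + (?b * ?s) *\<^sub>R oct_J (osec y) + oct_emb w"
    unfolding w_def by (subst e, subst im)
      (simp add: linear_diff[OF linear_oct_emb] linear_scale[OF linear_oct_emb] scaleR_diff_right)
  finally have V: "V = (?a * ?s) *\<^sub>R osec y + (?b * ?s) *\<^sub>R oct_J (osec y) + oct_emb w" .
  have "V = sec.hproj y V" using assms by (simp add: sec.hproj_def)
  also have "\<dots> = sec.hproj y (oct_emb w)"
  proof -
    have "sec.hproj y (osec y) = 0" "sec.hproj y (oct_J (osec y)) = 0"
      by (simp_all add: sec.hproj_def osec_inner)
    then show ?thesis
      using arg_cong[OF V, of "sec.hproj y"]
      by (simp only: linear_add[OF sec.linear_hproj] linear_scale[OF sec.linear_hproj]) simp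
  qed
  also have "\<dots> = sec.X (?s *\<^sub>R w) y"
    using s by (simp add: sec_X_eq linear_scale[OF linear_oct_emb] linear_scale[OF sec.linear_hproj])
  finally show ?thesis by blast
qed

lemma smooth_on_ochart: "smooth_on {x. (x \<bullet> oct_e 0)\<^sup>2 + (x \<bullet> oct_im)\<^sup>2 \<noteq> 0} ochart"
proof -
  let ?S = "{x. (x \<bullet> oct_e 0)\<^sup>2 + (x \<bullet> oct_im)\<^sup>2 \<noteq> 0}"
  have o: "open ?S"
    by (intro open_Collect_neq continuous_intros)
  have id: "smooth_on ?S (\<lambda>x. x)" by (rule smooth_on_ident[OF o])
  have i: "smooth_on ?S (\<lambda>x. x \<bullet> e)" for e by (intro smooth_on_inner o id smooth_on_const)
  have J: "smooth_on ?S oct_J" using smooth_on_bounded_linear[OF o oct.bounded_linear_J id] .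
  have "smooth_on ?S (\<lambda>x. (x \<bullet> oct_e 0) * (x \<bullet> oct_e 0) + (x \<bullet> oct_im) * (x \<bullet> oct_im))"
    by (intro smooth_on_add smooth_on_mult o i)
  then have "smooth_on ?S (\<lambda>x. inverse ((x \<bullet> oct_e 0)\<^sup>2 + (x \<bullet> oct_im)\<^sup>2))"
    by (intro smooth_on_inverse o) (simp_all add: power2_eq_square)
  moreover have "smooth_on ?S (\<lambda>x. oct_co ((x \<bullet> oct_e 0) *\<^sub>R x - (x \<bullet> oct_im) *\<^sub>R oct_J x))"
    by (intro smooth_on_bounded_linear[OF o linear_conv_bounded_linear[THEN iffD1, OF linear_oct_co]]
        smooth_on_diff smooth_on_scaleR o i id J)
  ultimately show "smooth_on ?S ochart"
    unfolding ochart_def[abs_def] by (rule smooth_on_scaleR[OF o])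
qed

section \<open>Horizontal lifts and the Fubini-Study matrix\<close>

lemma dhopf_eq: "dhopf x X = dirder X ochart x"
proof -
  have "cp_chart (hopf (sgn y)) = ochart y" for y
    using ochart_rotate(1)[of "inverse (norm y)" 0 y]
    by (cases "y = 0") (simp_all add: cp_chart_hopf sgn_div_norm)
  then show ?thesis by (simp add: dhopf_def dirder_def)
qed

text \<open>The chart is constant along the curves x + t x, for small t, and x + t J x, whose
  velocities are the radial and the fibre direction.\<close>

lemma ochart_kernel:
  assumes "ochart differentiable (at x)"
  shows "dirder x ochart x = 0" "dirder (oct_J x) ochart x = 0"
proof -
  have c: "dirder 1 (\<lambda>t::real. ochart (x + t *\<^sub>R v)) 0 = dirder v ochart x" for v
  proof -
    have g: "((\<lambda>t::real. x + t *\<^sub>R v) has_derivative (\<lambda>t. t *\<^sub>R v)) (at 0)"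
      by (auto intro!: derivative_eq_intros)
    then have d: "(\<lambda>t::real. x + t *\<^sub>R v) differentiable (at 0)" by (auto simp: differentiable_def)
    show ?thesis
      using dirder_chain[OF d, of ochart 1] assms dirder_eq[OF g, of 1] by simp
  qed
  have "ochart (x + t *\<^sub>R x) = ochart x" if "t \<in> {-1<..<1}" for t
    using ochart_rotate(1)[of "1 + t" 0 x] that by (simp add: scaleR_add_left)
  then have "dirder 1 (\<lambda>t::real. ochart (x + t *\<^sub>R x)) 0 = dirder 1 (\<lambda>t::real. ochart x) 0"
    by (intro dirder_cong[of "{-1<..<1::real}"]) auto
  then show "dirder x ochart x = 0" by (simp add: c)
  have "1\<^sup>2 + t\<^sup>2 \<noteq> (0::real)" for t by (metis one_power2 sum_power2_eq_zero_iff zero_neq_one)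
  then have "ochart (x + t *\<^sub>R oct_J x) = ochart x" for t
    using ochart_rotate(1)[of 1 t x] by simp
  then show "dirder (oct_J x) ochart x = 0" using c[of "oct_J x"] by simp
qed

text \<open>The first claim is the derivative of \<open>ochart (M (osec u)) = u\<close>. The
  derivative of the section may be replaced by its horizontal part because \<open>dhopf\<close>
  kills the fibre direction.\<close>

lemma dhopf_lift:
  assumes rs: "r\<^sup>2 + s\<^sup>2 = 1" and x: "x = r *\<^sub>R osec y + s *\<^sub>R oct_J (osec y)"
  shows "dhopf x (r *\<^sub>R sec.X w y + s *\<^sub>R oct_J (sec.X w y)) = w"
    and "linear (dhopf x)" and "dhopf x x = 0" and "dhopf x (oct_J x) = 0"
proof -
  define M where "M = (\<lambda>v. r *\<^sub>R v + s *\<^sub>R oct_J v)"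
  have blM: "bounded_linear M"
    unfolding M_def by (intro bounded_linear_add bounded_linear_scaleR_right
        bounded_linear_compose[OF bounded_linear_scaleR_right oct.bounded_linear_J])
  have xM: "x = M (osec y)" by (simp add: x M_def)
  have "ochart (M v) = ochart v" for v unfolding M_def by (rule ochart_rotate(1)) (simp add: rs)
  then have id: "ochart (M (osec u)) = u" for u by simp
  have "osec y \<bullet> oct_e 0 \<noteq> 0" using one_plus_inner_pos[of y] by (simp add: osec_def inner_add_left)
  then have "(x \<bullet> oct_e 0)\<^sup>2 + (x \<bullet> oct_im)\<^sup>2 \<noteq> 0"
    unfolding x using ochart_rotate(2)[of r s "osec y"] rs by (simp add: sum_power2_eq_zero_iff)
  then have dx: "ochart differentiable (at x)"
    using smooth_on_imp_differentiable[OF smooth_on_ochart] by blast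
  show lin: "linear (dhopf x)"
    using linear_dirder[OF dx] by (simp add: dhopf_eq[abs_def])
  show k: "dhopf x x = 0" "dhopf x (oct_J x) = 0"
    using ochart_kernel[OF dx] by (simp_all add: dhopf_eq)
  have ds: "osec differentiable (at y)" by (rule sec.x_differentiable) simp
  have dM: "(\<lambda>u. M (osec u)) differentiable (at y)"
    using bounded_linear.has_derivative[OF blM has_derivative_dirder[OF ds]] by (auto simp: differentiable_def)
  have "w = dirder w (\<lambda>u. ochart (M (osec u))) y" by (simp add: id dirder_def)
  also have "\<dots> = dirder (M (dirder w osec y)) ochart x"
    using dirder_chain[OF dM, of ochart w] dx by (simp add: xM dirder_bounded_linear[OF blM ds])
  also have "\<dots> = dhopf x (M (sec.X w y) + sec.phase w y *\<^sub>R oct_J x)"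
    by (simp add: sec.dirder_x dhopf_eq xM linear_add[OF bounded_linear.linear[OF blM]]
        linear_scale[OF bounded_linear.linear[OF blM]]) (simp add: M_def oct.J_lin)
  also have "\<dots> = dhopf x (M (sec.X w y))"
    by (simp add: linear_add[OF lin] linear_scale[OF lin] k)
  finally show "dhopf x (r *\<^sub>R sec.X w y + s *\<^sub>R oct_J (sec.X w y)) = w" by (simp add: M_def)
qed

lemma rotate_inner:
  assumes "r\<^sup>2 + s\<^sup>2 = 1"
  shows "(r *\<^sub>R v + s *\<^sub>R oct_J v) \<bullet> (r *\<^sub>R w + s *\<^sub>R oct_J w) = v \<bullet> w"
proof -
  have "(r *\<^sub>R v + s *\<^sub>R oct_J v) \<bullet> (r *\<^sub>R w + s *\<^sub>R oct_J w) = (r\<^sup>2 + s\<^sup>2) * (v \<bullet> w)"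
    by (simp add: inner_add_left inner_add_right oct.J_skew power2_eq_square algebra_simps)
  then show ?thesis using assms by simp
qed

lemma sec_X_horizontal: "sec.X w y \<bullet> osec y = 0" "sec.X w y \<bullet> oct_J (osec y) = 0"
  by (rule sec.hfieldD[OF sec.hfield_X UNIV_I])+

text \<open>For uniqueness a competitor is rotated back to the section, where it is a lift of some
  w' by \<open>sec_horizontal\<close>; applying \<open>dhopf\<close> gives w' = w.\<close>

lemma hlift_eq:
  assumes rs: "r\<^sup>2 + s\<^sup>2 = 1" and x: "x = r *\<^sub>R osec y + s *\<^sub>R oct_J (osec y)"
  shows "hlift x w = r *\<^sub>R sec.X w y + s *\<^sub>R oct_J (sec.X w y)"
  unfolding hlift_def oct_e_1 oct_J_def[symmetric]
proof (rule the_equality, intro conjI)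
  have Jx: "oct_J x = r *\<^sub>R oct_J (osec y) + s *\<^sub>R oct_J (oct_J (osec y))"
    by (simp add: x oct.J_lin)
  show "(r *\<^sub>R sec.X w y + s *\<^sub>R oct_J (sec.X w y)) \<bullet> x = 0"
    unfolding x rotate_inner[OF rs] by (rule sec_X_horizontal)
  show "(r *\<^sub>R sec.X w y + s *\<^sub>R oct_J (sec.X w y)) \<bullet> oct_J x = 0"
    unfolding Jx rotate_inner[OF rs] by (rule sec_X_horizontal)
  show "dhopf x (r *\<^sub>R sec.X w y + s *\<^sub>R oct_J (sec.X w y)) = w"
    by (rule dhopf_lift(1)[OF assms])
  fix V assume V: "V \<bullet> x = 0 \<and> V \<bullet> oct_J x = 0 \<and> dhopf x V = w"
  define V' where "V' = r *\<^sub>R V - s *\<^sub>R oct_J V"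
  have V'V: "V = r *\<^sub>R V' + s *\<^sub>R oct_J V'"
  proof -
    have "r *\<^sub>R V' + s *\<^sub>R oct_J V' = (r\<^sup>2 + s\<^sup>2) *\<^sub>R V"
      by (simp add: V'_def oct.J_lin power2_eq_square algebra_simps)
    then show ?thesis using rs by simp
  qed
  have "V' \<bullet> osec y = 0" "V' \<bullet> oct_J (osec y) = 0"
    using V unfolding Jx unfolding x V'V rotate_inner[OF rs] by auto
  then obtain w' where "V' = sec.X w' y" using sec_horizontal by blast
  then have "V = r *\<^sub>R sec.X w' y + s *\<^sub>R oct_J (sec.X w' y)" using V'V by simp
  moreover from this have "w' = w" using V dhopf_lift(1)[OF assms, of w'] by simp
  ultimately show "V = r *\<^sub>R sec.X w y + s *\<^sub>R oct_J (sec.X w y)" by simp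
qed

lemma fubini_study_eq:
  assumes "z \<in> CP3 - CP2"
  shows "fubini_study z w w' = sec.X w (cp_chart z) \<bullet> sec.X w' (cp_chart z)"
proof -
  obtain r s where "r\<^sup>2 + s\<^sup>2 = 1"
      "(SOME x. x \<in> z) = r *\<^sub>R osec (cp_chart z) + s *\<^sub>R oct_J (osec (cp_chart z))"
    using CP3_minus_CP2_rep[OF assms] by blast
  then show ?thesis by (simp only: fubini_study_def Let_def hlift_eq rotate_inner)
qed

lemma cp_chart_inv: "inv_into (CP3 - CP2) cp_chart y \<in> CP3 - CP2" "cp_chart (inv_into (CP3 - CP2) cp_chart y) = y"
proof -
  have "cp_chart (hopf (osec y)) = y" by (simp add: cp_chart_hopf)
  then have "y \<in> cp_chart ` (CP3 - CP2)" using hopf_osec by (metis imageI)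
  then show "inv_into (CP3 - CP2) cp_chart y \<in> CP3 - CP2" "cp_chart (inv_into (CP3 - CP2) cp_chart y) = y"
    by (rule inv_into_into, rule f_inv_into_f)
qed

text \<open>This makes the Christoffel symbols of the chart accessible to the Koszul formula for
  \<open>sec\<close>.\<close>

lemma fs_matrix_eq: "fs_matrix = sec.gram"
proof
  show "fs_matrix y = sec.gram y" for y
    by (simp only: fs_matrix_def Let_def sec.gram_def fubini_study_eq[OF cp_chart_inv(1)] cp_chart_inv(2))
qed

section \<open>The fields W and the Gauss translation\<close>

definition oct_W :: "octonion \<Rightarrow> octonion \<Rightarrow> octonion" where
  "oct_W v x = (x \<bullet> oct_e 0) *\<^sub>R v + (x \<bullet> oct_im) *\<^sub>R oct_J v - (x \<bullet> v) *\<^sub>R oct_e 0 - (x \<bullet> oct_J v) *\<^sub>R oct_im"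

lemma linear_oct_W: "linear (oct_W v)"
  by (rule linearI) (simp_all add: oct_W_def inner_add_left algebra_simps)

lemma oct_W_skew: "oct_W v x \<bullet> y = - (x \<bullet> oct_W v y)"
  by (simp add: oct_W_def inner_add_left inner_diff_left inner_add_right inner_diff_right inner_commute)

lemma oct_W_J: "oct_W v (oct_J x) = oct_J (oct_W v x)"
  by (simp add: oct_W_def oct_J_inner_e oct.J_lin oct_J_e0 oct.J_skew[of x v])

lemma vector_map_index:
  obtains n where "n \<in> {1..<7}" "\<And>f. (vector (map f [1..<7]) :: 'a::zero^6) $ i = f n"
    "oct_e (n + 1) = oct_emb (axis i 1)"
proof -
  have "i \<in> {1, 2, 3, 4, 5, 0}" using UNIV_6 by blast
  then have "\<exists>n\<in>{1..<7}. (\<forall>f. (vector (map f [1..<7]) :: 'a::zero^6) $ i = f n) \<and> of_nat n = i"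
    using vector_map_nth[where 'a = 'a]
    by (auto intro: bexI[of _ 1] bexI[of _ 2] bexI[of _ 3] bexI[of _ 4] bexI[of _ 5] bexI[of _ 6])
  then show ?thesis using that oct_e_emb by metis
qed

text \<open>The lift of the induced field is the horizontal part of W x. The vertical part may be
  kept in the formula since it is orthogonal to the lift of w, and commutation of W with J removes
  the phase of the representative.\<close>

lemma Gauss_transl_nth:
  assumes z: "z \<in> CP3 - CP2"
  shows "Gauss_transl z w $ i = sec.X w (cp_chart z) \<bullet> oct_W (oct_emb (axis i 1)) (osec (cp_chart z))"
proof -
  let ?y = "cp_chart z"
  obtain n where n: "n \<in> {1..<7}" "\<And>f. (vector (map f [1..<7]) :: real^6) $ i = f n"
    "oct_e (n + 1) = oct_emb (axis i 1)" using vector_map_index[where i = i and 'a = real] by metis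
  obtain r s where rs: "r\<^sup>2 + s\<^sup>2 = 1" and x: "(SOME x. x \<in> z) = r *\<^sub>R osec ?y + s *\<^sub>R oct_J (osec ?y)"
    using CP3_minus_CP2_rep[OF z] by blast
  define x where "x = r *\<^sub>R osec ?y + s *\<^sub>R oct_J (osec ?y)"
  let ?W = "oct_W (oct_emb (axis i 1))"
  obtain w' where w': "sec.hproj ?y (?W (osec ?y)) = sec.X w' ?y"
    using sec_horizontal[of "sec.hproj ?y (?W (osec ?y))" ?y] sec.hproj_inner[of ?y] by auto
  define a b where "a = ?W (osec ?y) \<bullet> osec ?y" and "b = ?W (osec ?y) \<bullet> oct_J (osec ?y)"
  have ab: "?W (osec ?y) = sec.X w' ?y + a *\<^sub>R osec ?y + b *\<^sub>R oct_J (osec ?y)"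
    unfolding w'[symmetric] sec.hproj_def a_def b_def by simp
  have "?W x = r *\<^sub>R ?W (osec ?y) + s *\<^sub>R oct_J (?W (osec ?y))"
    by (simp add: x_def linear_add[OF linear_oct_W] linear_scale[OF linear_oct_W] oct_W_J)
  also have "\<dots> = (r *\<^sub>R sec.X w' ?y + s *\<^sub>R oct_J (sec.X w' ?y)) + (a *\<^sub>R x + b *\<^sub>R oct_J x)"
    by (simp add: ab x_def oct.J_lin algebra_simps)
  finally have "dhopf x (?W x) = w'"
    using dhopf_lift[OF rs x_def] by (simp add: linear_add linear_scale)
  moreover have "Z_field n z = dhopf x (?W x)"
    unfolding Z_field_def Let_def x x_def[symmetric] W_field_eq[OF n(1)] unfolding n(3) oct_W_def ..
  ultimately have "fubini_study z w (Z_field n z) = sec.X w ?y \<bullet> sec.X w' ?y"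
    by (simp add: fubini_study_eq[OF z])
  also have "\<dots> = sec.X w ?y \<bullet> ?W (osec ?y)"
    unfolding ab by (simp add: inner_add_right sec_X_horizontal)
  finally show ?thesis unfolding Gauss_transl_def n(2) .
qed

lemma sec_X_inj: "sec.X w y = 0 \<Longrightarrow> w = 0"
  using dhopf_lift(1)[of 1 0 "osec y" y w] dhopf_lift(2)[of 1 0 "osec y" y] linear_0[of "dhopf (osec y)"]
  by simp

interpretation sec: sphere_immersion oct_J UNIV osec
  by unfold_locales (rule sec.gram_invertibleI[OF _ sec_X_inj], simp_all)

lemma linear_sec_X: "linear (\<lambda>w. sec.X w y)"
  by (rule sec.linear_X) simp

text \<open>Along the section the coordinate frame spans the whole horizontal space, so the
  Christoffel symbols give D X itself and not merely a tangential part.\<close>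

lemma sec_D_X:
  "sec.D b (sec.X (axis j 1)) y
    = (\<Sum>k\<in>UNIV. (\<Sum>i\<in>UNIV. b $ i * christoffel fs_matrix y k i j) *\<^sub>R sec.X (axis k 1) y)"
proof -
  have h: "sec.D (axis i 1) (sec.X (axis j 1)) y
      = (\<Sum>k\<in>UNIV. christoffel fs_matrix y k i j *\<^sub>R sec.X (axis k 1) y)" for i
  proof -
    obtain w where w: "sec.D (axis i 1) (sec.X (axis j 1)) y = sec.X w y"
      using sec_horizontal sec.hfieldD(1,2)[OF sec.hfield_D[OF sec.hfield_X] UNIV_I] by blast
    have e: "sec.X w y = (\<Sum>k\<in>UNIV. w $ k *\<^sub>R sec.X (axis k 1) y)"
      by (rule sec.linear_expand[OF linear_sec_X])
    have "w $ k = christoffel fs_matrix y k i j" for k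
      unfolding fs_matrix_eq sec.christoffel_dual[OF UNIV_I] w e
      by (simp add: inner_sum_right sec.dual_X sum_mult_delta)
    then show ?thesis unfolding w e by simp
  qed
  have l: "linear (\<lambda>b. sec.D b (sec.X (axis j 1)) y)"
    by (rule sec.linear_D) (simp_all add: sec.hfieldD(9)[OF sec.hfield_X])
  show ?thesis
    unfolding sec.linear_expand[OF l, of b] h scaleR_sum_right
    by (subst sum.swap) (simp add: scaleR_sum_left)
qed

section \<open>Hypersurfaces in the affine chart\<close>

locale chart_map =
  fixes U :: "(real^'m) set" and F :: "real^'m \<Rightarrow> real^6"
  assumes open_U: "open U" and smooth_F: "smooth_on U F"

sublocale chart_map \<subseteq> sphere_map oct_J U "\<lambda>u. osec (F u)"
  by (rule sphere_map_osec[OF open_U smooth_F])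

context chart_map
begin

lemma F_differentiable: "u \<in> U \<Longrightarrow> F differentiable (at u)"
  by (rule smooth_on_imp_differentiable[OF smooth_F])

lemma dirder_osec: "u \<in> U \<Longrightarrow> dirder a (\<lambda>u. osec (F u)) u = dirder (dirder a F u) osec (F u)"
  by (rule dirder_chain[OF F_differentiable sec.x_differentiable]) simp_all

lemma hproj_eq: "hproj u = sec.hproj (F u)"
  by (simp add: hproj_def sec.hproj_def fun_eq_iff)

lemma X_eq: "u \<in> U \<Longrightarrow> X a u = sec.X (dirder a F u) (F u)"
  by (simp add: X_def sec.X_def hproj_eq dirder_osec)

lemma phase_eq: "u \<in> U \<Longrightarrow> phase a u = sec.phase (dirder a F u) (F u)"
  by (simp add: phase_def sec.phase_def dirder_osec)

lemma D_comp:
  assumes "u \<in> U" "Y differentiable (at (F u))"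
  shows "D a (\<lambda>u. Y (F u)) u = sec.D (dirder a F u) Y (F u)"
  using assms by (simp add: D_def sec.D_def hproj_eq phase_eq dirder_chain F_differentiable)

lemma hfield_lift:
  assumes V: "smooth_on U V"
  shows "hfield (\<lambda>u. sec.X (V u) (F u))"
proof -
  have "smooth_on U (\<lambda>u. inverse (sqrt (1 + F u \<bullet> F u)))"
    by (intro smooth_on_inverse_sqrt smooth_intros smooth_F) (simp add: one_plus_inner_pos)
  moreover have "smooth_on U (\<lambda>u. oct_emb (V u))"
    by (rule smooth_on_bounded_linear[OF open_U linear_conv_bounded_linear[THEN iffD1, OF linear_oct_emb] V])
  ultimately show ?thesis
    unfolding sec_X_eq hproj_eq[symmetric] by (intro hfield_scaleR hfield_hproj)
qed

text \<open>The bridge from the covariant derivative in the affine chart to D: expand V in the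
  coordinate frame, apply the product rule and insert \<open>sec_D_X\<close>.\<close>

lemma lift_cov_deriv:
  assumes V: "smooth_on U V" and u: "u \<in> U"
  shows "D a (\<lambda>u. sec.X (V u) (F u)) u = sec.X (cov_deriv_along fs_matrix F V u a) (F u)"
proof -
  let ?E = "\<lambda>j. sec.X (axis j 1) (F u)" let ?b = "dirder a F u"
  have sc: "smooth_on U (\<lambda>u. V u $ j)" for j
    by (rule smooth_on_bounded_linear[OF open_U bounded_linear_vec_nth V])
  have dV: "dirder a (\<lambda>u. V u $ j) u = dirder a V u $ j" for j
    by (rule dirder_bounded_linear[OF bounded_linear_vec_nth smooth_on_imp_differentiable[OF V u]])
  have e: "sec.X w y = (\<Sum>j\<in>UNIV. w $ j *\<^sub>R sec.X (axis j 1) y)" for w y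
    by (rule sec.linear_expand[OF linear_sec_X])
  have "D a (\<lambda>u. sec.X (V u) (F u)) u = D a (\<lambda>u. \<Sum>j\<in>UNIV. V u $ j *\<^sub>R sec.X (axis j 1) (F u)) u"
    by (subst e) (rule refl)
  also have "\<dots> = (\<Sum>j\<in>UNIV. dirder a V u $ j *\<^sub>R ?E j + V u $ j *\<^sub>R D a (\<lambda>u. sec.X (axis j 1) (F u)) u)"
    unfolding dV[symmetric]
    by (rule D_sum[OF u]) (auto intro: smooth_on_imp_differentiable[OF sc u] hfield_lift)
  also have "\<dots> = (\<Sum>j\<in>UNIV. dirder a V u $ j *\<^sub>R ?E j)
      + (\<Sum>j\<in>UNIV. V u $ j *\<^sub>R (\<Sum>k\<in>UNIV. (\<Sum>i\<in>UNIV. ?b $ i * christoffel fs_matrix (F u) k i j) *\<^sub>R ?E k))"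
    unfolding sum.distrib sec_D_X[symmetric]
    by (simp add: D_comp[OF u sec.hfieldD(9)[OF sec.hfield_X UNIV_I]])
  also have "(\<Sum>j\<in>UNIV. V u $ j *\<^sub>R (\<Sum>k\<in>UNIV. (\<Sum>i\<in>UNIV. ?b $ i * christoffel fs_matrix (F u) k i j) *\<^sub>R ?E k))
      = (\<Sum>k\<in>UNIV. (\<Sum>j\<in>UNIV. \<Sum>i\<in>UNIV. christoffel fs_matrix (F u) k i j * ?b $ i * V u $ j) *\<^sub>R ?E k)"
    unfolding scaleR_sum_right
    by (subst sum.swap) (simp add: scaleR_sum_left scaleR_sum_right sum_distrib_left mult_ac)
  also have "\<dots> = (\<Sum>k\<in>UNIV. (\<Sum>i\<in>UNIV. \<Sum>j\<in>UNIV. christoffel fs_matrix (F u) k i j * ?b $ i * V u $ j) *\<^sub>R ?E k)"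
    by (subst sum.swap) (rule refl)
  finally show ?thesis
    by (subst e[of "cov_deriv_along fs_matrix F V u a"])
      (simp add: cov_deriv_along_def dirder_def scaleR_add_left sum.distrib)
qed

end

locale chart_hypersurface = chart_map U F for U :: "(real^5) set" and F +
  fixes \<nu> :: "real^5 \<Rightarrow> real^6"
  assumes smooth_\<nu>: "smooth_on U \<nu>"
    and inj_dF: "u \<in> U \<Longrightarrow> dirder a F u = 0 \<Longrightarrow> a = 0"
    and \<nu>_unit: "u \<in> U \<Longrightarrow> sec.X (\<nu> u) (F u) \<bullet> sec.X (\<nu> u) (F u) = 1"
    and \<nu>_normal: "u \<in> U \<Longrightarrow> sec.X (\<nu> u) (F u) \<bullet> sec.X (dirder a F u) (F u) = 0"
begin

text \<open>The map (a, t) from a space of dimension 5 + 1 is injective, by pairing with the normal,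
  and hence onto the six-dimensional tangent space.\<close>

lemma tangent_normal_span:
  assumes u: "u \<in> U"
  shows "\<exists>a t. w = dirder a F u + t *\<^sub>R \<nu> u"
proof -
  let ?f = "\<lambda>(a, t). dirder a F u + t *\<^sub>R \<nu> u"
  have ldF: "linear (\<lambda>a. dirder a F u)" by (rule linear_dirder[OF F_differentiable[OF u]])
  have lf: "linear ?f"
    by (rule linearI) (auto simp: linear_add[OF ldF] linear_scale[OF ldF] algebra_simps)
  have "a = 0 \<and> t = 0" if "dirder a F u + t *\<^sub>R \<nu> u = 0" for a t
  proof -
    have "sec.X (dirder a F u) (F u) + t *\<^sub>R sec.X (\<nu> u) (F u) = 0"
      using arg_cong[OF that, of "\<lambda>w. sec.X w (F u)"]
      by (simp add: linear_add[OF linear_sec_X] linear_scale[OF linear_sec_X] linear_0[OF linear_sec_X])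
    from arg_cong[OF this, of "\<lambda>v. sec.X (\<nu> u) (F u) \<bullet> v"] have "t = 0"
      by (simp add: inner_add_right \<nu>_unit[OF u] \<nu>_normal[OF u])
    then show ?thesis using that inj_dF[OF u] by simp
  qed
  then have "inj ?f" unfolding linear_injective_0[OF lf] by (auto simp: zero_prod_def)
  then have "dim (range ?f) = dim (UNIV :: ((real^5) \<times> real) set)"
    by (intro dim_image_eq lf) (simp add: inj_on_subset)
  then have "dim (range ?f) = DIM(real^6)" by simp
  then have "span (range ?f) = UNIV" using dim_eq_full by blast
  moreover have "span (range ?f) = range ?f"
    by (rule span_eq_iff[THEN iffD2]) (rule linear_subspace_image[OF lf subspace_UNIV])
  ultimately have "w \<in> range ?f" by simp
  then show ?thesis by auto
qed

end

sublocale chart_hypersurface \<subseteq> sphere_hypersurface oct_J U "\<lambda>u. osec (F u)" "\<lambda>u. sec.X (\<nu> u) (F u)"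
proof
  show "invertible (gram u)" if u: "u \<in> U" for u
    by (rule gram_invertibleI[OF u], rule inj_dF[OF u], rule sec_X_inj) (simp add: X_eq u)
  show "hfield (\<lambda>u. sec.X (\<nu> u) (F u))" by (rule hfield_lift[OF smooth_\<nu>])
  show "sec.X (\<nu> u) (F u) \<bullet> sec.X (\<nu> u) (F u) = 1" if "u \<in> U" for u by (rule \<nu>_unit[OF that])
  show "sec.X (\<nu> u) (F u) \<bullet> X a u = 0" if "u \<in> U" for u a by (simp add: X_eq \<nu>_normal that)
  fix u Z
  assume u: "u \<in> U" and Z: "Z \<bullet> osec (F u) = 0" "Z \<bullet> oct_J (osec (F u)) = 0"
      "Z \<bullet> sec.X (\<nu> u) (F u) = 0" "\<And>i. Z \<bullet> X (axis i 1) u = 0"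
  obtain w where w: "Z = sec.X w (F u)" using sec_horizontal Z by blast
  obtain a t where at: "w = dirder a F u + t *\<^sub>R \<nu> u" using tangent_normal_span[OF u] by blast
  have "Z = X a u + t *\<^sub>R sec.X (\<nu> u) (F u)"
    unfolding w at X_eq[OF u] by (simp add: linear_add[OF linear_sec_X] linear_scale[OF linear_sec_X])
  then have "Z \<bullet> Z = Z \<bullet> X a u" using Z(3) arg_cong[of Z _ "\<lambda>v. Z \<bullet> v"] by (simp add: inner_add_right)
  also have "\<dots> = 0"
    unfolding linear_expand[OF linear_X[OF u], of a] by (simp add: inner_sum_right Z(4))
  finally show "Z = 0" by simp
qed

section \<open>Degeneracy of the Gauss translation\<close>

text \<open>Vanishing of all pairings expresses V by its components p and q along 1 and i. Testing
  with v = y and v = i y and comparing with horizontality gives (1 + |y|^2) p = 0 and (1 - |y|^2) q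
  = 0; only the second equation can degenerate.\<close>

lemma oct_W_kernel:
  assumes V: "V \<bullet> osec y = 0" "V \<bullet> oct_J (osec y) = 0" and y: "y \<bullet> y \<noteq> 1"
    and W: "\<And>i. V \<bullet> oct_W (oct_emb (axis i 1)) (osec y) = 0"
  shows "V = 0"
proof -
  let ?Y = "oct_emb y" and ?r = "inverse (sqrt (1 + y \<bullet> y))"
  define p q where "p = V \<bullet> oct_e 0" and "q = V \<bullet> oct_im"
  have r: "?r \<noteq> 0" using one_plus_inner_pos[of y] by simp
  define \<phi> where "\<phi> = (\<lambda>w. V \<bullet> oct_emb w - (?Y \<bullet> oct_emb w) * p - (?Y \<bullet> oct_J (oct_emb w)) * q)"
  have "V \<bullet> oct_W (oct_emb w) (osec y) = ?r * \<phi> w" for w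
    by (simp add: oct_W_def osec_def inner_add_left inner_add_right inner_diff_right \<phi>_def p_def q_def
        inner_commute[of "oct_e 0" "oct_J _"] oct_J_inner_e algebra_simps)
  then have \<phi>i: "\<phi> (axis i 1) = 0" for i using W[of i] r by simp
  have l: "linear \<phi>"
    unfolding \<phi>_def by (rule linearI)
      (simp_all add: linear_add[OF linear_oct_emb] linear_scale[OF linear_oct_emb] oct.J_lin inner_add_right algebra_simps)
  have \<phi>: "\<phi> w = 0" for w
    using sec.linear_expand[OF l, of w] \<phi>i by simp
  have im: "oct_im \<bullet> oct_J v = v \<bullet> oct_e 0" "oct_e 0 \<bullet> oct_J v = - (v \<bullet> oct_im)" for v
    using oct_J_inner_e[of v] by (simp_all add: inner_commute)
  have p: "p + V \<bullet> ?Y = 0" "q + V \<bullet> oct_J ?Y = 0"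
    using V r by (simp_all add: osec_def oct.J_lin oct_J_e0 inner_add_right p_def q_def)
  have "V \<bullet> ?Y = (y \<bullet> y) * p" using \<phi>[of y] by (simp add: \<phi>_def)
  then have "(1 + y \<bullet> y) * p = 0" using p(1) by (simp add: algebra_simps)
  then have p0: "p = 0" using one_plus_inner_pos[of y] by simp
  have Jy: "oct_emb (oct_co (oct_J ?Y)) = oct_J ?Y"
    using oct_decomp[of "oct_J ?Y"] by (simp add: oct_J_inner_e)
  have "V \<bullet> oct_J ?Y = - (y \<bullet> y) * q" using \<phi>[of "oct_co (oct_J ?Y)"] by (simp add: \<phi>_def Jy p0)
  then have "(1 - y \<bullet> y) * q = 0" using p(2) by (simp add: algebra_simps)
  then have q0: "q = 0" using y by simp
  have "V \<bullet> oct_emb w = 0" for w using \<phi>[of w] by (simp add: \<phi>_def p0 q0)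
  then have "V \<bullet> V = 0"
    using arg_cong[OF oct_decomp[of V], of "(\<bullet>) V"] p0 q0 by (simp add: inner_add_right p_def q_def)
  then show ?thesis by simp
qed

context chart_hypersurface
begin

abbreviation N where "N \<equiv> \<lambda>u. sec.X (\<nu> u) (F u)"

text \<open>The shape operator pulled back to the parameter domain, so that its trace is an ordinary
  matrix trace.\<close>

definition shape :: "real^5 \<Rightarrow> real^5 \<Rightarrow> real^5" where
  "shape u b = (\<chi> j. - (D b N u \<bullet> dual j u))"

text \<open>D N is tangential and expands in the coordinate frame; injectivity of the lift transfers
  the expansion to the chart.\<close>

lemma cov_deriv_normal:
  assumes u: "u \<in> U"
  shows "- cov_deriv_along fs_matrix F \<nu> u b = dirder (shape u b) F u"
proof -
  let ?c = "cov_deriv_along fs_matrix F \<nu> u b"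
  note hD = hfieldD[OF hfield_D[OF hfield_N] u]
  have lX: "linear (\<lambda>a. X a u)" by (rule linear_X[OF u])
  have "D b N u = (\<Sum>j\<in>UNIV. (D b N u \<bullet> dual j u) *\<^sub>R XX j u)"
    by (rule tangential_expand(1)[OF u hD(1,2) D_N_N(1)[OF u]])
  also have "\<dots> = - X (shape u b) u"
    unfolding linear_expand[OF lX, of "shape u b"] by (simp add: shape_def sum_negf)
  finally have "sec.X ?c (F u) = - sec.X (dirder (shape u b) F u) (F u)"
    unfolding lift_cov_deriv[OF smooth_\<nu> u] X_eq[OF u] .
  then have "sec.X (?c + dirder (shape u b) F u) (F u) = 0"
    by (simp add: linear_add[OF linear_sec_X])
  then have "?c + dirder (shape u b) F u = 0" by (rule sec_X_inj)
  then show ?thesis by (simp add: add_eq_0_iff)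
qed

lemma linear_shape: "u \<in> U \<Longrightarrow> linear (shape u)"
proof -
  assume u: "u \<in> U"
  have l: "linear (\<lambda>b. D b N u)" by (rule linear_D[OF u hfieldD(9)[OF hfield_N u]])
  show ?thesis
    by (rule linearI) (simp_all add: shape_def vec_eq_iff linear_add[OF l] linear_scale[OF l] inner_add_left)
qed

lemma trace_shape: "trace (matrix (shape u)) = trA u"
  by (simp add: trace_def matrix_def shape_def trA_def sum_negf)

lemma trace_shape_sq: "u \<in> U \<Longrightarrow> trace (matrix (shape u \<circ> shape u)) = trA2 u"
proof -
  assume u: "u \<in> U"
  have "shape u (shape u (axis i 1)) $ i = (\<Sum>j\<in>UNIV. (DD i N u \<bullet> dual j u) * (DD j N u \<bullet> dual i u))" for i
  proof -
    have "shape u (shape u (axis i 1)) = (\<Sum>j\<in>UNIV. shape u (axis i 1) $ j *\<^sub>R shape u (axis j 1))"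
      by (rule linear_expand[OF linear_shape[OF u]])
    then show ?thesis by (simp add: shape_def)
  qed
  then show ?thesis by (simp add: trace_def matrix_def trA2_def)
qed

lemma killing: "killing_hypersurface oct_J U (\<lambda>u. osec (F u)) N (oct_W v)"
proof
  show "oct_W v (x + y) = oct_W v x + oct_W v y" "oct_W v (r *\<^sub>R x) = r *\<^sub>R oct_W v x" for x y r
    by (simp_all add: linear_add[OF linear_oct_W] linear_scale[OF linear_oct_W])
  show "oct_W v x \<bullet> w = - (x \<bullet> oct_W v w)" for x w by (rule oct_W_skew)
  show "oct_W v (oct_J x) = oct_J (oct_W v x)" for x by (rule oct_W_J)
qed

lemmas laplace_support = killing_hypersurface.laplace_support[OF killing]

text \<open>At points with \<open>F u \<bullet> F u = 1\<close> the fields \<open>oct_W\<close> miss one horizontal direction (compare \<open>oct_W_kernel\<close>),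
  so the Gauss translation does not detect the gradient of \<open>H\<close> there. These points form a geodesic sphere of
  radius \<open>\<pi>/4\<close>, whose unit normal lifts to \<open>x - sqrt 2 e\<^sub>0\<close> up to sign and for which \<open>trA\<close> is \<open>-4\<close> times that sign.\<close>

lemma trA_geodesic_sphere:
  assumes 1: "\<And>u. u \<in> U \<Longrightarrow> F u \<bullet> F u = 1" and u: "u \<in> U"
  shows "dirder a trA u = 0"
proof -
  let ?x = "\<lambda>u. osec (F u)"
  define n where "n = (\<lambda>u. ?x u - sqrt 2 *\<^sub>R oct_e 0)"
  have xe: "?x u \<bullet> oct_e 0 = inverse (sqrt 2)" "oct_e 0 \<bullet> ?x u = inverse (sqrt 2)" "?x u \<bullet> oct_im = 0"
      "oct_im \<bullet> ?x u = 0" "oct_e 0 \<bullet> oct_J (?x u) = 0" if "u \<in> U" for u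
    using 1[OF that] by (simp_all add: osec_def inner_add_left inner_add_right inner_commute[of "oct_e 0" "oct_J _"]
        oct_J_inner_e)
  have smn: "smooth_on U n" unfolding n_def by (intro smooth_intros)
  have hn: "hfield n"
    unfolding hfield_def using smn x_x xe by (auto simp: n_def inner_diff_left)
  have nn: "n u \<bullet> n u = 1" if "u \<in> U" for u
    using x_x[OF that] xe[OF that]
    by (simp add: n_def inner_diff_left inner_diff_right right_diff_distrib)
  have dx: "dirder a ?x u \<bullet> oct_e 0 = 0" "dirder a ?x u \<bullet> oct_im = 0" if u: "u \<in> U" for a u
  proof -
    have "dirder a (\<lambda>u. ?x u \<bullet> e) u = dirder a ?x u \<bullet> e" for e
      by (rule dirder_bounded_linear[OF bounded_linear_inner_left x_differentiable[OF u]])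
    moreover have "dirder a (\<lambda>u. ?x u \<bullet> oct_e 0) u = dirder a (\<lambda>u. inverse (sqrt 2)) u"
      "dirder a (\<lambda>u. ?x u \<bullet> oct_im) u = dirder a (\<lambda>u. 0) u"
      by (rule dirder_cong[OF open_U u], simp add: xe)+
    ultimately show "dirder a ?x u \<bullet> oct_e 0 = 0" "dirder a ?x u \<bullet> oct_im = 0" by simp_all
  qed
  have nX: "n u \<bullet> X a u = 0" if u: "u \<in> U" for a u
    using hproj_inner_horizontal[OF hfieldD(1,2)[OF hn u], of "dirder a ?x u"] dirder_x_inner[OF u, of a] dx[OF u, of a]
    by (simp add: X_def inner_commute[of "n u"]) (simp add: n_def inner_diff_right)
  \<comment> \<open>By \<open>full\<close> the given normal is a multiple of \<open>n\<close>. Its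
    factor squares to 1, so the derivative of the factor vanishes.\<close>
  define \<epsilon> where "\<epsilon> = (\<lambda>u. n u \<bullet> N u)"
  have n_eq: "n u = \<epsilon> u *\<^sub>R N u" if u: "u \<in> U" for u
  proof -
    have "n u - \<epsilon> u *\<^sub>R N u = 0"
      by (rule full[OF u]) (simp_all add: inner_diff_left hfieldD[OF hn u] hfieldD[OF hfield_N u]
          N_N[OF u] nX[OF u] N_X[OF u] \<epsilon>_def)
    then show ?thesis by simp
  qed
  have \<epsilon>2: "\<epsilon> u * \<epsilon> u = 1" if u: "u \<in> U" for u
    using nn[OF u] unfolding n_eq[OF u] by (simp add: N_N[OF u])
  have N_eq: "N u = \<epsilon> u *\<^sub>R n u" if u: "u \<in> U" for u
    unfolding n_eq[OF u] using \<epsilon>2[OF u] by simp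
  have sm\<epsilon>: "smooth_on U \<epsilon>" unfolding \<epsilon>_def by (rule hfield_inner_smooth[OF hn hfield_N])
  have d\<epsilon>: "dirder a \<epsilon> u = 0" if u: "u \<in> U" for a u
  proof -
    have "dirder a (\<lambda>u. \<epsilon> u * \<epsilon> u) u = dirder a (\<lambda>u. 1) u"
      by (rule dirder_cong[OF open_U u]) (rule \<epsilon>2)
    then have "2 * (\<epsilon> u * dirder a \<epsilon> u) = 0"
      by (simp add: dirder_mult smooth_on_imp_differentiable[OF sm\<epsilon> u])
    then show ?thesis using \<epsilon>2[OF u] by auto
  qed
  \<comment> \<open>\<open>n\<close> differs from x by a constant, so its derivative is that of x;
    the phase term becomes the component along J n. Up to sign the principal curvatures are 1 four
    times and 0 along J n, that is cot(pi/4) and 2 cot(pi/2).\<close>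
  have Dn: "D a n u = X a u - (X a u \<bullet> oct_J (n u)) *\<^sub>R oct_J (n u)" if u: "u \<in> U" for a u
  proof -
    have "((\<lambda>u. ?x u - sqrt 2 *\<^sub>R oct_e 0) has_derivative (\<lambda>a. dirder a ?x u)) (at u)"
      using has_derivative_dirder[OF x_differentiable[OF u]] by (auto intro!: derivative_eq_intros)
    then have dn: "dirder a n u = dirder a ?x u" unfolding n_def by (rule dirder_eq)
    have "X a u \<bullet> oct_J (n u) = dirder a ?x u \<bullet> oct_J (n u)"
      unfolding X_def using hfieldD[OF hn u] by (intro hproj_inner_horizontal) simp_all
    also have "\<dots> = phase a u"
      by (simp add: n_def phase_def oct.J_lin oct_J_e0 inner_diff_right dx[OF u])
    finally show ?thesis by (simp add: D_def dn X_def)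
  qed
  have DN: "D a N u = \<epsilon> u *\<^sub>R D a n u" if u: "u \<in> U" for a u
  proof -
    have "dirder a N u = dirder a (\<lambda>u. \<epsilon> u *\<^sub>R n u) u"
      by (rule dirder_cong[OF open_U u]) (rule N_eq)
    then have "dirder a N u = \<epsilon> u *\<^sub>R dirder a n u"
      by (simp add: dirder_scaleR smooth_on_imp_differentiable[OF sm\<epsilon> u] smooth_on_imp_differentiable[OF smn u] d\<epsilon>[OF u])
    then show ?thesis
      by (simp add: D_def linear_scale[OF linear_hproj] N_eq[OF u] oct.J_lin scaleR_diff_right mult.commute)
  qed
  have "trA u = - 4 * \<epsilon> u" if u: "u \<in> U" for u
  proof -
    have "oct_J (n u) \<bullet> oct_J (n u) = (\<Sum>i\<in>UNIV. (oct_J (n u) \<bullet> XX i u) * (dual i u \<bullet> oct_J (n u)))"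
      by (rule tangential_inner(2)[OF u]) (simp_all add: hfieldD[OF hn u] N_eq[OF u])
    then have "(\<Sum>i\<in>UNIV. (XX i u \<bullet> oct_J (n u)) * (oct_J (n u) \<bullet> dual i u)) = 1"
      using nn[OF u] by (simp add: inner_commute)
    moreover have "(\<Sum>i\<in>UNIV. XX i u \<bullet> dual i u) = 5"
      using dual_X[OF u] by (simp add: inner_commute)
    ultimately have "(\<Sum>i\<in>UNIV. D (axis i 1) n u \<bullet> dual i u) = 4"
      unfolding Dn[OF u] by (simp add: inner_diff_left sum_subtractf)
    then show ?thesis unfolding trA_def DN[OF u] by (simp add: sum_distrib_left[symmetric] mult.commute)
  qed
  then have "dirder a trA u = dirder a (\<lambda>u. - 4 * \<epsilon> u) u"
    by (rule dirder_cong[OF open_U u])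
  also have "\<dots> = 0"
    unfolding dirder_bounded_linear[OF bounded_linear_mult_right smooth_on_imp_differentiable[OF sm\<epsilon> u]]
    by (simp add: d\<epsilon>[OF u])
  finally show ?thesis .
qed

lemma trA_critical:
  assumes crit: "\<And>u a. u \<in> U \<Longrightarrow> F u \<bullet> F u \<noteq> 1 \<Longrightarrow> dirder a trA u = 0" and u: "u \<in> U"
  shows "dirder a trA u = 0"
proof -
  let ?S = "{u \<in> U. F u \<bullet> F u = 1}"
  have cont: "continuous_on U (\<lambda>u. F u \<bullet> F u)"
    by (intro continuous_on_inner smooth_on_imp_continuous[OF smooth_F])
  show ?thesis
  proof (cases "u \<in> closure (U - ?S)")
    case True
    define h where "h = dirder a trA"
    have ch: "continuous_on U h" unfolding h_def by (intro smooth_on_imp_continuous smooth_intros smooth_trA)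
    obtain f where f: "\<And>n. f n \<in> U - ?S" "f \<longlonglongrightarrow> u"
      using True unfolding closure_sequential by blast
    have "(\<lambda>n. h (f n)) \<longlonglongrightarrow> h u"
      by (rule continuous_on_tendsto_compose[OF ch f(2) u]) (use f(1) in auto)
    moreover have "h (f n) = 0" for n using f(1)[of n] crit by (simp add: h_def)
    ultimately have "h u = 0" by (simp add: LIMSEQ_const_iff)
    then show ?thesis by (simp add: h_def)
  next
    case False
    define O' where "O' = U \<inter> - closure (U - ?S)"
    have O: "open O'" unfolding O'_def using open_U by auto
    have sub: "O' \<subseteq> U" "O' \<subseteq> ?S" unfolding O'_def using closure_subset[of "U - ?S"] by auto
    \<comment> \<open>\<open>trA\<close> is built from F and the normal without reference to the
      domain, so the restricted hypersurface has the same \<open>trA\<close>.\<close>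
    interpret O: chart_hypersurface O' F \<nu>
      using sub O smooth_on_subset[OF smooth_F sub(1)] smooth_on_subset[OF smooth_\<nu> sub(1)]
      by unfold_locales (auto intro: inj_dF \<nu>_unit \<nu>_normal)
    show ?thesis
      by (rule O.trA_geodesic_sphere) (use False u sub in \<open>auto simp: O'_def\<close>)
  qed
qed

end

section \<open>Differentiability of transition maps\<close>

text \<open>Only continuity of \<open>\<tau>\<close> is given. As G' is bounded below, increments of
  \<open>\<tau>\<close> are controlled by those of F, hence by those of the argument; a linear left
  inverse of G' then yields the derivative.\<close>

lemma has_derivative_through_immersion:
  fixes F :: "'a::euclidean_space \<Rightarrow> 'c::euclidean_space" and G :: "'b::euclidean_space \<Rightarrow> 'c"
  assumes F: "(F has_derivative F') (at u)" and G: "(G has_derivative G') (at (\<tau> u))" and inj: "inj G'"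
    and \<tau>: "isCont \<tau> u" and eq: "\<forall>\<^sub>F u' in nhds u. F u' = G (\<tau> u')"
  shows "\<exists>T. (\<tau> has_derivative T) (at u) \<and> F' = G' \<circ> T"
proof -
  let ?v = "\<tau> u"
  have lG: "linear G'" and lF: "linear F'"
    using F G has_derivative_linear by auto
  obtain L where L: "linear L" "L \<circ> G' = id"
    using linear_injective_left_inverse[OF lG inj] by blast
  obtain B where B: "B > 0" "\<And>w. B * norm w \<le> norm (G' w)"
    using linear_inj_bounded_below_pos[OF lG inj] by blast
  obtain K where K: "K > 0" "\<And>w. norm (L w) \<le> K * norm w"
    using linear_bounded_pos[OF L(1)] by blast
  obtain C where C: "C > 0" "\<And>h. norm (F' h) \<le> C * norm h"
    using linear_bounded_pos[OF lF] by blast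
  \<comment> \<open>Half of the lower bound B is spent on the remainder of G, and the remainder of
    F, taken with e = 1, adds 1 to the operator bound C.\<close>
  define M where "M = 2 * (C + 1) / B"
  have M: "M > 0" using B C by (simp add: M_def)
  have F_near: "\<forall>\<^sub>F u' in nhds u. norm (F u' - F u - F' (u' - u)) \<le> e * norm (u' - u)" if "e > 0" for e
    using F that unfolding has_derivative_at_alt eventually_nhds_metric dist_norm by blast
  have tend: "(\<tau> \<longlongrightarrow> ?v) (nhds u)" using \<tau> by (simp add: isCont_def tendsto_nhds_iff)
  have G_near: "\<forall>\<^sub>F u' in nhds u. norm (G (\<tau> u') - G ?v - G' (\<tau> u' - ?v)) \<le> e * norm (\<tau> u' - ?v)" if "e > 0" for e
  proof -
    have "\<forall>\<^sub>F w in nhds ?v. norm (G w - G ?v - G' (w - ?v)) \<le> e * norm (w - ?v)"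
      using G that unfolding has_derivative_at_alt eventually_nhds_metric dist_norm by blast
    then show ?thesis using tend by (rule eventually_compose_filterlim)
  qed
  have equ: "F u = G ?v" using eq by (rule eventually_nhds_x_imp_x)
  have lip: "\<forall>\<^sub>F u' in nhds u. norm (\<tau> u' - ?v) \<le> M * norm (u' - u)"
    using eq F_near[of 1, simplified] G_near[OF half_gt_zero[OF B(1)]]
  proof eventually_elim
    case (elim u')
    have "B * norm (\<tau> u' - ?v) \<le> norm (G' (\<tau> u' - ?v))" by (rule B(2))
    also have "\<dots> \<le> norm (G (\<tau> u') - G ?v) + norm (G (\<tau> u') - G ?v - G' (\<tau> u' - ?v))"
      using norm_triangle_ineq4[of "G (\<tau> u') - G ?v" "G (\<tau> u') - G ?v - G' (\<tau> u' - ?v)"] by simp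
    also have "\<dots> \<le> norm (F u' - F u) + B / 2 * norm (\<tau> u' - ?v)" using elim equ by simp
    finally have "B / 2 * norm (\<tau> u' - ?v) \<le> norm (F u' - F u)" by (simp add: algebra_simps)
    also have "\<dots> \<le> norm (F u' - F u - F' (u' - u)) + norm (F' (u' - u))"
      using norm_triangle_ineq[of "F u' - F u - F' (u' - u)" "F' (u' - u)"] by simp
    also have "\<dots> \<le> norm (u' - u) + C * norm (u' - u)" using elim C(2) by (intro add_mono) auto
    finally show ?case using B(1) by (simp add: M_def field_simps)
  qed
  let ?T = "L \<circ> F'"
  have lT: "linear ?T" using lF L(1) by (rule linear_compose)
  have "(\<tau> has_derivative ?T) (at u)"
    unfolding has_derivative_at_alt
  proof (intro conjI allI impI)
    show "bounded_linear ?T" using lT by (simp add: linear_conv_bounded_linear)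
    fix e :: real assume e: "e > 0"
    have "\<forall>\<^sub>F u' in nhds u. norm (\<tau> u' - ?v - ?T (u' - u)) \<le> e * norm (u' - u)"
    proof -
      \<comment> \<open>Each remainder may use half of e after L has stretched it by at most K; the
        remainder of G is measured in \<open>\<tau>\<close> and loses a further factor M.\<close>
      have p: "e / (2 * K) > 0" "e / (2 * K * M) > 0" using e K M by simp_all
      show ?thesis using eq lip F_near[OF p(1)] G_near[OF p(2)]
      proof eventually_elim
        case (elim u')
        have LG: "L (G' w) = w" for w using L(2) by (metis comp_apply id_apply)
        have "\<tau> u' - ?v - ?T (u' - u) = L (G' (\<tau> u' - ?v) - F' (u' - u))"
          by (simp add: linear_diff[OF L(1)] LG)
        also have "G' (\<tau> u' - ?v) - F' (u' - u)
            = (F u' - F u - F' (u' - u)) - (G (\<tau> u') - G ?v - G' (\<tau> u' - ?v))"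
          using elim(1) equ by simp
        finally have "norm (\<tau> u' - ?v - ?T (u' - u))
            \<le> K * norm ((F u' - F u - F' (u' - u)) - (G (\<tau> u') - G ?v - G' (\<tau> u' - ?v)))"
          using K(2) by simp
        also have "\<dots> \<le> K * (norm (F u' - F u - F' (u' - u)) + norm (G (\<tau> u') - G ?v - G' (\<tau> u' - ?v)))"
          using K(1) by (intro mult_left_mono norm_triangle_ineq4) auto
        also have "\<dots> \<le> K * (e / (2 * K) * norm (u' - u) + e / (2 * K * M) * (M * norm (u' - u)))"
        proof (intro mult_left_mono add_mono)
          have "e / (2 * K * M) * norm (\<tau> u' - ?v) \<le> e / (2 * K * M) * (M * norm (u' - u))"
            using elim(2) e K M by (intro mult_left_mono) auto
          then show "norm (G (\<tau> u') - G ?v - G' (\<tau> u' - ?v)) \<le> e / (2 * K * M) * (M * norm (u' - u))"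
            using elim(4) by linarith
        qed (use elim(3) K in auto)
        also have "\<dots> = e * norm (u' - u)" using K M by (simp add: field_simps)
        finally show ?case .
      qed
    qed
    then show "\<exists>d>0. \<forall>y. norm (y - u) < d \<longrightarrow> norm (\<tau> y - \<tau> u - ?T (y - u)) \<le> e * norm (y - u)"
      unfolding eventually_nhds_metric dist_norm by blast
  qed
  moreover have "F' = G' \<circ> ?T"
  proof -
    have "((\<lambda>u'. G (\<tau> u')) has_derivative (\<lambda>h. G' (?T h))) (at u)"
      using has_derivative_compose[OF calculation] G by blast
    moreover have "((\<lambda>u'. G (\<tau> u')) has_derivative F') (at u)"
    proof -
      obtain S where "open S" "u \<in> S" "\<And>u'. u' \<in> S \<Longrightarrow> F u' = G (\<tau> u')"
        using eq unfolding eventually_nhds by blast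
      then show ?thesis by (rule has_derivative_transform_within_open[OF F])
    qed
    ultimately show ?thesis using has_derivative_unique by (auto simp: o_def)
  qed
  ultimately show ?thesis by blast
qed

lemma frechet_derivative_cong_open:
  "open U \<Longrightarrow> v \<in> U \<Longrightarrow> (\<And>v. v \<in> U \<Longrightarrow> h v = h' v) \<Longrightarrow> frechet_derivative h (at v) = frechet_derivative h' (at v)"
  using dirder_cong[of U v h h'] by (simp add: dirder_def fun_eq_iff)

lemma claplace_cong:
  assumes U: "open U" "u \<in> U" and g: "\<And>v. v \<in> U \<Longrightarrow> g v = g' v" and f: "\<And>v. v \<in> U \<Longrightarrow> f v = f' v"
  shows "claplace g f u = claplace g' f' u"
proof -
  have grad: "cgrad g f v = cgrad g' f' v" if v: "v \<in> U" for v
  proof -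
    have "frechet_derivative f (at v) = frechet_derivative f' (at v)"
      using U(1) v f by (rule frechet_derivative_cong_open)
    then show ?thesis unfolding cgrad_def g[OF v] by simp
  qed
  have "frechet_derivative g (at u) = frechet_derivative g' (at u)"
    using U g by (rule frechet_derivative_cong_open)
  then have "christoffel g u = christoffel g' u"
    unfolding christoffel_def[abs_def] g[OF U(2)] by simp
  moreover have "frechet_derivative (cgrad g f) (at u) = frechet_derivative (cgrad g' f') (at u)"
    using U grad by (rule frechet_derivative_cong_open)
  ultimately show ?thesis
    unfolding claplace_def cdiv_def cov_deriv_along_def[abs_def] frechet_derivative_ident grad[OF U(2)] by simp
qed

section \<open>Independence of the parametrization\<close>

text \<open>Only the germ of the transition map at u and its derivative are recorded, enough for the
  chain rule and free of domains.\<close>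

definition transition :: "(real^5 \<Rightarrow> 'm) \<Rightarrow> real^5 \<Rightarrow> (real^5 \<Rightarrow> 'm) \<Rightarrow> real^5 \<Rightarrow> (real^5 \<Rightarrow> real^5) \<Rightarrow> bool" where
  "transition \<phi> u \<psi> v T \<longleftrightarrow>
     (\<exists>\<tau>. (\<tau> has_derivative T) (at u) \<and> \<tau> u = v \<and> (\<forall>\<^sub>F u' in nhds u. \<phi> u' = \<psi> (\<tau> u')))"

lemma transition_dirder:
  assumes "transition \<phi> u \<psi> v T" "(h \<circ> \<psi>) differentiable (at v)"
  shows "dirder a (h \<circ> \<phi>) u = dirder (T a) (h \<circ> \<psi>) v"
proof -
  obtain \<tau> where \<tau>: "(\<tau> has_derivative T) (at u)" "\<tau> u = v" "\<forall>\<^sub>F u' in nhds u. \<phi> u' = \<psi> (\<tau> u')"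
    using assms(1) unfolding transition_def by blast
  then obtain S where S: "open S" "u \<in> S" "\<And>u'. u' \<in> S \<Longrightarrow> \<phi> u' = \<psi> (\<tau> u')"
    unfolding eventually_nhds by blast
  have "dirder a (h \<circ> \<phi>) u = dirder a (\<lambda>u'. (h \<circ> \<psi>) (\<tau> u')) u"
    by (rule dirder_cong[OF S(1,2)]) (simp add: S(3))
  also have "\<dots> = dirder (dirder a \<tau> u) (h \<circ> \<psi>) v"
    using dirder_chain[of \<tau> u "h \<circ> \<psi>" a] \<tau> assms(2) by (auto simp: differentiable_def)
  finally show ?thesis by (simp add: dirder_eq[OF \<tau>(1)])
qed

lemma local_paramD:
  assumes "local_param X \<iota> U \<phi>"
  shows "open U" "openin X (\<phi> ` U)" "inj_on \<phi> U" "continuous_map (top_of_set U) X \<phi>"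
    "smooth_on U (cp_chart \<circ> \<iota> \<circ> \<phi>)"
    "\<And>u. u \<in> U \<Longrightarrow> inj (frechet_derivative (cp_chart \<circ> \<iota> \<circ> \<phi>) (at u))"
    "\<And>S. S \<subseteq> U \<Longrightarrow> open S \<Longrightarrow> openin X (\<phi> ` S)"
    "\<And>u. u \<in> U \<Longrightarrow> \<phi> u \<in> topspace X"
proof -
  have h: "homeomorphic_map (top_of_set U) (subtopology X (\<phi> ` U)) \<phi>"
    and U: "open U" and im: "openin X (\<phi> ` U)"
    and rest: "smooth_on U (cp_chart \<circ> \<iota> \<circ> \<phi>)"
      "\<And>u. u \<in> U \<Longrightarrow> inj (frechet_derivative (cp_chart \<circ> \<iota> \<circ> \<phi>) (at u))"
    using assms unfolding local_param_def by auto
  show "open U" "openin X (\<phi> ` U)" "smooth_on U (cp_chart \<circ> \<iota> \<circ> \<phi>)"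
    "\<And>u. u \<in> U \<Longrightarrow> inj (frechet_derivative (cp_chart \<circ> \<iota> \<circ> \<phi>) (at u))" by fact+
  show "inj_on \<phi> U" using homeomorphic_imp_injective_map[OF h] by simp
  show "continuous_map (top_of_set U) X \<phi>"
    using homeomorphic_imp_continuous_map[OF h] by (simp add: continuous_map_in_subtopology)
  show "openin X (\<phi> ` S)" if S: "S \<subseteq> U" "open S" for S
  proof -
    have "openin (top_of_set U) S" using S U by (simp add: openin_open_eq)
    then have "openin (subtopology X (\<phi> ` U)) (\<phi> ` S)"
      using homeomorphic_imp_open_map[OF h] unfolding open_map_def by blast
    then show ?thesis using im openin_open_subtopology by blast
  qed
  show "\<phi> u \<in> topspace X" if "u \<in> U" for u using openin_subset[OF im] that by blast
qed

text \<open>The homeomorphism property makes the transition map continuous, and in the affine chart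
  \<open>has_derivative_through_immersion\<close> upgrades it to a differentiable map. Injectivity
  of T comes from that of the differential of the first parametrization.\<close>

lemma transition_exists:
  assumes \<phi>: "local_param X \<iota> U \<phi>" and \<psi>: "local_param X \<iota> V \<psi>"
    and u: "u \<in> U" and v: "v \<in> V" and uv: "\<phi> u = \<psi> v"
  shows "\<exists>T. transition \<phi> u \<psi> v T \<and> linear T \<and> inj T"
proof -
  note f = local_paramD[OF \<phi>] and g = local_paramD[OF \<psi>]
  let ?F = "cp_chart \<circ> \<iota> \<circ> \<phi>" and ?G = "cp_chart \<circ> \<iota> \<circ> \<psi>"
  define \<tau> where "\<tau> = (\<lambda>u'. inv_into V \<psi> (\<phi> u'))"
  have \<tau>u: "\<tau> u = v" using uv v g(3) by (simp add: \<tau>_def)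
  \<comment> \<open>One preimage argument gives both facts needed: with S the whole space the
    factorization near u, with small S the continuity of \<open>\<tau>\<close>.\<close>
  have pre: "\<exists>W. open W \<and> u \<in> W \<and> (\<forall>u'\<in>W. \<tau> u' \<in> S \<and> \<phi> u' = \<psi> (\<tau> u'))" if S: "open S" "v \<in> S" for S
  proof -
    define W where "W = {u' \<in> topspace (top_of_set U). \<phi> u' \<in> \<psi> ` (S \<inter> V)}"
    have "openin X (\<psi> ` (S \<inter> V))" using S g(1) by (intro g(7)) auto
    then have "openin (top_of_set U) W"
      unfolding W_def by (rule openin_continuous_map_preimage[OF f(4)])
    then have "open W" using f(1) by (simp add: openin_open_eq)
    moreover have "u \<in> W" using u v S uv by (auto simp: W_def)
    moreover have "\<tau> u' \<in> S \<and> \<phi> u' = \<psi> (\<tau> u')" if u': "u' \<in> W" for u'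
    proof -
      obtain w where "w \<in> S" "w \<in> V" "\<phi> u' = \<psi> w" using u' unfolding W_def by blast
      then show ?thesis using g(3) by (simp add: \<tau>_def)
    qed
    ultimately show ?thesis by blast
  qed
  have ev: "\<forall>\<^sub>F u' in nhds u. \<phi> u' = \<psi> (\<tau> u')"
    using pre[OF open_UNIV] unfolding eventually_nhds by blast
  have "(\<tau> \<longlongrightarrow> \<tau> u) (at u)"
  proof (rule topological_tendstoI)
    fix S assume "open S" "\<tau> u \<in> S"
    then show "\<forall>\<^sub>F u' in at u. \<tau> u' \<in> S"
      using pre[of S] unfolding eventually_at_topological \<tau>u by blast
  qed
  then have cont: "isCont \<tau> u" by (simp add: isCont_def)
  have dF: "(?F has_derivative frechet_derivative ?F (at u)) (at u)"
    using smooth_on_imp_differentiable[OF f(5) u] by (simp add: frechet_derivative_works)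
  have dG: "(?G has_derivative frechet_derivative ?G (at v)) (at (\<tau> u))"
    using smooth_on_imp_differentiable[OF g(5) v] by (simp add: frechet_derivative_works \<tau>u)
  have "\<forall>\<^sub>F u' in nhds u. ?F u' = ?G (\<tau> u')" using ev by eventually_elim simp
  then obtain T where T: "(\<tau> has_derivative T) (at u)" "frechet_derivative ?F (at u) = frechet_derivative ?G (at v) \<circ> T"
    using has_derivative_through_immersion[OF dF dG g(6)[OF v] cont] by blast
  have "inj T" using f(6)[OF u] unfolding T(2) by (rule inj_on_imageI2)
  then show ?thesis
    using T(1) \<tau>u ev has_derivative_linear[OF T(1)] unfolding transition_def by blast
qed

section \<open>Pointwise objects in an arbitrary parametrization\<close>

locale oriented_hypersurface =
  fixes X :: "'m topology" and \<iota> :: "'m \<Rightarrow> octonion set" and \<eta> :: "'m \<Rightarrow> real^6"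
  assumes hypersurface: "hypersurface X \<iota>" and unit_normal: "unit_normal X \<iota> \<eta>"
begin

abbreviation coord :: "(real^5 \<Rightarrow> 'm) \<Rightarrow> real^5 \<Rightarrow> real^6" where "coord \<phi> \<equiv> cp_chart \<circ> \<iota> \<circ> \<phi>"
abbreviation pos :: "(real^5 \<Rightarrow> 'm) \<Rightarrow> real^5 \<Rightarrow> octonion" where "pos \<phi> \<equiv> \<lambda>u. osec (coord \<phi> u)"
abbreviation nrm :: "(real^5 \<Rightarrow> 'm) \<Rightarrow> real^5 \<Rightarrow> octonion" where
  "nrm \<phi> \<equiv> \<lambda>u. sphere_map.X oct_J osec ((\<eta> \<circ> \<phi>) u) (coord \<phi> u)"
abbreviation meanc :: "(real^5 \<Rightarrow> 'm) \<Rightarrow> real^5 \<Rightarrow> real" where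
  "meanc \<phi> \<equiv> sphere_hypersurface.trA oct_J (pos \<phi>) (nrm \<phi>)"

lemma param_at_cases:
  assumes "p \<in> topspace X"
  obtains U \<phi> u where "param_at X \<iota> p = (\<phi>, u)" "local_param X \<iota> U \<phi>" "u \<in> U" "\<phi> u = p"
proof -
  have "\<exists>U \<phi>. local_param X \<iota> U \<phi> \<and> p \<in> \<phi> ` U"
    using hypersurface assms unfolding hypersurface_def by simp
  then obtain U \<phi> where \<phi>: "local_param X \<iota> U \<phi>" "p \<in> \<phi> ` U" by (elim exE conjE)
  from \<phi>(2) obtain u where "p = \<phi> u" "u \<in> U" by (rule imageE)
  with \<phi>(1) have "case (\<phi>, u) of (\<phi>, u) \<Rightarrow> \<exists>U. local_param X \<iota> U \<phi> \<and> u \<in> U \<and> \<phi> u = p" by auto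
  then have "\<exists>x. case x of (\<phi>, u) \<Rightarrow> \<exists>U. local_param X \<iota> U \<phi> \<and> u \<in> U \<and> \<phi> u = p" by (rule exI)
  from someI_ex[OF this]
  have "case param_at X \<iota> p of (\<phi>, u) \<Rightarrow> \<exists>U. local_param X \<iota> U \<phi> \<and> u \<in> U \<and> \<phi> u = p"
    unfolding param_at_def .
  moreover obtain \<phi>' u' where e: "param_at X \<iota> p = (\<phi>', u')" by (cases "param_at X \<iota> p")
  ultimately obtain U' where "local_param X \<iota> U' \<phi>'" "u' \<in> U'" "\<phi>' u' = p" by auto
  with e show ?thesis by (rule that)
qed

lemma \<iota>_in: "p \<in> topspace X \<Longrightarrow> \<iota> p \<in> CP3 - CP2"
  using hypersurface unfolding hypersurface_def by (elim conjE) (rule subsetD, assumption, rule imageI)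

lemma differentiable_\<eta>: "local_param X \<iota> U \<phi> \<Longrightarrow> u \<in> U \<Longrightarrow> (\<eta> \<circ> \<phi>) differentiable (at u)"
  using unit_normal unfolding unit_normal_def by (intro smooth_on_imp_differentiable[of U]) simp_all

text \<open>The definitions evaluate everything in the parametrization chosen at the point. This
  collects what is needed to pass from it to a given one.\<close>

lemma param_compare:
  assumes \<psi>: "local_param X \<iota> V \<psi>" and v: "v \<in> V"
  shows "\<exists>\<phi> u T. param_at X \<iota> (\<psi> v) = (\<phi>, u) \<and> coord \<phi> u = coord \<psi> v \<and> (\<eta> \<circ> \<phi>) u = (\<eta> \<circ> \<psi>) v
    \<and> linear T \<and> inj T \<and> inj (dparam_at X \<iota> (\<psi> v))
    \<and> (\<forall>b. dirder b (coord \<psi>) v = dirder (T b) (coord \<phi>) u)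
    \<and> (\<forall>b. dirder b (coord \<psi>) v = dparam_at X \<iota> (\<psi> v) (T b))
    \<and> (\<forall>b. dirder b (\<eta> \<circ> \<psi>) v = dirder (T b) (\<eta> \<circ> \<phi>) u)"
proof -
  obtain U \<phi> u where p: "param_at X \<iota> (\<psi> v) = (\<phi>, u)" "local_param X \<iota> U \<phi>" "u \<in> U" "\<phi> u = \<psi> v"
    by (rule param_at_cases[OF local_paramD(8)[OF \<psi> v]])
  obtain T where T: "transition \<psi> v \<phi> u T" "linear T" "inj T"
    using transition_exists[OF \<psi> p(2) v p(3) p(4)[symmetric]] by blast
  have d: "dirder b (coord \<psi>) v = dirder (T b) (coord \<phi>) u" for b
    by (rule transition_dirder[OF T(1) smooth_on_imp_differentiable[OF local_paramD(5)[OF p(2)] p(3)]])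
  have dp: "dparam_at X \<iota> (\<psi> v) b = dirder b (coord \<phi>) u" for b
    by (simp add: dparam_at_def p(1) dirder_def)
  have "inj (dparam_at X \<iota> (\<psi> v))"
    using local_paramD(6)[OF p(2,3)] by (simp add: dparam_at_def p(1))
  show ?thesis
  proof (rule exI[of _ \<phi>], rule exI[of _ u], rule exI[of _ T], intro conjI allI)
    show "inj (dparam_at X \<iota> (\<psi> v))" by fact
    show "coord \<phi> u = coord \<psi> v" "(\<eta> \<circ> \<phi>) u = (\<eta> \<circ> \<psi>) v" using p(4) by simp_all
    show "dirder b (coord \<psi>) v = dirder (T b) (coord \<phi>) u" for b by (rule d)
    show "dirder b (coord \<psi>) v = dparam_at X \<iota> (\<psi> v) (T b)" for b
      unfolding d dp ..
    show "dirder b (\<eta> \<circ> \<psi>) v = dirder (T b) (\<eta> \<circ> \<phi>) u" for b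
      by (rule transition_dirder[OF T(1) differentiable_\<eta>[OF p(2,3)]])
    show "param_at X \<iota> (\<psi> v) = (\<phi>, u)" "linear T" "inj T" by fact+
  qed
qed

text \<open>Orthogonality of the normal is given for the tangent space of the chosen
  parametrization, so \<open>param_compare\<close> is needed to obtain it for this one.\<close>

lemma chart_hypersurface:
  assumes \<psi>: "local_param X \<iota> V \<psi>"
  shows "chart_hypersurface V (coord \<psi>) (\<eta> \<circ> \<psi>)"
proof
  note g = local_paramD[OF \<psi>]
  show "open V" "smooth_on V (coord \<psi>)" by fact+
  show "smooth_on V (\<eta> \<circ> \<psi>)" using unit_normal \<psi> unfolding unit_normal_def by simp
  fix v assume v: "v \<in> V"
  note z = \<iota>_in[OF g(8)[OF v]]
  have n: "fubini_study (\<iota> (\<psi> v)) (\<eta> (\<psi> v)) (\<eta> (\<psi> v)) = 1"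
    "\<And>w. w \<in> tangent_space X \<iota> (\<psi> v) \<Longrightarrow> fubini_study (\<iota> (\<psi> v)) (\<eta> (\<psi> v)) w = 0"
    using unit_normal g(8)[OF v] unfolding unit_normal_def by simp_all
  show "sec.X ((\<eta> \<circ> \<psi>) v) (coord \<psi> v) \<bullet> sec.X ((\<eta> \<circ> \<psi>) v) (coord \<psi> v) = 1"
    using n(1) unfolding fubini_study_eq[OF z] comp_apply .
  show "a = 0" if "dirder a (coord \<psi>) v = 0" for a
    using that g(6)[OF v] unfolding dirder_def
      linear_injective_0[OF linear_frechet_derivative[OF smooth_on_imp_differentiable[OF g(5) v]]] by blast
  show "sec.X ((\<eta> \<circ> \<psi>) v) (coord \<psi> v) \<bullet> sec.X (dirder a (coord \<psi>) v) (coord \<psi> v) = 0" for a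
  proof -
    obtain \<phi> u T where p:
    "param_at X \<iota> (\<psi> v) = (\<phi>, u)" "coord \<phi> u = coord \<psi> v" "(\<eta> \<circ> \<phi>) u = (\<eta> \<circ> \<psi>) v"
    "linear T" "inj T" "inj (dparam_at X \<iota> (\<psi> v))"
    "\<forall>b. dirder b (coord \<psi>) v = dirder (T b) (coord \<phi>) u"
    "\<forall>b. dirder b (coord \<psi>) v = dparam_at X \<iota> (\<psi> v) (T b)"
    "\<forall>b. dirder b (\<eta> \<circ> \<psi>) v = dirder (T b) (\<eta> \<circ> \<phi>) u"
    using param_compare[OF \<psi> v] by (elim exE conjE) (rule that)
    have "dirder a (coord \<psi>) v \<in> tangent_space X \<iota> (\<psi> v)" unfolding tangent_space_def p(8)[rule_format] by (rule rangeI)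
    from n(2)[OF this] show ?thesis unfolding fubini_study_eq[OF z] comp_apply .
  qed
qed

text \<open>The two coordinate matrices of L are conjugate by T, and the trace is invariant under
  conjugation.\<close>

lemma tangent_trace_eq:
  assumes \<psi>: "local_param X \<iota> V \<psi>" and v: "v \<in> V" and S: "linear S"
    and L: "\<And>b. L (dirder b (coord \<psi>) v) = dirder (S b) (coord \<psi>) v"
  shows "tangent_trace X \<iota> (\<psi> v) L = trace (matrix S)"
proof -
  obtain \<phi> u T where p:
    "param_at X \<iota> (\<psi> v) = (\<phi>, u)" "coord \<phi> u = coord \<psi> v" "(\<eta> \<circ> \<phi>) u = (\<eta> \<circ> \<psi>) v"
    "linear T" "inj T" "inj (dparam_at X \<iota> (\<psi> v))"
    "\<forall>b. dirder b (coord \<psi>) v = dirder (T b) (coord \<phi>) u"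
    "\<forall>b. dirder b (coord \<psi>) v = dparam_at X \<iota> (\<psi> v) (T b)"
    "\<forall>b. dirder b (\<eta> \<circ> \<psi>) v = dirder (T b) (\<eta> \<circ> \<phi>) u"
    using param_compare[OF \<psi> v] by (elim exE conjE) (rule that)
  note T = p(4,5,6) p(8)[rule_format]
  obtain T' where T': "linear T'" "\<And>x. T' (T x) = x" "\<And>x. T (T' x) = x"
    using linear_injective_isomorphism[OF T(1,2)] by blast
  have "inv (dparam_at X \<iota> (\<psi> v)) \<circ> L \<circ> dparam_at X \<iota> (\<psi> v) = T \<circ> (S \<circ> T')"
  proof
    fix c
    have "L (dparam_at X \<iota> (\<psi> v) (T (T' c))) = dparam_at X \<iota> (\<psi> v) (T (S (T' c)))"
      by (simp only: T(4)[symmetric] L)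
    then have "L (dparam_at X \<iota> (\<psi> v) c) = dparam_at X \<iota> (\<psi> v) (T (S (T' c)))"
      unfolding T'(3) .
    then show "(inv (dparam_at X \<iota> (\<psi> v)) \<circ> L \<circ> dparam_at X \<iota> (\<psi> v)) c = (T \<circ> (S \<circ> T')) c"
      by (simp add: inv_f_f[OF T(3)])
  qed
  then have "tangent_trace X \<iota> (\<psi> v) L = trace (matrix T ** matrix (S \<circ> T'))"
    by (simp add: tangent_trace_def matrix_compose linear_compose T(1) T'(1) S)
  also have "\<dots> = trace (matrix (S \<circ> T') ** matrix T)" by (rule trace_mul_sym)
  also have "\<dots> = trace (matrix ((S \<circ> T') \<circ> T))"
    by (simp add: matrix_compose linear_compose T(1) T'(1) S)
  also have "(S \<circ> T') \<circ> T = S" by (simp add: fun_eq_iff T'(2))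
  finally show ?thesis .
qed

lemma shape_op_eq:
  assumes \<psi>: "local_param X \<iota> V \<psi>" and v: "v \<in> V"
  shows "shape_op X \<iota> \<eta> (\<psi> v) (dirder b (coord \<psi>) v)
    = dirder (chart_hypersurface.shape (coord \<psi>) (\<eta> \<circ> \<psi>) v b) (coord \<psi>) v"
proof -
  interpret C: chart_hypersurface V "coord \<psi>" "\<eta> \<circ> \<psi>" by (rule chart_hypersurface[OF \<psi>])
  obtain \<phi> u T where p:
    "param_at X \<iota> (\<psi> v) = (\<phi>, u)" "coord \<phi> u = coord \<psi> v" "(\<eta> \<circ> \<phi>) u = (\<eta> \<circ> \<psi>) v"
    "linear T" "inj T" "inj (dparam_at X \<iota> (\<psi> v))"
    "\<forall>b. dirder b (coord \<psi>) v = dirder (T b) (coord \<phi>) u"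
    "\<forall>b. dirder b (coord \<psi>) v = dparam_at X \<iota> (\<psi> v) (T b)"
    "\<forall>b. dirder b (\<eta> \<circ> \<psi>) v = dirder (T b) (\<eta> \<circ> \<phi>) u"
    using param_compare[OF \<psi> v] by (elim exE conjE) (rule that)
  have "shape_op X \<iota> \<eta> (\<psi> v) (dirder b (coord \<psi>) v) = - cov_deriv_along fs_matrix (coord \<phi>) (\<eta> \<circ> \<phi>) u (T b)"
    unfolding shape_op_def p(1) prod.case p(8)[rule_format] inv_f_f[OF p(6)] ..
  also have "cov_deriv_along fs_matrix (coord \<phi>) (\<eta> \<circ> \<phi>) u (T b) = cov_deriv_along fs_matrix (coord \<psi>) (\<eta> \<circ> \<psi>) v b"
    unfolding cov_deriv_along_def dirder_def[symmetric] p(2,3) p(7)[rule_format, symmetric] p(9)[rule_format, symmetric] ..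
  finally show ?thesis unfolding C.cov_deriv_normal[OF v] .
qed

text \<open>Since each point brings its own chosen parametrization, H in the coordinates of a fixed
  one is not visibly smooth. This identifies it with a smooth function on the whole parameter
  domain.\<close>

lemma mean_curv_eq:
  assumes \<psi>: "local_param X \<iota> V \<psi>" and v: "v \<in> V"
  shows "mean_curv X \<iota> \<eta> (\<psi> v) = meanc \<psi> v / 5"
    and "shape_norm_sq X \<iota> \<eta> (\<psi> v) = sphere_hypersurface.trA2 oct_J (pos \<psi>) (nrm \<psi>) v"
proof -
  interpret C: chart_hypersurface V "coord \<psi>" "\<eta> \<circ> \<psi>" by (rule chart_hypersurface[OF \<psi>])
  show "mean_curv X \<iota> \<eta> (\<psi> v) = meanc \<psi> v / 5"
    unfolding mean_curv_def
    by (subst tangent_trace_eq[OF \<psi> v C.linear_shape[OF v] shape_op_eq[OF \<psi> v]]) (simp add: C.trace_shape)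
  show "shape_norm_sq X \<iota> \<eta> (\<psi> v) = sphere_hypersurface.trA2 oct_J (pos \<psi>) (nrm \<psi>) v"
    unfolding shape_norm_sq_def
    by (subst tangent_trace_eq[OF \<psi> v linear_compose[OF C.linear_shape[OF v] C.linear_shape[OF v]]])
      (simp_all add: shape_op_eq[OF \<psi> v] C.trace_shape_sq[OF v])
qed

text \<open>The gradient of \<open>5 H\<close> as a horizontal vector of \<open>\<real>\<^sup>8\<close>.\<close>

definition meanc_grad :: "(real^5 \<Rightarrow> 'm) \<Rightarrow> real^5 \<Rightarrow> octonion" where
  "meanc_grad \<phi> u = (\<Sum>l\<in>UNIV. dirder (axis l 1) (meanc \<phi>) u *\<^sub>R sphere_immersion.dual oct_J (pos \<phi>) l u)"

text \<open>Both terms are reduced to the pairing of one horizontal vector with W, in the chosen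
  parametrization. The factor 1/5 reflects that \<open>meanc_grad\<close> lifts the gradient of 5
  H.\<close>

lemma Gauss_laplace_local:
  assumes \<phi>: "local_param X \<iota> U \<phi>" and u: "u \<in> U" and p: "param_at X \<iota> p = (\<phi>, u)" "\<phi> u = p"
  shows "hs_vec_laplace X \<iota> (Gauss_map \<iota> \<eta>) p $ i =
      - (meanc_grad \<phi> u \<bullet> oct_W (oct_emb (axis i 1)) (pos \<phi> u))
      - (8 + shape_norm_sq X \<iota> \<eta> p) * Gauss_map \<iota> \<eta> p $ i"
    and "Gauss_transl (\<iota> p) (hs_grad X \<iota> (mean_curv X \<iota> \<eta>) p) $ i
      = (meanc_grad \<phi> u \<bullet> oct_W (oct_emb (axis i 1)) (pos \<phi> u)) / 5"
proof -
  interpret C: chart_hypersurface U "coord \<phi>" "\<eta> \<circ> \<phi>" by (rule chart_hypersurface[OF \<phi>])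
  let ?W = "oct_W (oct_emb (axis i 1))" let ?H = "mean_curv X \<iota> \<eta>"
  have z: "\<iota> (\<phi> v) \<in> CP3 - CP2" if "v \<in> U" for v
    using local_paramD(8)[OF \<phi> that] \<iota>_in by blast
  have met: "induced_metric \<iota> \<phi> v = C.gram v" if "v \<in> U" for v
    unfolding induced_metric_def C.gram_def fubini_study_eq[OF z[OF that]] C.X_eq[OF that] dirder_def by simp
  have f: "Gauss_map \<iota> \<eta> (\<phi> v) $ i = nrm \<phi> v \<bullet> ?W (pos \<phi> v)" if "v \<in> U" for v
    unfolding Gauss_map_def Gauss_transl_nth[OF z[OF that]] by simp
  have grad: "meanc_grad \<phi> u \<bullet> w = (\<Sum>l\<in>UNIV. (C.dual l u \<bullet> w) * C.dd l C.trA u)" for w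
    by (simp add: meanc_grad_def inner_sum_left mult.commute)
  have "hs_vec_laplace X \<iota> (Gauss_map \<iota> \<eta>) p $ i = claplace (induced_metric \<iota> \<phi>) ((\<lambda>q. Gauss_map \<iota> \<eta> q $ i) \<circ> \<phi>) u"
    by (simp add: hs_vec_laplace_def hs_laplace_def p(1))
  also have "\<dots> = claplace C.gram (\<lambda>u. nrm \<phi> u \<bullet> ?W (pos \<phi> u)) u"
    by (rule claplace_cong[OF C.open_U u]) (simp_all only: met f comp_apply)
  also have "\<dots> = - (meanc_grad \<phi> u \<bullet> ?W (pos \<phi> u)) - (8 + C.trA2 u) * (nrm \<phi> u \<bullet> ?W (pos \<phi> u))"
    unfolding C.laplace_support[OF u] grad by simp
  finally show "hs_vec_laplace X \<iota> (Gauss_map \<iota> \<eta>) p $ i = - (meanc_grad \<phi> u \<bullet> ?W (pos \<phi> u))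
      - (8 + shape_norm_sq X \<iota> \<eta> p) * Gauss_map \<iota> \<eta> p $ i"
    using f[OF u] mean_curv_eq(2)[OF \<phi> u] by (simp add: p(2))
  let ?b = "cgrad (induced_metric \<iota> \<phi>) (?H \<circ> \<phi>) u"
  have dH: "C.dd k (?H \<circ> \<phi>) u = C.dd k C.trA u / 5" for k
  proof -
    have "C.dd k (?H \<circ> \<phi>) u = C.dd k (\<lambda>v. C.trA v / 5) u"
      by (rule dirder_cong[OF C.open_U u]) (simp only: comp_apply mean_curv_eq(1)[OF \<phi>])
    also have "\<dots> = C.dd k C.trA u / 5"
      by (rule dirder_bounded_linear[OF bounded_linear_divide smooth_on_imp_differentiable[OF C.smooth_trA u]])
    finally show ?thesis .
  qed
  have "?b = cgrad C.gram (?H \<circ> \<phi>) u" unfolding cgrad_def met[OF u] ..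
  then have "C.X ?b u \<bullet> w = (meanc_grad \<phi> u \<bullet> w) / 5" for w
    by (simp only: C.X_cgrad[OF u] dH grad times_divide_eq_right sum_divide_distrib)
  moreover have "Gauss_transl (\<iota> p) (hs_grad X \<iota> ?H p) $ i = C.X ?b u \<bullet> ?W (pos \<phi> u)"
    unfolding hs_grad_def p(1) prod.case dparam_at_def p(2)[symmetric] Gauss_transl_nth[OF z[OF u]] C.X_eq[OF u]
    unfolding p(2) p(1) prod.case dirder_def comp_apply ..
  ultimately show "Gauss_transl (\<iota> p) (hs_grad X \<iota> ?H p) $ i = (meanc_grad \<phi> u \<bullet> ?W (pos \<phi> u)) / 5" by simp
qed

end

section \<open>From the equation for the Gauss map to constant mean curvature\<close>

text \<open>Every set defined by a condition on the value of f is open, so a level set is open and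
  closed.\<close>

lemma locally_constant_imp_constant_on:
  assumes X: "connected_space X"
    and loc: "\<And>p. p \<in> topspace X \<Longrightarrow> \<exists>O'. openin X O' \<and> p \<in> O' \<and> (\<forall>q\<in>O'. f q = f p)"
  shows "f constant_on topspace X"
proof (cases "topspace X = {}")
  case True
  then show ?thesis by (simp add: constant_on_def)
next
  case False
  then obtain p0 where p0: "p0 \<in> topspace X" by blast
  have op: "openin X {q \<in> topspace X. P (f q)}" for P
  proof (subst openin_subopen, intro ballI)
    fix q assume q: "q \<in> {q \<in> topspace X. P (f q)}"
    then have "q \<in> topspace X" by simp
    from loc[OF this] obtain O' where O': "openin X O'" "q \<in> O'" "\<forall>q'\<in>O'. f q' = f q" by (elim exE conjE)
    have "O' \<subseteq> {q \<in> topspace X. P (f q)}"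
    proof
      fix q' assume q': "q' \<in> O'"
      then have "f q' = f q" using O'(3) by blast
      then show "q' \<in> {q \<in> topspace X. P (f q)}" using q q' openin_subset[OF O'(1)] by auto
    qed
    with O'(1,2) show "\<exists>T. openin X T \<and> q \<in> T \<and> T \<subseteq> {q \<in> topspace X. P (f q)}" by blast
  qed
  have "topspace X - {q \<in> topspace X. f q = f p0} = {q \<in> topspace X. f q \<noteq> f p0}" by auto
  then have "openin X {q \<in> topspace X. f q = f p0}" "openin X (topspace X - {q \<in> topspace X. f q = f p0})"
    using op[of "\<lambda>y. y = f p0"] op[of "\<lambda>y. y \<noteq> f p0"] by simp_all
  then have "closedin X {q \<in> topspace X. f q = f p0} \<and> openin X {q \<in> topspace X. f q = f p0}"
    by (simp add: closedin_def)
  then have "{q \<in> topspace X. f q = f p0} = {} \<or> {q \<in> topspace X. f q = f p0} = topspace X"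
    using X unfolding connected_space_clopen_in by blast
  then show ?thesis using p0 unfolding constant_on_def by blast
qed

context oriented_hypersurface
begin

lemma Gauss_laplace:
  assumes "p \<in> topspace X"
  shows "hs_vec_laplace X \<iota> (Gauss_map \<iota> \<eta>) p =
    - 5 *\<^sub>R Gauss_transl (\<iota> p) (hs_grad X \<iota> (mean_curv X \<iota> \<eta>) p)
    - (8 + shape_norm_sq X \<iota> \<eta> p) *\<^sub>R Gauss_map \<iota> \<eta> p"
proof -
  obtain U \<phi> u where p: "param_at X \<iota> p = (\<phi>, u)" "local_param X \<iota> U \<phi>" "u \<in> U" "\<phi> u = p"
    by (rule param_at_cases[OF assms])
  show ?thesis
    unfolding vec_eq_iff by (simp add: Gauss_laplace_local[OF p(2,3,1,4)])
qed

lemma dirder_mean_curv: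
  assumes \<phi>: "local_param X \<iota> U \<phi>" and u: "u \<in> U"
  shows "(mean_curv X \<iota> \<eta> \<circ> \<phi>) differentiable (at u)"
    and "dirder a (mean_curv X \<iota> \<eta> \<circ> \<phi>) u = dirder a (meanc \<phi>) u / 5"
proof -
  interpret C: chart_hypersurface U "coord \<phi>" "\<eta> \<circ> \<phi>" by (rule chart_hypersurface[OF \<phi>])
  have d: "((\<lambda>v. C.trA v / 5) has_derivative (\<lambda>a. dirder a C.trA u / 5)) (at u)"
    by (rule bounded_linear.has_derivative[OF bounded_linear_divide
        has_derivative_dirder[OF smooth_on_imp_differentiable[OF C.smooth_trA u]]])
  have "((mean_curv X \<iota> \<eta> \<circ> \<phi>) has_derivative (\<lambda>a. dirder a C.trA u / 5)) (at u)"
    by (rule has_derivative_transform_within_open[OF d C.open_U u]) (simp only: comp_apply mean_curv_eq(1)[OF \<phi>])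
  then show "(mean_curv X \<iota> \<eta> \<circ> \<phi>) differentiable (at u)"
    "dirder a (mean_curv X \<iota> \<eta> \<circ> \<phi>) u = dirder a (meanc \<phi>) u / 5"
    by (rule differentiableI, rule dirder_eq)
qed

lemma constant_mean_curv_imp:
  assumes c: "mean_curv X \<iota> \<eta> constant_on topspace X" and "p \<in> topspace X"
  shows "Gauss_transl (\<iota> p) (hs_grad X \<iota> (mean_curv X \<iota> \<eta>) p) = 0"
proof -
  obtain U \<phi> u where p: "param_at X \<iota> p = (\<phi>, u)" "local_param X \<iota> U \<phi>" "u \<in> U" "\<phi> u = p"
    by (rule param_at_cases[OF assms(2)])
  obtain k where k: "\<And>q. q \<in> topspace X \<Longrightarrow> mean_curv X \<iota> \<eta> q = k"
    using c unfolding constant_on_def by blast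
  have "dirder a (mean_curv X \<iota> \<eta> \<circ> \<phi>) u = dirder a (\<lambda>_. k) u" for a
    by (rule dirder_cong[OF local_paramD(1)[OF p(2)] p(3)]) (simp add: k local_paramD(8)[OF p(2)])
  then have "dirder a (meanc \<phi>) u = 0" for a using dirder_mean_curv(2)[OF p(2,3)] by simp
  then have "meanc_grad \<phi> u = 0" unfolding meanc_grad_def by simp
  then show ?thesis unfolding vec_eq_iff Gauss_laplace_local(2)[OF p(2,3,1,4)] by simp
qed

text \<open>Off the geodesic sphere the vanishing is read off in the parametrization chosen at each
  point and carried over by a transition. A whole fixed parametrization is treated because
  \<open>trA_critical\<close> needs the vanishing at all nearby points outside the sphere, not at
  one point.\<close>

lemma mean_curv_critical:
  assumes "\<And>p. p \<in> topspace X \<Longrightarrow> Gauss_transl (\<iota> p) (hs_grad X \<iota> (mean_curv X \<iota> \<eta>) p) = 0"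
    and \<psi>: "local_param X \<iota> V \<psi>" and v: "v \<in> V"
  shows "dirder a (meanc \<psi>) v = 0"
proof -
  have "dirder a (meanc \<psi>) v = 0" if v: "v \<in> V" and ne: "coord \<psi> v \<bullet> coord \<psi> v \<noteq> 1" for v a
  proof -
    let ?p = "\<psi> v"
    note pX = local_paramD(8)[OF \<psi> v]
    obtain U \<phi> u where p: "param_at X \<iota> ?p = (\<phi>, u)" "local_param X \<iota> U \<phi>" "u \<in> U" "\<phi> u = ?p"
      by (rule param_at_cases[OF pX])
    interpret C: chart_hypersurface U "coord \<phi>" "\<eta> \<circ> \<phi>" by (rule chart_hypersurface[OF p(2)])
    have "coord \<phi> u = coord \<psi> v" unfolding comp_apply p(4) ..
    then have ne': "coord \<phi> u \<bullet> coord \<phi> u \<noteq> 1" using ne by simp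
    have "meanc_grad \<phi> u = 0"
    proof (rule oct_W_kernel[OF _ _ ne'])
      show "meanc_grad \<phi> u \<bullet> pos \<phi> u = 0" "meanc_grad \<phi> u \<bullet> oct_J (pos \<phi> u) = 0"
        unfolding meanc_grad_def inner_sum_left inner_scaleR_left C.hfieldD(1,2)[OF C.hfield_dual p(3)] by simp_all
      show "meanc_grad \<phi> u \<bullet> oct_W (oct_emb (axis i 1)) (pos \<phi> u) = 0" for i
        using Gauss_laplace_local(2)[OF p(2,3,1,4), of i] unfolding assms(1)[OF pX] by simp
    qed
    then have z: "C.dd k (meanc \<phi>) u = 0" for k
    proof -
      assume "meanc_grad \<phi> u = 0"
      then have "0 = meanc_grad \<phi> u \<bullet> C.XX k u" by simp
      also have "\<dots> = (\<Sum>l\<in>UNIV. C.dd l (meanc \<phi>) u * (if l = k then 1 else 0))"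
        unfolding meanc_grad_def inner_sum_left inner_scaleR_left C.dual_X[OF p(3)] ..
      finally show ?thesis by (simp add: sum_mult_delta)
    qed
    have l: "linear (\<lambda>a. dirder a (meanc \<phi>) u)"
      by (rule linear_dirder[OF smooth_on_imp_differentiable[OF C.smooth_trA p(3)]])
    have z: "dirder a (meanc \<phi>) u = 0" for a
    proof -
      have "dirder a (meanc \<phi>) u = (\<Sum>i\<in>UNIV. a $ i *\<^sub>R C.dd i (meanc \<phi>) u)"
        by (rule C.linear_expand[OF l])
      also have "\<dots> = 0" by (simp only: z) simp
      finally show ?thesis .
    qed
    obtain T where T: "transition \<psi> v \<phi> u T"
      using transition_exists[OF \<psi> p(2) v p(3) p(4)[symmetric]] by blast
    have "dirder a (mean_curv X \<iota> \<eta> \<circ> \<psi>) v = 0"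
      unfolding transition_dirder[OF T dirder_mean_curv(1)[OF p(2,3)]] dirder_mean_curv(2)[OF p(2,3)] z by simp
    then show ?thesis unfolding dirder_mean_curv(2)[OF \<psi> v] by simp
  qed
  then show ?thesis
    by (rule chart_hypersurface.trA_critical[OF chart_hypersurface[OF \<psi>] _ v])
qed

lemma constant_mean_curvI:
  assumes X: "connected_space X"
    and crit: "\<And>p. p \<in> topspace X \<Longrightarrow> Gauss_transl (\<iota> p) (hs_grad X \<iota> (mean_curv X \<iota> \<eta>) p) = 0"
  shows "mean_curv X \<iota> \<eta> constant_on topspace X"
proof (rule locally_constant_imp_constant_on[OF X])
  fix p assume "p \<in> topspace X"
  then obtain U \<phi> u where p: "param_at X \<iota> p = (\<phi>, u)" "local_param X \<iota> U \<phi>" "u \<in> U" "\<phi> u = p"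
    by (rule param_at_cases)
  obtain r where r: "r > 0" "ball u r \<subseteq> U" using local_paramD(1)[OF p(2)] p(3) openE by blast
  let ?h = "mean_curv X \<iota> \<eta> \<circ> \<phi>"
  have "(?h has_derivative (\<lambda>_. 0)) (at v within ball u r)" if "v \<in> ball u r" for v
  proof -
    have v: "v \<in> U" using that r by blast
    have "dirder a (meanc \<phi>) v = 0" for a
      using crit p(2) v by (rule mean_curv_critical)
    then have "dirder a ?h v = 0" for a
      unfolding dirder_mean_curv(2)[OF p(2) v] by simp
    then have "(?h has_derivative (\<lambda>_. 0)) (at v)"
      using has_derivative_dirder[OF dirder_mean_curv(1)[OF p(2) v]] by simp
    then show ?thesis by (rule has_derivative_at_withinI)
  qed
  then obtain k where k: "\<And>v. v \<in> ball u r \<Longrightarrow> ?h v = k"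
    using has_derivative_zero_constant[OF convex_ball, of u r ?h] by blast
  have "openin X (\<phi> ` ball u r)" by (rule local_paramD(7)[OF p(2) r(2) open_ball])
  moreover have "p \<in> \<phi> ` ball u r" using p(4) r(1) by (intro image_eqI[of _ _ u]) simp_all
  moreover have "mean_curv X \<iota> \<eta> q = mean_curv X \<iota> \<eta> p" if q: "q \<in> \<phi> ` ball u r" for q
  proof -
    obtain v where v: "q = \<phi> v" "v \<in> ball u r" using q by (rule imageE)
    show ?thesis using k[OF v(2)] k[of u] r(1) p(4) v(1) by simp
  qed
  ultimately show "\<exists>O'. openin X O' \<and> p \<in> O' \<and> (\<forall>q\<in>O'. mean_curv X \<iota> \<eta> q = mean_curv X \<iota> \<eta> p)" by blast
qed

end

theorem theorem13:
  fixes X :: "'m topology" and \<iota> :: "'m \<Rightarrow> octonion set" and \<eta> :: "'m \<Rightarrow> real^6"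
  assumes "hypersurface X \<iota>" and "connected_space X" and "orientable X \<iota>"
    and "unit_normal X \<iota> \<eta>"
  shows "(\<forall>p\<in>topspace X.
            hs_vec_laplace X \<iota> (Gauss_map \<iota> \<eta>) p =
              - 5 *\<^sub>R Gauss_transl (\<iota> p) (hs_grad X \<iota> (mean_curv X \<iota> \<eta>) p)
              - (8 + shape_norm_sq X \<iota> \<eta> p) *\<^sub>R Gauss_map \<iota> \<eta> p) \<and>
         (mean_curv X \<iota> \<eta> constant_on topspace X \<longleftrightarrow>
          (\<forall>p\<in>topspace X.
            hs_vec_laplace X \<iota> (Gauss_map \<iota> \<eta>) p =
              - (8 + shape_norm_sq X \<iota> \<eta> p) *\<^sub>R Gauss_map \<iota> \<eta> p))"
proof -
  interpret oriented_hypersurface X \<iota> \<eta> using assms by unfold_locales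
  \<comment> \<open>By the general formula the equation says precisely that the Gauss translation
    annihilates grad H.\<close>
  have "hs_vec_laplace X \<iota> (Gauss_map \<iota> \<eta>) p = - (8 + shape_norm_sq X \<iota> \<eta> p) *\<^sub>R Gauss_map \<iota> \<eta> p
      \<longleftrightarrow> Gauss_transl (\<iota> p) (hs_grad X \<iota> (mean_curv X \<iota> \<eta>) p) = 0" if "p \<in> topspace X" for p
  proof -
    have "- 5 *\<^sub>R a - c *\<^sub>R b = - c *\<^sub>R b \<longleftrightarrow> a = 0" for a b :: "real^6" and c by simp
    then show ?thesis unfolding Gauss_laplace[OF that] .
  qed
  then show ?thesis
    using Gauss_laplace constant_mean_curv_imp constant_mean_curvI[OF assms(2)] by blast
qed

end
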